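(* Let $k$ be a field, let $S=k[\![x_0,\ldots,x_n]\!]$, let $f\in(x_0,\ldots,x_n)$, and put $R=S/(f)$. Let $S^\sharp=S[\![y]\!]$ and let $R^\sharp=S^\sharp/(f+y^m)$, called the $m$-branched cover of $R$. Let $\pi:R^\sharp\to R$ be the natural surjection, given by $R\cong R^\sharp/(y)$. Then $$\pi(\mathrm{ca}(R^\sharp))\subseteq \mathrm{ca}(R).$$ When $m=2$, the equality $\pi(\mathrm{ca}(R^\sharp))=\mathrm{ca}(R)$ holds.
   Context: For a commutative Noetherian ring $A$, the $i$th cohomology annihilator is $\mathrm{ca}^i(A)=\bigcap_{M,N}\mathrm{ann}_A\mathrm{Ext}_A^i(M,N)$, the intersection running over all finitely generated $A$-modules $M,N$, and the cohomology annihilator of $A$ is the ideal $\mathrm{ca}(A)=\bigcup_{i\ge 0}\mathrm{ca}^i(A)$.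
   Formalization: The inclusion is stated for m ≥ 2 (it fails for m = 1, f = x², and π does not exist for m = 0); the equality for m = 2 additionally assumes f ≠ 0 and char k ≠ 2 (it fails for f = 0, and in characteristic 2 for f = a² in k[[a,b]]). *)

theory Defs
  imports "HOL-Algebra.Algebra"
begin

section \<open>Formal power series\<close>

text \<open>
  As in the library's indexed polynomials, a monomial in the variables \<open>I\<close> is a multiset over
  \<open>I\<close>, and a power series is the function sending each monomial to its coefficient. The
  constants \<open>ring.indexed_const\<close> and \<open>ring.indexed_var\<close> of that theory give the constant
  series and the variables. The definition is meant for finite \<open>I\<close>.
\<close>

definition power_series_ring :: "('a, 'e) ring_scheme \<Rightarrow> 'i set \<Rightarrow> ('i multiset \<Rightarrow> 'a) ring" where
  "power_series_ring A I =
    \<lparr>carrier = {p. (\<forall>m. p m \<in> carrier A) \<and> (\<forall>m. \<not> set_mset m \<subseteq> I \<longrightarrow> p m = \<zero>\<^bsub>A\<^esub>)},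
     monoid.mult = (\<lambda>p q m. \<Oplus>\<^bsub>A\<^esub>u\<in>{u. u \<subseteq># m}. p u \<otimes>\<^bsub>A\<^esub> q (m - u)),
     one = ring.indexed_const A \<one>\<^bsub>A\<^esub>,
     ring.zero = (\<lambda>m. \<zero>\<^bsub>A\<^esub>),
     ring.add = (\<lambda>p q m. p m \<oplus>\<^bsub>A\<^esub> q m)\<rparr>"

section \<open>Modules\<close>

text \<open>
  The library's module records extend ring records; the fields \<open>mult\<close> and \<open>one\<close> play no role
  in a module and are left unspecified.
\<close>

definition finitely_generated_module ::
    "('a, 'e) ring_scheme \<Rightarrow> ('a, 'm, 'x) module_scheme \<Rightarrow> bool" where
  "finitely_generated_module A M \<longleftrightarrow> module A M \<and>
    (\<exists>B. finite B \<and> B \<subseteq> carrier M \<and> (\<forall>U. submodule U A M \<and> B \<subseteq> U \<longrightarrow> U = carrier M))"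

definition module_homs ::
    "('a, 'e) ring_scheme \<Rightarrow> ('a, 'm, 'x) module_scheme \<Rightarrow> ('a, 'n, 'y) module_scheme \<Rightarrow>
      ('m \<Rightarrow> 'n) set" where
  "module_homs A M N = {h \<in> carrier M \<rightarrow>\<^sub>E carrier N.
    (\<forall>x\<in>carrier M. \<forall>y\<in>carrier M. h (x \<oplus>\<^bsub>M\<^esub> y) = h x \<oplus>\<^bsub>N\<^esub> h y) \<and>
    (\<forall>a\<in>carrier A. \<forall>x\<in>carrier M. h (a \<odot>\<^bsub>M\<^esub> x) = a \<odot>\<^bsub>N\<^esub> h x)}"

definition hom_module ::
    "('a, 'e) ring_scheme \<Rightarrow> ('a, 'm, 'x) module_scheme \<Rightarrow> ('a, 'n, 'y) module_scheme \<Rightarrow>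
      ('a, 'm \<Rightarrow> 'n) module" where
  "hom_module A M N =
    \<lparr>carrier = module_homs A M N, monoid.mult = undefined, one = undefined,
     ring.zero = (\<lambda>x\<in>carrier M. \<zero>\<^bsub>N\<^esub>),
     ring.add = (\<lambda>g h. \<lambda>x\<in>carrier M. g x \<oplus>\<^bsub>N\<^esub> h x),
     smult = (\<lambda>a h. \<lambda>x\<in>carrier M. a \<odot>\<^bsub>N\<^esub> h x)\<rparr>"

definition free_module :: "('a, 'e) ring_scheme \<Rightarrow> nat \<Rightarrow> ('a, nat \<Rightarrow> 'a) module" where
  "free_module A r =
    \<lparr>carrier = {..<r} \<rightarrow>\<^sub>E carrier A, monoid.mult = undefined, one = undefined,
     ring.zero = (\<lambda>i\<in>{..<r}. \<zero>\<^bsub>A\<^esub>),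
     ring.add = (\<lambda>v w. \<lambda>i\<in>{..<r}. v i \<oplus>\<^bsub>A\<^esub> w i),
     smult = (\<lambda>a v. \<lambda>i\<in>{..<r}. a \<otimes>\<^bsub>A\<^esub> v i)\<rparr>"

text \<open>Scalar multiplication on cosets follows the style of \<^const>\<open>rcoset_mult\<close>.\<close>

definition quotient_module ::
    "('a, 'm, 'x) module_scheme \<Rightarrow> 'm set \<Rightarrow> ('a, 'm set) module" where
  "quotient_module M U =
    \<lparr>carrier = a_rcosets\<^bsub>M\<^esub> U, monoid.mult = undefined, one = undefined,
     ring.zero = U,
     ring.add = set_add M,
     smult = (\<lambda>a C. \<Union>x\<in>C. U +>\<^bsub>M\<^esub> (a \<odot>\<^bsub>M\<^esub> x))\<rparr>"

definition module_ann :: "('a, 'e) ring_scheme \<Rightarrow> ('a, 'm, 'x) module_scheme \<Rightarrow> 'a set" where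
  "module_ann A M = {a \<in> carrier A. \<forall>x\<in>carrier M. a \<odot>\<^bsub>M\<^esub> x = \<zero>\<^bsub>M\<^esub>}"

section \<open>Ext\<close>

text \<open>
  A resolution of \<open>M\<close> by finite free modules
  \<open>\<dots> \<longrightarrow> A^(r 2) \<longrightarrow> A^(r 1) \<longrightarrow> A^(r 0) \<longrightarrow> M \<longrightarrow> 0\<close>, with differentials
  \<open>d j : A^(r (j + 1)) \<longrightarrow> A^(r j)\<close> and augmentation \<open>e\<close>. It exists whenever \<open>A\<close> is Noetherian
  and \<open>M\<close> is finitely generated, which is the only case in which Ext is used below.
\<close>

definition free_resolution ::
    "('a, 'e) ring_scheme \<Rightarrow> ('a, 'm, 'x) module_scheme \<Rightarrow> (nat \<Rightarrow> nat) \<Rightarrow>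
      (nat \<Rightarrow> (nat \<Rightarrow> 'a) \<Rightarrow> (nat \<Rightarrow> 'a)) \<Rightarrow> ((nat \<Rightarrow> 'a) \<Rightarrow> 'm) \<Rightarrow> bool" where
  "free_resolution A M r d e \<longleftrightarrow>
    e \<in> module_homs A (free_module A (r 0)) M \<and>
    (\<forall>j. d j \<in> module_homs A (free_module A (r (Suc j))) (free_module A (r j))) \<and>
    e ` carrier (free_module A (r 0)) = carrier M \<and>
    d 0 ` carrier (free_module A (r 1)) = a_kernel (free_module A (r 0)) M e \<and>
    (\<forall>j. d (Suc j) ` carrier (free_module A (r (Suc (Suc j)))) =
      a_kernel (free_module A (r (Suc j))) (free_module A (r j)) (d j))"

text \<open>Cocycles and coboundaries of the complex \<open>Hom(A^(r i), N)\<close>.\<close>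

definition ext_cocycles ::
    "('a, 'e) ring_scheme \<Rightarrow> (nat \<Rightarrow> nat) \<Rightarrow> (nat \<Rightarrow> (nat \<Rightarrow> 'a) \<Rightarrow> (nat \<Rightarrow> 'a)) \<Rightarrow>
      ('a, 'n, 'y) module_scheme \<Rightarrow> nat \<Rightarrow> ((nat \<Rightarrow> 'a) \<Rightarrow> 'n) set" where
  "ext_cocycles A r d N i = {h \<in> module_homs A (free_module A (r i)) N.
    \<forall>v\<in>carrier (free_module A (r (Suc i))). h (d i v) = \<zero>\<^bsub>N\<^esub>}"

definition ext_coboundaries ::
    "('a, 'e) ring_scheme \<Rightarrow> (nat \<Rightarrow> nat) \<Rightarrow> (nat \<Rightarrow> (nat \<Rightarrow> 'a) \<Rightarrow> (nat \<Rightarrow> 'a)) \<Rightarrow>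
      ('a, 'n, 'y) module_scheme \<Rightarrow> nat \<Rightarrow> ((nat \<Rightarrow> 'a) \<Rightarrow> 'n) set" where
  "ext_coboundaries A r d N i =
    (case i of
      0 \<Rightarrow> {\<lambda>v\<in>carrier (free_module A (r 0)). \<zero>\<^bsub>N\<^esub>}
    | Suc j \<Rightarrow> (\<lambda>h. compose (carrier (free_module A (r (Suc j)))) h (d j)) `
        module_homs A (free_module A (r j)) N)"

text \<open>
  \<open>Ext A i M N\<close> is computed from one chosen resolution of \<open>M\<close>; up to isomorphism the choice is
  immaterial.
\<close>

definition Ext ::
    "('a, 'e) ring_scheme \<Rightarrow> nat \<Rightarrow> ('a, 'm, 'x) module_scheme \<Rightarrow> ('a, 'n, 'y) module_scheme \<Rightarrow>
      ('a, ((nat \<Rightarrow> 'a) \<Rightarrow> 'n) set) module" where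
  "Ext A i M N =
    (let (r, d, e) = (SOME (r, d, e). free_resolution A M r d e)
     in quotient_module
          (hom_module A (free_module A (r i)) N \<lparr>carrier := ext_cocycles A r d N i\<rparr>)
          (ext_coboundaries A r d N i))"

section \<open>Cohomology annihilators\<close>

text \<open>
  The carriers of \<open>M\<close> and \<open>N\<close> are taken in the type \<^typ>\<open>(nat \<Rightarrow> 'a) set\<close>. This loses nothing:
  every finitely generated \<open>A\<close>-module is isomorphic to a quotient of some \<open>free_module A r\<close>,
  whose elements are cosets, that is, sets of functions \<^typ>\<open>nat \<Rightarrow> 'a\<close>.
\<close>

definition coh_ann_at :: "('a, 'e) ring_scheme \<Rightarrow> nat \<Rightarrow> 'a set" where
  "coh_ann_at A i =
    {a \<in> carrier A. \<forall>(M :: ('a, (nat \<Rightarrow> 'a) set) module) (N :: ('a, (nat \<Rightarrow> 'a) set) module).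
       finitely_generated_module A M \<and> finitely_generated_module A N \<longrightarrow>
       a \<in> module_ann A (Ext A i M N)}"

definition coh_ann :: "('a, 'e) ring_scheme \<Rightarrow> 'a set" where
  "coh_ann A = (\<Union>i. coh_ann_at A i)"

section \<open>Branched covers\<close>

text \<open>
  \<open>S[[y]]\<close> is the power series ring over \<open>S\<close> in a single variable, indexed by \<^term>\<open>()\<close>.
\<close>

definition branched_cover_equation ::
    "('s, 'e) ring_scheme \<Rightarrow> 's \<Rightarrow> nat \<Rightarrow> (unit multiset \<Rightarrow> 's)" where
  "branched_cover_equation S f m =
    (let T = power_series_ring S {()}
     in ring.indexed_const S f \<oplus>\<^bsub>T\<^esub> ring.indexed_var S () [^]\<^bsub>T\<^esub> m)"

definition hypersurface_ring :: "('s, 'e) ring_scheme \<Rightarrow> 's \<Rightarrow> 's set ring" where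
  "hypersurface_ring S f = S Quot (PIdl\<^bsub>S\<^esub> f)"

definition branched_cover ::
    "('s, 'e) ring_scheme \<Rightarrow> 's \<Rightarrow> nat \<Rightarrow> (unit multiset \<Rightarrow> 's) set ring" where
  "branched_cover S f m =
    (let T = power_series_ring S {()} in T Quot (PIdl\<^bsub>T\<^esub> (branched_cover_equation S f m)))"

text \<open>
  The surjection \<open>S[[y]]/(f + y^m) \<longrightarrow> S/(f)\<close> induced by \<open>y \<mapsto> 0\<close>: it sends the class of \<open>F\<close> to
  the class of the constant coefficient of \<open>F\<close>. For \<open>m > 0\<close> this class is the same for all
  members \<open>F\<close> of the coset \<open>C\<close>.
\<close>

definition branched_cover_proj ::
    "('s, 'e) ring_scheme \<Rightarrow> 's \<Rightarrow> (unit multiset \<Rightarrow> 's) set \<Rightarrow> 's set" where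
  "branched_cover_proj S f C = the_elem ((\<lambda>F. (PIdl\<^bsub>S\<^esub> f) +>\<^bsub>S\<^esub> F {#}) ` C)"

end

theory Submission
  imports Defs
begin

text \<open>
  Write \<open>P = S[[y]]/(f + y^m)\<close> and \<open>R = S/(f)\<close>. Over a Noetherian ring an element \<open>a\<close> kills all
  \<open>Ext^(l+1)\<close> iff, for every exact sequence \<open>d\<close> of finite free modules, \<open>a d l\<close> factors as
  \<open>d l \<circ> s \<circ> d l\<close>; all arguments are about such homotopies \<open>s\<close>.

  A resolution over \<open>R\<close>, lifted to \<open>S\<close> and mapped to \<open>P\<close>, is a complex up to multiples of
  \<open>f = -y^m\<close>, hence of \<open>y^2\<close>. Its mapping cone over \<open>P\<close> is exact and splits modulo \<open>y\<close>, so
  homotopies over \<open>P\<close> descend to \<open>R\<close>. This needs \<open>f\<close> to be a nonzerodivisor; if \<open>f = 0\<close>, then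
  \<open>R\<close> is \<open>S\<close>, which is regular, and its cohomology annihilator is everything.

  Conversely, a homotopy for \<open>a\<close> over \<open>R\<close> lifts to \<open>P\<close> up to an error divisible by \<open>y\<close>, and a
  homotopy for \<open>y\<close> absorbs the error. For \<open>m = 2\<close> such a homotopy exists in high degrees:
  \<open>S[[y]]\<close> is regular, so resolutions over \<open>P\<close> come from matrix factorizations of \<open>f + y^2\<close>, and
  differentiating these with respect to \<open>y\<close> shows that \<open>2y\<close> is homotopic to zero.

  Regularity of power series rings is proved in the form that \<open>1\<close> has a homotopy in high degrees,
  which passes from \<open>A\<close> to \<open>A[[x]]\<close> by inverting \<open>1 + x u\<close> for an error term \<open>u\<close>.
\<close>

section \<open>Linear maps and free modules\<close>

text \<open>Only the relation \<open>d s d = a d\<close> in one degree is available, never a chain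
  homotopy on a whole resolution, so everything is moved between rings as maps of finite free
  modules, which lift along surjections and extend along ring homomorphisms. All quotients have one
  form, a surjection whose kernel is generated by a nonzerodivisor \<open>x\<close>:
  \<open>A[[x]]\<close> onto \<open>A\<close>, \<open>S[[y]]\<close> onto \<open>P\<close>, and
  \<open>P\<close> onto \<open>R\<close>. A lift \<open>D\<close> of an exact sequence is no longer
  a complex; \<open>D D = x E\<close>, and the cone with blocks \<open>D\<close>, \<open>x\<close>,
  \<open>-E\<close>, \<open>-D\<close> repairs this. The cone serves twice. For \<open>P\<close>
  onto \<open>R\<close> the lift passes through \<open>S\<close>, whose elements vanishing in
  \<open>R\<close> become multiples of \<open>y^2\<close>, so \<open>E\<close> is itself divisible
  by \<open>y\<close>. For \<open>S[[y]]\<close> onto \<open>P\<close> the cone carries a homotopy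
  for \<open>1\<close>. Lifting a homotopy from a quotient to the ring above costs one degree, since
  reduction modulo \<open>x\<close> may destroy exactness at one place; the union over all degrees
  hides the shift. Expressing Ext through syzygies needs finite free resolutions, so the Noetherian
  property is carried from \<open>k\<close> through the power series rings along with
  regularity.\<close>

definition linear_map ::
    "('a, 'e) ring_scheme \<Rightarrow> ('a, 'm, 'x) module_scheme \<Rightarrow> ('a, 'n, 'y) module_scheme \<Rightarrow>
      ('m \<Rightarrow> 'n) \<Rightarrow> bool" where
  "linear_map A M N h \<longleftrightarrow> h \<in> carrier M \<rightarrow> carrier N \<and>
    (\<forall>x\<in>carrier M. \<forall>y\<in>carrier M. h (x \<oplus>\<^bsub>M\<^esub> y) = h x \<oplus>\<^bsub>N\<^esub> h y) \<and>
    (\<forall>a\<in>carrier A. \<forall>x\<in>carrier M. h (a \<odot>\<^bsub>M\<^esub> x) = a \<odot>\<^bsub>N\<^esub> h x)"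

lemma linear_mapI:
  assumes "\<And>x. x \<in> carrier M \<Longrightarrow> h x \<in> carrier N"
    and "\<And>x y. x \<in> carrier M \<Longrightarrow> y \<in> carrier M \<Longrightarrow> h (x \<oplus>\<^bsub>M\<^esub> y) = h x \<oplus>\<^bsub>N\<^esub> h y"
    and "\<And>a x. a \<in> carrier A \<Longrightarrow> x \<in> carrier M \<Longrightarrow> h (a \<odot>\<^bsub>M\<^esub> x) = a \<odot>\<^bsub>N\<^esub> h x"
  shows "linear_map A M N h"
  using assms by (auto simp: linear_map_def)

lemma linear_map_closed: "linear_map A M N h \<Longrightarrow> x \<in> carrier M \<Longrightarrow> h x \<in> carrier N"
  and linear_map_add: "linear_map A M N h \<Longrightarrow> x \<in> carrier M \<Longrightarrow> y \<in> carrier M \<Longrightarrow>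
    h (x \<oplus>\<^bsub>M\<^esub> y) = h x \<oplus>\<^bsub>N\<^esub> h y"
  and linear_map_smult: "linear_map A M N h \<Longrightarrow> a \<in> carrier A \<Longrightarrow> x \<in> carrier M \<Longrightarrow>
    h (a \<odot>\<^bsub>M\<^esub> x) = a \<odot>\<^bsub>N\<^esub> h x"
  by (auto simp: linear_map_def)

lemma linear_map_zero:
  assumes "module A M" "module A N" "linear_map A M N h"
  shows "h \<zero>\<^bsub>M\<^esub> = \<zero>\<^bsub>N\<^esub>"
proof -
  interpret M: module A M by fact
  interpret N: module A N by fact
  have "h (\<zero>\<^bsub>A\<^esub> \<odot>\<^bsub>M\<^esub> \<zero>\<^bsub>M\<^esub>) = \<zero>\<^bsub>A\<^esub> \<odot>\<^bsub>N\<^esub> h \<zero>\<^bsub>M\<^esub>"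
    by (rule linear_map_smult[OF assms(3)]) auto
  then show ?thesis using linear_map_closed[OF assms(3), of "\<zero>\<^bsub>M\<^esub>"] by simp
qed

lemma linear_map_uminus:
  assumes "module A M" "module A N" "linear_map A M N h" "x \<in> carrier M"
  shows "h (\<ominus>\<^bsub>M\<^esub> x) = \<ominus>\<^bsub>N\<^esub> h x"
proof -
  interpret M: module A M by fact
  interpret N: module A N by fact
  have "h (\<ominus>\<^bsub>M\<^esub> x) \<oplus>\<^bsub>N\<^esub> h x = \<zero>\<^bsub>N\<^esub>"
    using linear_map_add[OF assms(3), of "\<ominus>\<^bsub>M\<^esub> x" x] assms(4) linear_map_zero[OF assms(1-3)]
    by (simp add: M.M.l_neg)
  then show ?thesis
    using linear_map_closed[OF assms(3)] assms(4) by (simp add: N.M.minus_equality)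
qed

lemma linear_map_minus:
  assumes "module A M" "module A N" "linear_map A M N h" "x \<in> carrier M" "y \<in> carrier M"
  shows "h (x \<ominus>\<^bsub>M\<^esub> y) = h x \<ominus>\<^bsub>N\<^esub> h y"
proof -
  interpret M: module A M by fact
  show ?thesis
    using assms(4,5) linear_map_add[OF assms(3), of x "\<ominus>\<^bsub>M\<^esub> y"] linear_map_uminus[OF assms(1-3)]
    by (simp add: a_minus_def)
qed

lemmas linear_map_simps = linear_map_closed linear_map_add linear_map_smult
lemmas linear_map_group_simps = linear_map_zero linear_map_uminus linear_map_minus

lemma linear_map_comp:
  "linear_map A M N g \<Longrightarrow> linear_map A L M h \<Longrightarrow> linear_map A L N (\<lambda>x. g (h x))"
  by (auto simp: linear_map_def Pi_def)

lemma linear_map_plus: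
  assumes "module A N" "linear_map A M N g" "linear_map A M N h"
  shows "linear_map A M N (\<lambda>x. g x \<oplus>\<^bsub>N\<^esub> h x)"
proof -
  interpret N: module A N by fact
  note [simp] = linear_map_simps[OF assms(2)] linear_map_simps[OF assms(3)]
  show ?thesis
    by (rule linear_mapI) (simp_all add: N.smult_r_distr N.M.a_ac)
qed

lemma linear_map_neg:
  assumes "module A N" "linear_map A M N g"
  shows "linear_map A M N (\<lambda>x. \<ominus>\<^bsub>N\<^esub> g x)"
proof -
  interpret N: module A N by fact
  note [simp] = linear_map_simps[OF assms(2)]
  show ?thesis
    by (rule linear_mapI) (simp_all add: N.smult_r_minus N.M.minus_add N.M.a_ac)
qed

lemma linear_map_diff:
  assumes "module A N" "linear_map A M N g" "linear_map A M N h"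
  shows "linear_map A M N (\<lambda>x. g x \<ominus>\<^bsub>N\<^esub> h x)"
  unfolding a_minus_def by (intro linear_map_plus linear_map_neg assms)

lemma linear_map_scale:
  assumes "module A N" "linear_map A M N g" "a \<in> carrier A"
  shows "linear_map A M N (\<lambda>x. a \<odot>\<^bsub>N\<^esub> g x)"
proof -
  interpret N: module A N by fact
  note [simp] = linear_map_simps[OF assms(2)] assms(3)
  show ?thesis
    by (rule linear_mapI) (simp_all add: N.smult_r_distr N.smult_assoc1[symmetric] N.R.m_comm)
qed

lemma linear_map_id: "linear_map A M M (\<lambda>x. x)"
  by (auto simp: linear_map_def)

lemma linear_map_0: "module A N \<Longrightarrow> linear_map A M N (\<lambda>x. \<zero>\<^bsub>N\<^esub>)"
proof -
  assume "module A N"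
  then interpret N: module A N .
  show ?thesis by (auto simp: linear_map_def)
qed

text \<open>\<open>module_homs\<close> also demands the value \<open>undefined\<close> off the
  carrier, which composites and sums written as lambda terms lack; hence computations use
  \<open>linear_map\<close>, and restriction comes in only where Ext is met.\<close>

lemma module_homs_iff:
  "h \<in> module_homs A M N \<longleftrightarrow> linear_map A M N h \<and> h \<in> extensional (carrier M)"
  by (auto simp: module_homs_def linear_map_def PiE_def)

lemma restrict_in_module_homs:
  assumes "module A M" "linear_map A M N h"
  shows "restrict h (carrier M) \<in> module_homs A M N"
proof -
  interpret M: module A M by fact
  show ?thesis using assms(2) by (auto simp: module_homs_iff linear_map_def)
qed

lemma (in module) submodule_zero_closed: "submodule U R M \<Longrightarrow> \<zero>\<^bsub>M\<^esub> \<in> U"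
  by (metis subgroup.one_closed submodule.axioms(1) monoid.select_convs(2))

lemma submodule_image:
  assumes "module A M" "module A N" "linear_map A M N h"
  shows "submodule (h ` carrier M) A N"
proof -
  interpret M: module A M by fact
  interpret N: module A N by fact
  note h = linear_map_add[OF assms(3), symmetric] linear_map_smult[OF assms(3), symmetric] linear_map_uminus[OF assms, symmetric]
  show ?thesis
  proof (rule N.submoduleI)
    show "\<zero>\<^bsub>N\<^esub> \<in> h ` carrier M"
      using linear_map_zero[OF assms, symmetric] by auto
  qed (auto simp: h linear_map_closed[OF assms(3)] simp del: M.M.add.inv_closed)
qed

lemma submodule_vimage:
  assumes "module A M" "module A N" "linear_map A M N h" "submodule U A N"
  shows "submodule {x \<in> carrier M. h x \<in> U} A M"
proof -
  interpret M: module A M by fact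
  interpret N: module A N by fact
  show ?thesis
    using N.submoduleE[OF assms(4)] N.submodule_zero_closed[OF assms(4)]
      linear_map_group_simps[OF assms(1-3)] linear_map_simps[OF assms(3)]
    by (intro M.submoduleI) auto
qed

lemma submodule_zero:
  assumes "module A M"
  shows "submodule {\<zero>\<^bsub>M\<^esub>} A M"
proof -
  interpret M: module A M by fact
  show ?thesis by (rule M.submoduleI) (auto simp: M.M.minus_equality)
qed

lemma submodule_kernel:
  assumes "module A M" "module A N" "linear_map A M N h"
  shows "submodule {x \<in> carrier M. h x = \<zero>\<^bsub>N\<^esub>} A M"
  using submodule_vimage[OF assms submodule_zero[OF assms(2)]] by simp

lemma linear_map_finsum:
  assumes "module A M" "module A N" "linear_map A M N h" "finite I" "f \<in> I \<rightarrow> carrier M"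
  shows "h (finsum M f I) = finsum N (\<lambda>i. h (f i)) I"
proof -
  interpret M: module A M by fact
  interpret N: module A N by fact
  show ?thesis using assms(4,5)
    by (induction) (auto simp: linear_map_zero[OF assms(1-3)] linear_map_simps[OF assms(3)] Pi_def)
qed

definition std_vec :: "('a, 'e) ring_scheme \<Rightarrow> nat \<Rightarrow> nat \<Rightarrow> nat \<Rightarrow> 'a" where
  "std_vec A r k = (\<lambda>i\<in>{..<r}. if i = k then \<one>\<^bsub>A\<^esub> else \<zero>\<^bsub>A\<^esub>)"

locale free_modules = cring R for R (structure)
begin

lemma carrier_free: "carrier (free_module R r) = {..<r} \<rightarrow>\<^sub>E carrier R"
  and zero_free: "\<zero>\<^bsub>free_module R r\<^esub> = (\<lambda>i\<in>{..<r}. \<zero>)"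
  and add_free: "v \<oplus>\<^bsub>free_module R r\<^esub> w = (\<lambda>i\<in>{..<r}. v i \<oplus> w i)"
  and smult_free: "a \<odot>\<^bsub>free_module R r\<^esub> v = (\<lambda>i\<in>{..<r}. a \<otimes> v i)"
  by (simp_all add: free_module_def)

lemmas free_simps = carrier_free zero_free add_free smult_free

lemma free_eqI:
  assumes "v \<in> carrier (free_module R r)" "w \<in> carrier (free_module R r)" "\<And>i. i < r \<Longrightarrow> v i = w i"
  shows "v = w"
  using assms unfolding carrier_free by (intro PiE_ext) auto

lemma module_free: "module R (free_module R r)"
proof (rule moduleI)
  show "abelian_group (free_module R r)"
  proof (rule abelian_groupI)
    fix x assume "x \<in> carrier (free_module R r)"
    then show "\<exists>y\<in>carrier (free_module R r). y \<oplus>\<^bsub>free_module R r\<^esub> x = \<zero>\<^bsub>free_module R r\<^esub>"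
      by (intro bexI[of _ "\<lambda>i\<in>{..<r}. \<ominus> x i"]) (auto simp: free_simps l_neg PiE_iff)
  qed (auto simp: free_simps PiE_iff a_ac intro!: ext extensionalityI simp: extensional_def)
qed (auto simp: free_simps PiE_iff is_cring l_distr r_distr m_assoc intro!: ext simp: extensional_def)

end

sublocale free_modules \<subseteq> F: module R "free_module R r" for r
  by (rule module_free)

context free_modules
begin

lemma std_vec_closed [simp]: "std_vec R r k \<in> carrier (free_module R r)"
  by (auto simp: std_vec_def carrier_free)

lemma finsum_free_apply:
  assumes "finite I" "f \<in> I \<rightarrow> carrier (free_module R r)" "i < r"
  shows "finsum (free_module R r) f I i = (\<Oplus>k\<in>I. f k i)"
  using assms by (induction) (auto simp: zero_free add_free Pi_def carrier_free PiE_iff)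

lemma free_expand:
  assumes "v \<in> carrier (free_module R r)"
  shows "v = (\<Oplus>\<^bsub>free_module R r\<^esub>k\<in>{..<r}. v k \<odot>\<^bsub>free_module R r\<^esub> std_vec R r k)"
proof -
  have v: "v k \<in> carrier R" if "k < r" for k using assms that by (auto simp: carrier_free)
  show ?thesis
  proof (rule free_eqI[OF assms])
    fix i assume i: "i < r"
    have "(\<Oplus>\<^bsub>free_module R r\<^esub>k\<in>{..<r}. v k \<odot>\<^bsub>free_module R r\<^esub> std_vec R r k) i
        = (\<Oplus>k\<in>{..<r}. if i = k then v k else \<zero>)"
      using i v by (subst finsum_free_apply)
        (auto intro!: finsum_cong' simp: v, auto simp: smult_free std_vec_def v)
    also have "\<dots> = v i"
      using i v by (intro finsum_singleton) auto
    finally show "v i = (\<Oplus>\<^bsub>free_module R r\<^esub>k\<in>{..<r}. v k \<odot>\<^bsub>free_module R r\<^esub> std_vec R r k) i" ..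
  qed (use v in auto)
qed

lemma linear_map_expand:
  assumes "module R N" "linear_map R (free_module R r) N h" "v \<in> carrier (free_module R r)"
  shows "h v = (\<Oplus>\<^bsub>N\<^esub>k\<in>{..<r}. v k \<odot>\<^bsub>N\<^esub> h (std_vec R r k))"
proof -
  interpret N: module R N by fact
  have v: "v k \<in> carrier R" if "k < r" for k using assms that by (auto simp: carrier_free)
  have "h v = h (\<Oplus>\<^bsub>free_module R r\<^esub>k\<in>{..<r}. v k \<odot>\<^bsub>free_module R r\<^esub> std_vec R r k)"
    using free_expand[OF assms(3)] by simp
  also have "\<dots> = (\<Oplus>\<^bsub>N\<^esub>k\<in>{..<r}. h (v k \<odot>\<^bsub>free_module R r\<^esub> std_vec R r k))"
    using v by (intro linear_map_finsum[OF module_free assms(1,2)]) auto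
  also have "\<dots> = (\<Oplus>\<^bsub>N\<^esub>k\<in>{..<r}. v k \<odot>\<^bsub>N\<^esub> h (std_vec R r k))"
    using v linear_map_simps[OF assms(2)] by (intro N.M.finsum_cong') auto
  finally show ?thesis .
qed

lemma linear_map_eqI:
  assumes "module R N" "linear_map R (free_module R r) N g" "linear_map R (free_module R r) N h"
    "\<And>k. k < r \<Longrightarrow> g (std_vec R r k) = h (std_vec R r k)" "v \<in> carrier (free_module R r)"
  shows "g v = h v"
proof -
  interpret N: module R N by fact
  have v: "v k \<in> carrier R" if "k < r" for k using assms that by (auto simp: carrier_free)
  show ?thesis
    unfolding linear_map_expand[OF assms(1,2,5)] linear_map_expand[OF assms(1,3,5)]
    using v assms(4) linear_map_closed[OF assms(3)] by (intro N.M.finsum_cong') auto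
qed

lemma linear_map_exists:
  assumes "module R N" "\<And>k. k < r \<Longrightarrow> c k \<in> carrier N"
  shows "\<exists>h. linear_map R (free_module R r) N h \<and> (\<forall>k<r. h (std_vec R r k) = c k)"
proof (intro exI conjI allI impI)
  interpret N: module R N by fact
  let ?h = "\<lambda>v. \<Oplus>\<^bsub>N\<^esub>k\<in>{..<r}. v k \<odot>\<^bsub>N\<^esub> c k"
  show "linear_map R (free_module R r) N ?h"
  proof (rule linear_mapI)
    fix x y assume x: "x \<in> carrier (free_module R r)" "y \<in> carrier (free_module R r)"
    then have *: "x k \<in> carrier R" "y k \<in> carrier R" if "k < r" for k
      using that by (auto simp: carrier_free)
    have "?h (x \<oplus>\<^bsub>free_module R r\<^esub> y) = (\<Oplus>\<^bsub>N\<^esub>k\<in>{..<r}. x k \<odot>\<^bsub>N\<^esub> c k \<oplus>\<^bsub>N\<^esub> y k \<odot>\<^bsub>N\<^esub> c k)"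
      using * assms(2) by (intro N.M.finsum_cong') (auto simp: add_free N.smult_l_distr)
    also have "\<dots> = ?h x \<oplus>\<^bsub>N\<^esub> ?h y"
      using * assms(2) by (intro N.M.finsum_addf) auto
    finally show "?h (x \<oplus>\<^bsub>free_module R r\<^esub> y) = ?h x \<oplus>\<^bsub>N\<^esub> ?h y" .
  next
    fix x a assume x: "x \<in> carrier (free_module R r)" "a \<in> carrier R"
    then have *: "x k \<in> carrier R" if "k < r" for k
      using that by (auto simp: carrier_free)
    have "?h (a \<odot>\<^bsub>free_module R r\<^esub> x) = (\<Oplus>\<^bsub>N\<^esub>k\<in>{..<r}. a \<odot>\<^bsub>N\<^esub> (x k \<odot>\<^bsub>N\<^esub> c k))"
      using * x assms(2) by (intro N.M.finsum_cong') (auto simp: smult_free N.smult_assoc1)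
    also have "\<dots> = a \<odot>\<^bsub>N\<^esub> ?h x"
      using * x assms(2) by (intro N.finsum_smult_ldistr[symmetric]) auto
    finally show "?h (a \<odot>\<^bsub>free_module R r\<^esub> x) = a \<odot>\<^bsub>N\<^esub> ?h x" .
  qed (use assms in \<open>auto intro!: N.M.finsum_closed simp: carrier_free\<close>)
  fix k assume k: "k < r"
  have "?h (std_vec R r k) = (\<Oplus>\<^bsub>N\<^esub>j\<in>{..<r}. if k = j then c j else \<zero>\<^bsub>N\<^esub>)"
    using assms(2) by (intro N.M.finsum_cong') (auto simp: std_vec_def)
  also have "\<dots> = c k"
    using assms(2) k by (intro N.M.finsum_singleton) auto
  finally show "?h (std_vec R r k) = c k" .
qed

text \<open>Projectivity of finite free modules: preimages under \<open>e\<close> have to be chosen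
  only for the basis vectors.\<close>

lemma linear_map_factor:
  assumes "module R M" "module R N" "linear_map R M N e" "linear_map R (free_module R r) N t"
    "\<And>k. k < r \<Longrightarrow> t (std_vec R r k) \<in> e ` carrier M"
  obtains u where "linear_map R (free_module R r) M u"
    "\<And>v. v \<in> carrier (free_module R r) \<Longrightarrow> e (u v) = t v"
proof -
  have "\<forall>k. \<exists>x. k < r \<longrightarrow> x \<in> carrier M \<and> t (std_vec R r k) = e x"
    using assms(5) by blast
  then obtain c where c: "\<And>k. k < r \<Longrightarrow> c k \<in> carrier M \<and> t (std_vec R r k) = e (c k)"
    by metis
  obtain u where u: "linear_map R (free_module R r) M u" "\<forall>k<r. u (std_vec R r k) = c k"
    using linear_map_exists[OF assms(1), of r c] c by blast
  have "e (u v) = t v" if "v \<in> carrier (free_module R r)" for v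
    using linear_map_eqI[OF assms(2) linear_map_comp[OF assms(3) u(1)] assms(4) _ that] u(2) c by simp
  then show ?thesis using that u(1) by blast
qed

end

section \<open>Change of rings\<close>

lemmas (in module) group_norm =
  M.a_ac M.minus_add M.minus_minus M.r_neg M.r_neg1 M.r_neg2 M.l_neg M.minus_eq
  smult_r_distr smult_r_minus

lemma (in free_modules) smult_apply: "i < r \<Longrightarrow> (a \<odot>\<^bsub>free_module R r\<^esub> w) i = a \<otimes> w i"
  and zero_apply: "i < r \<Longrightarrow> \<zero>\<^bsub>free_module R r\<^esub> i = \<zero>"
  and free_closed: "v \<in> carrier (free_module R r) \<Longrightarrow> i < r \<Longrightarrow> v i \<in> carrier R"
  by (auto simp: free_simps)

lemma (in free_modules) restrict_closed:
  "(\<And>i. i < r \<Longrightarrow> f i \<in> carrier R) \<Longrightarrow> (\<lambda>i\<in>{..<r}. f i) \<in> carrier (free_module R r)"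
  by (simp add: carrier_free)

lemma (in module) minus_eq_zero_iff:
  "x \<in> carrier M \<Longrightarrow> y \<in> carrier M \<Longrightarrow> x \<ominus>\<^bsub>M\<^esub> y = \<zero>\<^bsub>M\<^esub> \<longleftrightarrow> x = y"
  by (metis M.a_inv_closed M.minus_eq M.minus_equality M.minus_minus M.r_neg)

text \<open>Applying \<open>\<phi>\<close> to coordinates goes between modules over different rings.
  Over the source ring, with scalars restricted, it is a linear map, and the general lemmas apply to
  it.\<close>

definition restrict_scalars ::
    "('b \<Rightarrow> 'a) \<Rightarrow> ('a, 'm, 'x) module_scheme \<Rightarrow> ('b, 'm) module" where
  "restrict_scalars \<phi> M =
    \<lparr>carrier = carrier M, monoid.mult = undefined, one = undefined,
     ring.zero = \<zero>\<^bsub>M\<^esub>, ring.add = (\<oplus>\<^bsub>M\<^esub>), smult = (\<lambda>b x. \<phi> b \<odot>\<^bsub>M\<^esub> x)\<rparr>"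

lemma restrict_scalars_simps [simp]:
  "carrier (restrict_scalars \<phi> M) = carrier M"
  "\<zero>\<^bsub>restrict_scalars \<phi> M\<^esub> = \<zero>\<^bsub>M\<^esub>"
  "x \<oplus>\<^bsub>restrict_scalars \<phi> M\<^esub> y = x \<oplus>\<^bsub>M\<^esub> y"
  "a \<odot>\<^bsub>restrict_scalars \<phi> M\<^esub> x = \<phi> a \<odot>\<^bsub>M\<^esub> x"
  by (simp_all add: restrict_scalars_def)

lemma module_restrict_scalars:
  assumes "cring B" "\<phi> \<in> ring_hom B A" "module A M"
  shows "module B (restrict_scalars \<phi> M)"
proof -
  interpret M: module A M by fact
  note [simp] = ring_hom_closed[OF assms(2)] ring_hom_add[OF assms(2)]
    ring_hom_mult[OF assms(2)] ring_hom_one[OF assms(2)]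
  show ?thesis
  proof (rule moduleI)
    show "abelian_group (restrict_scalars \<phi> M)"
    proof (rule abelian_groupI)
      fix y assume "y \<in> carrier (restrict_scalars \<phi> M)"
      then show "\<exists>z\<in>carrier (restrict_scalars \<phi> M).
          z \<oplus>\<^bsub>restrict_scalars \<phi> M\<^esub> y = \<zero>\<^bsub>restrict_scalars \<phi> M\<^esub>"
        by (intro bexI[of _ "\<ominus>\<^bsub>M\<^esub> y"]) (auto simp: M.M.l_neg)
    qed (auto simp: M.M.a_ac)
  qed (auto simp: assms(1) M.smult_l_distr M.smult_r_distr M.smult_assoc1)
qed

lemma linear_map_restrict_scalars:
  assumes "\<phi> \<in> ring_hom B A" "linear_map A M N h"
  shows "linear_map B (restrict_scalars \<phi> M) (restrict_scalars \<phi> N) h"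
  using assms by (auto simp: linear_map_def ring_hom_closed)

section \<open>Coordinatewise ring homomorphisms and base change of maps\<close>

definition map_vec :: "('a \<Rightarrow> 'b) \<Rightarrow> nat \<Rightarrow> (nat \<Rightarrow> 'a) \<Rightarrow> nat \<Rightarrow> 'b" where
  "map_vec \<phi> r v = (\<lambda>i\<in>{..<r}. \<phi> (v i))"

locale ring_change = S: free_modules S + R: free_modules R for S and R +
  fixes \<phi>
  assumes hom: "\<phi> \<in> ring_hom S R"
begin

lemmas hom_simps [simp] =
  ring_hom_closed[OF hom] ring_hom_add[OF hom] ring_hom_mult[OF hom] ring_hom_one[OF hom]
  ring_hom_zero[OF hom S.ring_axioms R.ring_axioms]

lemma map_vec_closed [simp]: "v \<in> carrier (free_module S r) \<Longrightarrow> map_vec \<phi> r v \<in> carrier (free_module R r)"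
  unfolding map_vec_def by (rule R.restrict_closed) (simp add: S.free_closed)

lemma map_vec_linear:
  "linear_map S (free_module S r) (restrict_scalars \<phi> (free_module R r)) (map_vec \<phi> r)"
proof (rule linear_mapI)
  fix x y assume xy: "x \<in> carrier (free_module S r)" "y \<in> carrier (free_module S r)"
  then show "map_vec \<phi> r (x \<oplus>\<^bsub>free_module S r\<^esub> y) =
      map_vec \<phi> r x \<oplus>\<^bsub>restrict_scalars \<phi> (free_module R r)\<^esub> map_vec \<phi> r y"
    by (simp add: map_vec_def S.add_free R.add_free S.free_closed restrict_def cong: if_cong)
next
  fix a x assume ax: "a \<in> carrier S" "x \<in> carrier (free_module S r)"
  then show "map_vec \<phi> r (a \<odot>\<^bsub>free_module S r\<^esub> x) =
      a \<odot>\<^bsub>restrict_scalars \<phi> (free_module R r)\<^esub> map_vec \<phi> r x"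
    by (simp add: map_vec_def S.smult_free R.smult_free S.free_closed restrict_def cong: if_cong)
qed simp

lemma module_restrict: "module S (restrict_scalars \<phi> (free_module R r))"
  by (rule module_restrict_scalars[OF S.is_cring hom R.module_free])

lemma map_vec_add: "v \<in> carrier (free_module S r) \<Longrightarrow> w \<in> carrier (free_module S r) \<Longrightarrow>
    map_vec \<phi> r (v \<oplus>\<^bsub>free_module S r\<^esub> w) = map_vec \<phi> r v \<oplus>\<^bsub>free_module R r\<^esub> map_vec \<phi> r w"
  and map_vec_smult: "a \<in> carrier S \<Longrightarrow> v \<in> carrier (free_module S r) \<Longrightarrow>
    map_vec \<phi> r (a \<odot>\<^bsub>free_module S r\<^esub> v) = \<phi> a \<odot>\<^bsub>free_module R r\<^esub> map_vec \<phi> r v"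
  and map_vec_zero: "map_vec \<phi> r \<zero>\<^bsub>free_module S r\<^esub> = \<zero>\<^bsub>free_module R r\<^esub>"
  using linear_map_simps[OF map_vec_linear]
    linear_map_zero[OF S.module_free module_restrict map_vec_linear] by simp_all

lemma map_vec_uminus:
  assumes "v \<in> carrier (free_module S r)"
  shows "map_vec \<phi> r (\<ominus>\<^bsub>free_module S r\<^esub> v) = \<ominus>\<^bsub>free_module R r\<^esub> map_vec \<phi> r v"
  using map_vec_add[where v = "\<ominus>\<^bsub>free_module S r\<^esub> v" and w = v and r = r] assms map_vec_zero
  by (intro R.F.M.minus_equality[symmetric]) (simp_all add: S.F.M.l_neg)

lemma map_vec_minus:
  "v \<in> carrier (free_module S r) \<Longrightarrow> w \<in> carrier (free_module S r) \<Longrightarrow>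
    map_vec \<phi> r (v \<ominus>\<^bsub>free_module S r\<^esub> w) = map_vec \<phi> r v \<ominus>\<^bsub>free_module R r\<^esub> map_vec \<phi> r w"
  by (simp add: a_minus_def map_vec_add map_vec_uminus)

lemmas map_vec_simps = map_vec_add map_vec_smult map_vec_zero map_vec_uminus map_vec_minus

lemma map_vec_std: "map_vec \<phi> r (std_vec S r k) = std_vec R r k"
  by (simp add: map_vec_def std_vec_def restrict_def fun_eq_iff)

text \<open>\<open>D\<close> has the matrix of \<open>d\<close> with \<open>\<phi>\<close> applied
  to its entries, so it is prescribed on the basis vectors.\<close>

lemma base_change:
  assumes "linear_map S (free_module S p) (free_module S q) d"
  obtains D where "linear_map R (free_module R p) (free_module R q) D"
    "\<And>v. v \<in> carrier (free_module S p) \<Longrightarrow> D (map_vec \<phi> p v) = map_vec \<phi> q (d v)"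
proof -
  let ?c = "\<lambda>k. map_vec \<phi> q (d (std_vec S p k))"
  have c: "?c k \<in> carrier (free_module R q)" for k
    by (rule map_vec_closed[OF linear_map_closed[OF assms S.std_vec_closed]])
  obtain D where D: "linear_map R (free_module R p) (free_module R q) D"
    "\<forall>k<p. D (std_vec R p k) = map_vec \<phi> q (d (std_vec S p k))"
    using R.linear_map_exists[OF R.module_free, of p ?c q, OF c] by (elim exE conjE)
  have "D (map_vec \<phi> p v) = map_vec \<phi> q (d v)" if "v \<in> carrier (free_module S p)" for v
  proof (rule S.linear_map_eqI[OF module_restrict
        linear_map_comp[OF linear_map_restrict_scalars[OF hom D(1)] map_vec_linear]
        linear_map_comp[OF map_vec_linear assms] _ that])
    show "D (map_vec \<phi> p (std_vec S p k)) = map_vec \<phi> q (d (std_vec S p k))" if "k < p" for k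
      using D(2) that by (simp add: map_vec_std)
  qed
  then show ?thesis using that D(1) by blast
qed

end

text \<open>Exactness is asked for at \<open>r 1\<close>, \<open>r 2\<close> and so on; the sequence
  thus resolves the cokernel of \<open>d 0\<close>. Leaving out module and augmentation lets it be
  reduced, lifted and shifted as it stands.\<close>

definition free_exact ::
    "('a, 'e) ring_scheme \<Rightarrow> (nat \<Rightarrow> nat) \<Rightarrow> (nat \<Rightarrow> (nat \<Rightarrow> 'a) \<Rightarrow> (nat \<Rightarrow> 'a)) \<Rightarrow> bool" where
  "free_exact A r d \<longleftrightarrow>
    (\<forall>j. linear_map A (free_module A (r (Suc j))) (free_module A (r j)) (d j)) \<and>
    (\<forall>j. \<forall>v\<in>carrier (free_module A (r (Suc j))). d j v = \<zero>\<^bsub>free_module A (r j)\<^esub> \<longleftrightarrow>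
      v \<in> d (Suc j) ` carrier (free_module A (r (Suc (Suc j)))))"

lemma free_exact_linear:
  "free_exact A r d \<Longrightarrow> linear_map A (free_module A (r (Suc j))) (free_module A (r j)) (d j)"
  by (simp add: free_exact_def)

lemma free_exact_complex:
  assumes "free_exact A r d" "v \<in> carrier (free_module A (r (Suc (Suc j))))"
  shows "d j (d (Suc j) v) = \<zero>\<^bsub>free_module A (r j)\<^esub>"
  using assms linear_map_closed[OF free_exact_linear[OF assms(1), of "Suc j"] assms(2)]
  by (auto simp: free_exact_def)

lemma free_exact_lift:
  assumes "free_exact A r d" "v \<in> carrier (free_module A (r (Suc j)))"
    "d j v = \<zero>\<^bsub>free_module A (r j)\<^esub>"
  obtains w where "w \<in> carrier (free_module A (r (Suc (Suc j))))" "v = d (Suc j) w"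
  using assms unfolding free_exact_def by blast

lemma free_exact_shift: "free_exact A r d \<Longrightarrow> free_exact A (\<lambda>j. r (Suc j)) (\<lambda>j. d (Suc j))"
  by (simp add: free_exact_def)

text \<open>
  An element \<open>a\<close> lies in \<open>syzygy_ann A l\<close> iff it kills \<open>Ext A (l + 1)\<close>: taking the
  \<open>(l + 1)\<close>-st syzygy of \<open>M\<close>, that is the image of \<open>d l\<close>, as second argument, the class of the
  projection onto it is killed by \<open>a\<close> iff \<open>a\<close> times its identity extends along its inclusion into
  \<open>A^(r l)\<close>, and a lift of this extension is the map \<open>s\<close>.
\<close>

definition syzygy_ann :: "('a, 'e) ring_scheme \<Rightarrow> nat \<Rightarrow> 'a set" where
  "syzygy_ann A l = {a \<in> carrier A. \<forall>r d. free_exact A r d \<longrightarrow>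
    (\<exists>s. linear_map A (free_module A (r l)) (free_module A (r (Suc l))) s \<and>
      (\<forall>v\<in>carrier (free_module A (r (Suc l))).
        d l (s (d l v)) = a \<odot>\<^bsub>free_module A (r l)\<^esub> d l v))}"

lemma syzygy_annE:
  assumes "a \<in> syzygy_ann A l" "free_exact A r d"
  obtains s where "linear_map A (free_module A (r l)) (free_module A (r (Suc l))) s"
    "\<And>v. v \<in> carrier (free_module A (r (Suc l))) \<Longrightarrow>
        d l (s (d l v)) = a \<odot>\<^bsub>free_module A (r l)\<^esub> d l v"
  using assms unfolding syzygy_ann_def by blast

lemma syzygy_ann_closed: "a \<in> syzygy_ann A l \<Longrightarrow> a \<in> carrier A"
  by (simp add: syzygy_ann_def)

lemma syzygy_annI:
  assumes "a \<in> carrier A"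
    and "\<And>r d. free_exact A r d \<Longrightarrow>
      \<exists>s. linear_map A (free_module A (r l)) (free_module A (r (Suc l))) s \<and>
      (\<forall>v\<in>carrier (free_module A (r (Suc l))).
        d l (s (d l v)) = a \<odot>\<^bsub>free_module A (r l)\<^esub> d l v)"
  shows "a \<in> syzygy_ann A l"
  using assms by (simp add: syzygy_ann_def)

text \<open>An exact sequence without its first term is exact, and degree \<open>l\<close> of the
  shorter one is degree \<open>l + 1\<close> of the longer one.\<close>

lemma syzygy_ann_mono:
  assumes "l \<le> l'"
  shows "syzygy_ann A l \<subseteq> syzygy_ann A l'"
proof -
  have "syzygy_ann A l \<subseteq> syzygy_ann A (Suc l)" for l
    using free_exact_shift unfolding syzygy_ann_def by fast
  then show ?thesis using assms by (rule lift_Suc_mono_le[of "syzygy_ann A"])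
qed

lemma (in free_modules) syzygy_ann_mult:
  assumes "a \<in> syzygy_ann R l" "c \<in> carrier R"
  shows "c \<otimes> a \<in> syzygy_ann R l"
proof (rule syzygy_annI)
  note [simp] = syzygy_ann_closed[OF assms(1)] assms(2)
  show "c \<otimes> a \<in> carrier R" by simp
  fix r d assume d: "free_exact R r d"
  obtain s where s: "linear_map R (free_module R (r l)) (free_module R (r (Suc l))) s"
    "\<And>v. v \<in> carrier (free_module R (r (Suc l))) \<Longrightarrow>
        d l (s (d l v)) = a \<odot>\<^bsub>free_module R (r l)\<^esub> d l v"
    by (rule syzygy_annE[OF assms(1) d]) blast
  note d' = free_exact_linear[OF d, of l]
  show "\<exists>s. linear_map R (free_module R (r l)) (free_module R (r (Suc l))) s \<and>
      (\<forall>v\<in>carrier (free_module R (r (Suc l))).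
        d l (s (d l v)) = (c \<otimes> a) \<odot>\<^bsub>free_module R (r l)\<^esub> d l v)"
    using s linear_map_simps[OF d'] linear_map_closed[OF s(1)]
    by (intro exI[of _ "\<lambda>v. c \<odot>\<^bsub>free_module R (r (Suc l))\<^esub> s v"] conjI linear_map_scale module_free)
      (auto simp: F.smult_assoc1)
qed

section \<open>Lifting along surjections, and quotients by a nonzerodivisor\<close>

locale surjective_ring_change = ring_change +
  assumes surj: "\<phi> ` carrier S = carrier R"
begin

lemma map_vec_surj:
  assumes "w \<in> carrier (free_module R r)"
  obtains v where "v \<in> carrier (free_module S r)" "map_vec \<phi> r v = w"
proof -
  have "\<forall>i. \<exists>a. i < r \<longrightarrow> a \<in> carrier S \<and> \<phi> a = w i"
    using R.free_closed[OF assms] surj by (metis imageE)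
  then obtain c where "\<And>i. i < r \<Longrightarrow> c i \<in> carrier S \<and> \<phi> (c i) = w i" by metis
  then show ?thesis
    using assms by (intro that[of "\<lambda>i\<in>{..<r}. c i"])
      (simp_all add: map_vec_def S.carrier_free R.carrier_free PiE_iff extensional_def restrict_def fun_eq_iff)
qed

lemma lift_linear_map:
  assumes "linear_map R (free_module R p) (free_module R q) d"
  obtains D where "linear_map S (free_module S p) (free_module S q) D"
    "\<And>v. v \<in> carrier (free_module S p) \<Longrightarrow> map_vec \<phi> q (D v) = d (map_vec \<phi> p v)"
proof (rule S.linear_map_factor[OF S.module_free module_restrict map_vec_linear
      linear_map_comp[OF linear_map_restrict_scalars[OF hom assms] map_vec_linear]])
  show "d (map_vec \<phi> p (std_vec S p k)) \<in> map_vec \<phi> q ` carrier (free_module S q)" for k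
    by (rule map_vec_surj[OF linear_map_closed[OF assms map_vec_closed[OF S.std_vec_closed]], of k])
      (metis image_eqI)
qed (use that in blast)

end

text \<open>Stands for \<open>R = S/(x)\<close> with \<open>x\<close> a nonzerodivisor. The map is
  kept abstract because some instances are coset rings and others are rings of power series.\<close>

locale nzd_quotient = surjective_ring_change +
  fixes x
  assumes x_closed [simp]: "x \<in> carrier S"
    and x_kernel: "a \<in> carrier S \<Longrightarrow> \<phi> a = \<zero>\<^bsub>R\<^esub> \<Longrightarrow> \<exists>b\<in>carrier S. a = x \<otimes>\<^bsub>S\<^esub> b"
    and x_zero: "\<phi> x = \<zero>\<^bsub>R\<^esub>"
    and x_nzd: "a \<in> carrier S \<Longrightarrow> x \<otimes>\<^bsub>S\<^esub> a = \<zero>\<^bsub>S\<^esub> \<Longrightarrow> a = \<zero>\<^bsub>S\<^esub>"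
begin

lemma map_vec_x: "v \<in> carrier (free_module S r) \<Longrightarrow>
    map_vec \<phi> r (x \<odot>\<^bsub>free_module S r\<^esub> v) = \<zero>\<^bsub>free_module R r\<^esub>"
  by (simp add: map_vec_smult x_zero)

lemma map_vec_kernel:
  assumes "v \<in> carrier (free_module S r)" "map_vec \<phi> r v = \<zero>\<^bsub>free_module R r\<^esub>"
  obtains w where "w \<in> carrier (free_module S r)" "v = x \<odot>\<^bsub>free_module S r\<^esub> w"
proof -
  have "\<phi> (v i) = \<zero>\<^bsub>R\<^esub>" if "i < r" for i
    using that fun_cong[OF assms(2), of i] by (simp add: map_vec_def R.zero_free)
  then have "\<forall>i. \<exists>b. i < r \<longrightarrow> b \<in> carrier S \<and> v i = x \<otimes>\<^bsub>S\<^esub> b"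
    using x_kernel S.free_closed[OF assms(1)] by blast
  then obtain b where "\<And>i. i < r \<Longrightarrow> b i \<in> carrier S \<and> v i = x \<otimes>\<^bsub>S\<^esub> b i" by metis
  then show ?thesis
    using assms(1) by (intro that[of "\<lambda>i\<in>{..<r}. b i"] S.free_eqI[where r = r])
      (simp_all add: S.smult_free S.carrier_free PiE_iff)
qed

lemma smult_x_zero:
  assumes "v \<in> carrier (free_module S r)" "x \<odot>\<^bsub>free_module S r\<^esub> v = \<zero>\<^bsub>free_module S r\<^esub>"
  shows "v = \<zero>\<^bsub>free_module S r\<^esub>"
proof (rule S.free_eqI)
  fix i assume i: "i < r"
  then have "x \<otimes>\<^bsub>S\<^esub> v i = \<zero>\<^bsub>S\<^esub>"
    using fun_cong[OF assms(2), of i] by (simp add: S.smult_free S.zero_free)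
  then show "v i = \<zero>\<^bsub>free_module S r\<^esub> i"
    using i x_nzd S.free_closed[OF assms(1)] by (simp add: S.zero_free)
qed (use assms in auto)

lemma smult_x_cancel:
  assumes "v \<in> carrier (free_module S r)" "w \<in> carrier (free_module S r)"
    "x \<odot>\<^bsub>free_module S r\<^esub> v = x \<odot>\<^bsub>free_module S r\<^esub> w"
  shows "v = w"
proof -
  have "x \<odot>\<^bsub>free_module S r\<^esub> (v \<ominus>\<^bsub>free_module S r\<^esub> w) = \<zero>\<^bsub>free_module S r\<^esub>"
    using assms by (simp add: S.F.group_norm)
  then have "v \<ominus>\<^bsub>free_module S r\<^esub> w = \<zero>\<^bsub>free_module S r\<^esub>"
    using smult_x_zero assms by blast
  then show ?thesis using assms S.F.minus_eq_zero_iff by blast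
qed

text \<open>A map that is zero modulo \<open>x\<close> on the basis takes basis vectors into the
  image of multiplication by \<open>x\<close>, so it factors through that multiplication.\<close>

lemma divide_linear_map:
  assumes "linear_map S (free_module S p) (free_module S q) h"
    "\<And>k. k < p \<Longrightarrow> map_vec \<phi> q (h (std_vec S p k)) = \<zero>\<^bsub>free_module R q\<^esub>"
  obtains t where "linear_map S (free_module S p) (free_module S q) t"
    "\<And>v. v \<in> carrier (free_module S p) \<Longrightarrow> h v = x \<odot>\<^bsub>free_module S q\<^esub> t v"
proof (rule S.linear_map_factor[OF S.module_free S.module_free
      linear_map_scale[OF S.module_free linear_map_id x_closed] assms(1)])
  show "h (std_vec S p k) \<in> (\<odot>\<^bsub>free_module S q\<^esub>) x ` carrier (free_module S q)" if "k < p" for k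
    using map_vec_kernel[OF _ assms(2)[OF that]] linear_map_closed[OF assms(1)]
    by (metis S.std_vec_closed image_eqI)
qed (use that in metis)

end

section \<open>Lifting and descending annihilation\<close>

text \<open>Direct sums are realized inside \<open>free_module\<close> by concatenation, since the
  terms of a \<open>free_exact\<close> sequence have to be of that form.\<close>

definition vec_append :: "nat \<Rightarrow> nat \<Rightarrow> (nat \<Rightarrow> 'a) \<Rightarrow> (nat \<Rightarrow> 'a) \<Rightarrow> nat \<Rightarrow> 'a" where
  "vec_append p q u v = (\<lambda>i\<in>{..<p + q}. if i < p then u i else v (i - p))"

definition vec_fst :: "nat \<Rightarrow> (nat \<Rightarrow> 'a) \<Rightarrow> nat \<Rightarrow> 'a" where
  "vec_fst p w = (\<lambda>i\<in>{..<p}. w i)"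

definition vec_snd :: "nat \<Rightarrow> nat \<Rightarrow> (nat \<Rightarrow> 'a) \<Rightarrow> nat \<Rightarrow> 'a" where
  "vec_snd p q w = (\<lambda>i\<in>{..<q}. w (p + i))"

context free_modules
begin

lemma vec_append_closed [simp]:
  "u \<in> carrier (free_module R p) \<Longrightarrow> v \<in> carrier (free_module R q) \<Longrightarrow>
    vec_append p q u v \<in> carrier (free_module R (p + q))"
  unfolding vec_append_def by (rule restrict_closed) (auto simp: free_closed)

lemma vec_fst_append [simp]: "u \<in> carrier (free_module R p) \<Longrightarrow> vec_fst p (vec_append p q u v) = u"
  and vec_snd_append [simp]: "v \<in> carrier (free_module R q) \<Longrightarrow> vec_snd p q (vec_append p q u v) = v"
  by (auto simp: vec_fst_def vec_snd_def vec_append_def carrier_free PiE_iff extensional_def fun_eq_iff)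

lemma vec_append_split:
  "w \<in> carrier (free_module R (p + q)) \<Longrightarrow> vec_append p q (vec_fst p w) (vec_snd p q w) = w"
  by (auto simp: vec_fst_def vec_snd_def vec_append_def carrier_free PiE_iff extensional_def fun_eq_iff)

lemma vec_fst_linear: "linear_map R (free_module R (p + q)) (free_module R p) (vec_fst p)"
  and vec_snd_linear: "linear_map R (free_module R (p + q)) (free_module R q) (vec_snd p q)"
  unfolding vec_fst_def vec_snd_def
  by (rule linear_mapI; auto simp: free_simps fun_eq_iff PiE_iff)+

lemma vec_append_linear:
  assumes "linear_map R M (free_module R p) g" "linear_map R M (free_module R q) h"
  shows "linear_map R M (free_module R (p + q)) (\<lambda>x. vec_append p q (g x) (h x))"
proof (rule linear_mapI)
  fix x y assume "x \<in> carrier M" "y \<in> carrier M"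
  then show "vec_append p q (g (x \<oplus>\<^bsub>M\<^esub> y)) (h (x \<oplus>\<^bsub>M\<^esub> y)) =
      vec_append p q (g x) (h x) \<oplus>\<^bsub>free_module R (p + q)\<^esub> vec_append p q (g y) (h y)"
    by (auto simp: linear_map_add[OF assms(1)] linear_map_add[OF assms(2)] vec_append_def add_free
        restrict_def fun_eq_iff)
next
  fix a x assume "a \<in> carrier R" "x \<in> carrier M"
  then show "vec_append p q (g (a \<odot>\<^bsub>M\<^esub> x)) (h (a \<odot>\<^bsub>M\<^esub> x)) =
      a \<odot>\<^bsub>free_module R (p + q)\<^esub> vec_append p q (g x) (h x)"
    by (auto simp: linear_map_smult[OF assms(1)] linear_map_smult[OF assms(2)] vec_append_def smult_free
        restrict_def fun_eq_iff)
qed (simp add: linear_map_closed[OF assms(1)] linear_map_closed[OF assms(2)])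

lemma vec_append_inject:
  "\<lbrakk>u \<in> carrier (free_module R p); v \<in> carrier (free_module R q); u' \<in> carrier (free_module R p);
    v' \<in> carrier (free_module R q)\<rbrakk> \<Longrightarrow>
    vec_append p q u v = vec_append p q u' v' \<longleftrightarrow> u = u' \<and> v = v'"
  by (metis vec_fst_append vec_snd_append)

lemma vec_append_zero:
  "vec_append p q \<zero>\<^bsub>free_module R p\<^esub> \<zero>\<^bsub>free_module R q\<^esub> = \<zero>\<^bsub>free_module R (p + q)\<^esub>"
  by (auto simp: vec_append_def free_simps fun_eq_iff)

lemma vec_append_smult:
  "a \<odot>\<^bsub>free_module R (p + q)\<^esub> vec_append p q u v =
    vec_append p q (a \<odot>\<^bsub>free_module R p\<^esub> u) (a \<odot>\<^bsub>free_module R q\<^esub> v)"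
  by (auto simp: vec_append_def free_simps fun_eq_iff)

lemma vec_append_add:
  "vec_append p q u v \<oplus>\<^bsub>free_module R (p + q)\<^esub> vec_append p q u' v' =
    vec_append p q (u \<oplus>\<^bsub>free_module R p\<^esub> u') (v \<oplus>\<^bsub>free_module R q\<^esub> v')"
  by (auto simp: vec_append_def free_simps fun_eq_iff)

end

lemmas (in free_modules) linear_map_free_simps =
  linear_map_closed linear_map_add linear_map_smult
  linear_map_zero[OF module_free module_free] linear_map_uminus[OF module_free module_free]
  linear_map_minus[OF module_free module_free]

text \<open>Makes the method \<open>algebra\<close> decide additive identities in a module.\<close>

lemmas (in module) additive_simprules
  [algebra module "ring.zero M" "ring.add M" "a_inv M" "a_minus M"] =
  M.a_closed M.zero_closed M.a_inv_closed M.minus_closed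
  M.a_assoc M.l_zero M.l_neg M.a_comm M.minus_eq
  M.r_zero M.r_neg M.r_neg2 M.r_neg1 M.minus_add M.minus_minus M.a_lcomm

context module
begin

lemma add_minus_cancel:
  "x \<in> carrier M \<Longrightarrow> y \<in> carrier M \<Longrightarrow> x \<oplus>\<^bsub>M\<^esub> y \<ominus>\<^bsub>M\<^esub> y = x"
  by algebra

lemma smult_r_diff:
  "a \<in> carrier R \<Longrightarrow> x \<in> carrier M \<Longrightarrow> y \<in> carrier M \<Longrightarrow>
    a \<odot>\<^bsub>M\<^esub> (x \<ominus>\<^bsub>M\<^esub> y) = a \<odot>\<^bsub>M\<^esub> x \<ominus>\<^bsub>M\<^esub> a \<odot>\<^bsub>M\<^esub> y"
  by (simp add: a_minus_def smult_r_distr smult_r_minus)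

lemma neg_zero: "\<ominus>\<^bsub>M\<^esub> \<zero>\<^bsub>M\<^esub> = \<zero>\<^bsub>M\<^esub>"
  by (simp add: M.minus_equality)

lemma eq_minus_of_add_eq_zero:
  assumes "x \<in> carrier M" "y \<in> carrier M" "z \<in> carrier M" "x \<oplus>\<^bsub>M\<^esub> y \<oplus>\<^bsub>M\<^esub> z = \<zero>\<^bsub>M\<^esub>"
  shows "z = \<ominus>\<^bsub>M\<^esub> x \<ominus>\<^bsub>M\<^esub> y"
proof -
  have "z = (x \<oplus>\<^bsub>M\<^esub> y \<oplus>\<^bsub>M\<^esub> z) \<ominus>\<^bsub>M\<^esub> x \<ominus>\<^bsub>M\<^esub> y"
    using assms(1-3) by algebra
  then show ?thesis using assms by (simp add: a_minus_def)
qed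

lemma add_minus_diff_add:
  "\<lbrakk>a \<in> carrier M; b \<in> carrier M; c \<in> carrier M\<rbrakk> \<Longrightarrow>
    a \<oplus>\<^bsub>M\<^esub> c \<ominus>\<^bsub>M\<^esub> (a \<ominus>\<^bsub>M\<^esub> b \<oplus>\<^bsub>M\<^esub> c) = b"
  by algebra

lemma add_neg_diffs:
  "\<lbrakk>a \<in> carrier M; b \<in> carrier M; c \<in> carrier M; d \<in> carrier M\<rbrakk> \<Longrightarrow>
    a \<oplus>\<^bsub>M\<^esub> c \<oplus>\<^bsub>M\<^esub> (\<ominus>\<^bsub>M\<^esub> (a \<ominus>\<^bsub>M\<^esub> b) \<ominus>\<^bsub>M\<^esub> (c \<ominus>\<^bsub>M\<^esub> d)) = b \<oplus>\<^bsub>M\<^esub> d"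
  by algebra

lemma minus_add_cancel:
  "x \<in> carrier M \<Longrightarrow> y \<in> carrier M \<Longrightarrow> x \<ominus>\<^bsub>M\<^esub> y \<oplus>\<^bsub>M\<^esub> y = x"
  by algebra

lemma add_minus_add:
  "\<lbrakk>a \<in> carrier M; b \<in> carrier M; c \<in> carrier M; d \<in> carrier M\<rbrakk> \<Longrightarrow>
    a \<oplus>\<^bsub>M\<^esub> b \<ominus>\<^bsub>M\<^esub> (c \<oplus>\<^bsub>M\<^esub> d) = a \<ominus>\<^bsub>M\<^esub> c \<oplus>\<^bsub>M\<^esub> (b \<ominus>\<^bsub>M\<^esub> d)"
  by algebra

lemma add_minus_add_cancel_left:
  "\<lbrakk>a \<in> carrier M; b \<in> carrier M; c \<in> carrier M\<rbrakk> \<Longrightarrow>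
    a \<oplus>\<^bsub>M\<^esub> b \<ominus>\<^bsub>M\<^esub> (a \<oplus>\<^bsub>M\<^esub> c) = b \<ominus>\<^bsub>M\<^esub> c"
  by algebra

lemma add_neg_add_cancel:
  "\<lbrakk>a \<in> carrier M; b \<in> carrier M; c \<in> carrier M\<rbrakk> \<Longrightarrow>
    a \<oplus>\<^bsub>M\<^esub> b \<oplus>\<^bsub>M\<^esub> (\<ominus>\<^bsub>M\<^esub> a \<oplus>\<^bsub>M\<^esub> c) = b \<oplus>\<^bsub>M\<^esub> c"
  by algebra

lemma add_neg_cancel_left:
  "x \<in> carrier M \<Longrightarrow> y \<in> carrier M \<Longrightarrow> x \<oplus>\<^bsub>M\<^esub> y \<oplus>\<^bsub>M\<^esub> \<ominus>\<^bsub>M\<^esub> x = y"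
  by algebra

lemma add_add_minus_cancel:
  "\<lbrakk>a \<in> carrier M; b \<in> carrier M; c \<in> carrier M\<rbrakk> \<Longrightarrow>
    a \<oplus>\<^bsub>M\<^esub> b \<oplus>\<^bsub>M\<^esub> (c \<ominus>\<^bsub>M\<^esub> b) = a \<oplus>\<^bsub>M\<^esub> c"
  by algebra

lemma minus_minus_cancel:
  "x \<in> carrier M \<Longrightarrow> y \<in> carrier M \<Longrightarrow> x \<ominus>\<^bsub>M\<^esub> (x \<ominus>\<^bsub>M\<^esub> y) = y"
  by algebra

end

section \<open>Reduction modulo a nonzerodivisor and lifting of homotopies\<close>

context nzd_quotient
begin

text \<open>If \<open>D u = x v\<close>, then \<open>x D v = 0\<close>, so \<open>v\<close> is a
  cycle and \<open>v = D v'\<close>; now \<open>u - x v'\<close> is a cycle with the same reduction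
  as \<open>u\<close>. Exactness is used at two consecutive places, hence the first term is
  lost.\<close>

lemma free_exact_reduction:
  assumes ex: "free_exact S r D"
    and lin: "\<And>j. linear_map R (free_module R (r (Suc j))) (free_module R (r j)) (d j)"
    and d: "\<And>j v. v \<in> carrier (free_module S (r (Suc j))) \<Longrightarrow>
      d j (map_vec \<phi> (r (Suc j)) v) = map_vec \<phi> (r j) (D j v)"
  shows "free_exact R (\<lambda>j. r (Suc j)) (\<lambda>j. d (Suc j))"
  unfolding free_exact_def
proof (intro conjI allI ballI lin)
  fix j w assume w: "w \<in> carrier (free_module R (r (Suc (Suc j))))"
  note linD = free_exact_linear[OF ex]
  note [simp] = linear_map_closed[OF linD]
  obtain u where u: "u \<in> carrier (free_module S (r (Suc (Suc j))))"
    and wu: "map_vec \<phi> (r (Suc (Suc j))) u = w"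
    using map_vec_surj[OF w] by blast
  show "d (Suc j) w = \<zero>\<^bsub>free_module R (r (Suc j))\<^esub> \<longleftrightarrow>
    w \<in> d (Suc (Suc j)) ` carrier (free_module R (r (Suc (Suc (Suc j)))))"
  proof
    assume "d (Suc j) w = \<zero>\<^bsub>free_module R (r (Suc j))\<^esub>"
    then have "map_vec \<phi> (r (Suc j)) (D (Suc j) u) = \<zero>\<^bsub>free_module R (r (Suc j))\<^esub>"
      using d[OF u] wu by simp
    then obtain v where v: "v \<in> carrier (free_module S (r (Suc j)))"
      and Du: "D (Suc j) u = x \<odot>\<^bsub>free_module S (r (Suc j))\<^esub> v"
      using map_vec_kernel u by (metis linear_map_closed[OF linD])
    have "x \<odot>\<^bsub>free_module S (r j)\<^esub> D j v = D j (D (Suc j) u)"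
      using v by (simp add: Du linear_map_smult[OF linD])
    also have "\<dots> = \<zero>\<^bsub>free_module S (r j)\<^esub>"
      using free_exact_complex[OF ex u] .
    finally have "D j v = \<zero>\<^bsub>free_module S (r j)\<^esub>"
      by (rule smult_x_zero[rotated]) (use v in simp)
    then obtain v' where v': "v' \<in> carrier (free_module S (r (Suc (Suc j))))" "v = D (Suc j) v'"
      using free_exact_lift[OF ex v] by blast
    let ?u = "u \<ominus>\<^bsub>free_module S (r (Suc (Suc j)))\<^esub> x \<odot>\<^bsub>free_module S (r (Suc (Suc j)))\<^esub> v'"
    have u': "?u \<in> carrier (free_module S (r (Suc (Suc j))))"
      using u v' by simp
    have "D (Suc j) ?u = \<zero>\<^bsub>free_module S (r (Suc j))\<^esub>"
      using u v' Du
      by (simp add: S.linear_map_free_simps[OF linD] S.F.minus_eq_zero_iff)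
    then obtain z where z: "z \<in> carrier (free_module S (r (Suc (Suc (Suc j)))))" "?u = D (Suc (Suc j)) z"
      using free_exact_lift[OF ex u'] by blast
    have "w = map_vec \<phi> (r (Suc (Suc j))) ?u"
      using u v'(1) w by (simp add: map_vec_simps x_zero wu R.F.group_norm)
    also have "\<dots> = d (Suc (Suc j)) (map_vec \<phi> (r (Suc (Suc (Suc j)))) z)"
      unfolding z(2) using d[OF z(1)] by simp
    finally show "w \<in> d (Suc (Suc j)) ` carrier (free_module R (r (Suc (Suc (Suc j)))))"
      using z(1) by (metis image_eqI map_vec_closed)
  next
    assume "w \<in> d (Suc (Suc j)) ` carrier (free_module R (r (Suc (Suc (Suc j)))))"
    then obtain z where z: "z \<in> carrier (free_module R (r (Suc (Suc (Suc j)))))" "w = d (Suc (Suc j)) z"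
      by blast
    obtain v where v: "v \<in> carrier (free_module S (r (Suc (Suc (Suc j)))))"
      "map_vec \<phi> (r (Suc (Suc (Suc j)))) v = z"
      using map_vec_surj[OF z(1)] by blast
    have "d (Suc j) w = map_vec \<phi> (r (Suc j)) (D (Suc j) (D (Suc (Suc j)) v))"
      using d[OF v(1)] v d[of "D (Suc (Suc j)) v" "Suc j"] z(2) by simp
    then show "d (Suc j) w = \<zero>\<^bsub>free_module R (r (Suc j))\<^esub>"
      using free_exact_complex[OF ex v(1)] by (simp add: map_vec_zero)
  qed
qed

text \<open>
  Reducing modulo \<open>x\<close> shifts exactness by one, so a homotopy for \<open>\<phi> b\<close> lifts to one for \<open>b\<close> up
  to an error divisible by \<open>x\<close>; the error factors through the next differential on both sides.
\<close>

lemma lift_homotopy: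
  assumes b: "b \<in> carrier S" "\<phi> b \<in> syzygy_ann R l" and ex: "free_exact S r D"
  obtains s t u where
    "linear_map S (free_module S (r (Suc l))) (free_module S (r (Suc (Suc l)))) s"
    "linear_map S (free_module S (r (Suc (Suc l)))) (free_module S (r (Suc l))) t"
    "linear_map S (free_module S (r (Suc (Suc l)))) (free_module S (r (Suc (Suc l)))) u"
    "\<And>v. v \<in> carrier (free_module S (r (Suc (Suc l)))) \<Longrightarrow> D (Suc l) (s (D (Suc l) v)) =
      b \<odot>\<^bsub>free_module S (r (Suc l))\<^esub> D (Suc l) v \<oplus>\<^bsub>free_module S (r (Suc l))\<^esub>
      x \<odot>\<^bsub>free_module S (r (Suc l))\<^esub> t v"
    "\<And>v. v \<in> carrier (free_module S (r (Suc (Suc l)))) \<Longrightarrow> t v = D (Suc l) (u v)"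
    "\<And>v. v \<in> carrier (free_module S (r (Suc (Suc l)))) \<Longrightarrow>
      D (Suc l) v = \<zero>\<^bsub>free_module S (r (Suc l))\<^esub> \<Longrightarrow> t v = \<zero>\<^bsub>free_module S (r (Suc l))\<^esub>"
proof -
  note linD = free_exact_linear[OF ex]
  note [simp] = b(1) linear_map_closed[OF linD]
  have "\<exists>d. linear_map R (free_module R (r (Suc j))) (free_module R (r j)) d \<and>
      (\<forall>v\<in>carrier (free_module S (r (Suc j))).
        d (map_vec \<phi> (r (Suc j)) v) = map_vec \<phi> (r j) (D j v))" for j
    by (rule base_change[OF linD, of j]) blast
  then obtain d where lin: "\<And>j. linear_map R (free_module R (r (Suc j))) (free_module R (r j)) (d j)"
    and d: "\<And>j v. v \<in> carrier (free_module S (r (Suc j))) \<Longrightarrow>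
      d j (map_vec \<phi> (r (Suc j)) v) = map_vec \<phi> (r j) (D j v)"
    by metis
  have "free_exact R (\<lambda>j. r (Suc j)) (\<lambda>j. d (Suc j))"
    by (rule free_exact_reduction[OF ex lin d])
  then obtain s0 where s0: "linear_map R (free_module R (r (Suc l))) (free_module R (r (Suc (Suc l)))) s0"
    and ds0: "\<And>v. v \<in> carrier (free_module R (r (Suc (Suc l)))) \<Longrightarrow>
        d (Suc l) (s0 (d (Suc l) v)) = \<phi> b \<odot>\<^bsub>free_module R (r (Suc l))\<^esub> d (Suc l) v"
    by (rule syzygy_annE[OF b(2)]) blast
  obtain s where s: "linear_map S (free_module S (r (Suc l))) (free_module S (r (Suc (Suc l)))) s"
    and ss0: "\<And>v. v \<in> carrier (free_module S (r (Suc l))) \<Longrightarrow>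
      map_vec \<phi> (r (Suc (Suc l))) (s v) = s0 (map_vec \<phi> (r (Suc l)) v)"
    by (rule lift_linear_map[OF s0]) blast
  note [simp] = linear_map_closed[OF s]
  \<comment> \<open>The error of the lifted homotopy; it vanishes modulo \<open>x\<close> because
    \<open>s0\<close> is a homotopy for \<open>\<phi> b\<close>.\<close>
  let ?h = "\<lambda>v. D (Suc l) (s (D (Suc l) v)) \<ominus>\<^bsub>free_module S (r (Suc l))\<^esub>
      b \<odot>\<^bsub>free_module S (r (Suc l))\<^esub> D (Suc l) v"
  have h: "linear_map S (free_module S (r (Suc (Suc l)))) (free_module S (r (Suc l))) ?h"
    by (intro linear_map_diff linear_map_scale S.module_free b linD
        linear_map_comp[OF linD] linear_map_comp[OF s])
  have h0: "map_vec \<phi> (r (Suc l)) (?h v) = \<zero>\<^bsub>free_module R (r (Suc l))\<^esub>"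
    if v: "v \<in> carrier (free_module S (r (Suc (Suc l))))" for v
    using v ds0[OF map_vec_closed[OF v]]
    by (simp add: map_vec_simps d[symmetric] ss0 linear_map_closed[OF lin] R.F.minus_eq_zero_iff)
  obtain t where t: "linear_map S (free_module S (r (Suc (Suc l)))) (free_module S (r (Suc l))) t"
    and ht: "\<And>v. v \<in> carrier (free_module S (r (Suc (Suc l)))) \<Longrightarrow>
      ?h v = x \<odot>\<^bsub>free_module S (r (Suc l))\<^esub> t v"
    by (rule divide_linear_map[OF h h0]) auto
  note [simp] = linear_map_closed[OF t]
  \<comment> \<open>\<open>x D (t v)\<close> is \<open>D\<close> of the error, which is zero because
    consecutive differentials compose to zero. Cancelling \<open>x\<close> puts \<open>t v\<close>
    into the kernel of \<open>D l\<close>, the image of \<open>D (Suc l)\<close>, and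
    \<open>u\<close> is a lift.\<close>
  have Dt: "D l (t v) = \<zero>\<^bsub>free_module S (r l)\<^esub>"
    if v: "v \<in> carrier (free_module S (r (Suc (Suc l))))" for v
  proof (rule smult_x_zero)
    have "x \<odot>\<^bsub>free_module S (r l)\<^esub> D l (t v) = D l (?h v)"
      using v by (simp add: ht linear_map_smult[OF linD])
    also have "\<dots> = \<zero>\<^bsub>free_module S (r l)\<^esub>"
      using v by (simp add: S.linear_map_free_simps[OF linD] free_exact_complex[OF ex]
          S.F.minus_eq_zero_iff)
    finally show "x \<odot>\<^bsub>free_module S (r l)\<^esub> D l (t v) = \<zero>\<^bsub>free_module S (r l)\<^esub>" .
  qed (use v in simp)
  obtain u where u: "linear_map S (free_module S (r (Suc (Suc l)))) (free_module S (r (Suc (Suc l)))) u"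
    and tu: "\<And>v. v \<in> carrier (free_module S (r (Suc (Suc l)))) \<Longrightarrow> D (Suc l) (u v) = t v"
  proof (rule S.linear_map_factor[OF S.module_free S.module_free linD[of "Suc l"] t])
    fix k show "t (std_vec S (r (Suc (Suc l))) k) \<in> D (Suc l) ` carrier (free_module S (r (Suc (Suc l))))"
      by (rule free_exact_lift[OF ex _ Dt[of "std_vec S (r (Suc (Suc l))) k"]]) auto
  qed blast
  show ?thesis
  proof (rule that[OF s t u])
    fix v assume v: "v \<in> carrier (free_module S (r (Suc (Suc l))))"
    show "D (Suc l) (s (D (Suc l) v)) =
      b \<odot>\<^bsub>free_module S (r (Suc l))\<^esub> D (Suc l) v \<oplus>\<^bsub>free_module S (r (Suc l))\<^esub>
      x \<odot>\<^bsub>free_module S (r (Suc l))\<^esub> t v"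
      using v by (simp add: ht[symmetric] S.F.group_norm)
    show "t v = D (Suc l) (u v)" by (simp add: tu v)
    assume D0: "D (Suc l) v = \<zero>\<^bsub>free_module S (r (Suc l))\<^esub>"
    have "x \<odot>\<^bsub>free_module S (r (Suc l))\<^esub> t v = \<zero>\<^bsub>free_module S (r (Suc l))\<^esub>"
      using v by (simp add: ht[symmetric] D0 linear_map_zero[OF S.module_free S.module_free s]
          linear_map_zero[OF S.module_free S.module_free linD] S.F.group_norm)
    then show "t v = \<zero>\<^bsub>free_module S (r (Suc l))\<^esub>"
      by (rule smult_x_zero[rotated]) (use v in simp)
  qed
qed

text \<open>With \<open>c\<close> a homotopy for \<open>x\<close>, the error \<open>x t\<close> is
  removed by \<open>u c\<close>: \<open>t\<close> vanishes on the kernel of \<open>D\<close>, which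
  contains \<open>x v - c (D v)\<close>, so \<open>D u c D = t c D = x t\<close>.\<close>

lemma lift_syzygy_ann:
  assumes b: "b \<in> carrier S" "\<phi> b \<in> syzygy_ann R l" and xl: "x \<in> syzygy_ann S (Suc l)"
  shows "b \<in> syzygy_ann S (Suc l)"
proof (rule syzygy_annI[OF b(1)])
  fix r D assume ex: "free_exact S r D"
  note linD = free_exact_linear[OF ex]
  obtain s t u where
    s: "linear_map S (free_module S (r (Suc l))) (free_module S (r (Suc (Suc l)))) s"
    and t: "linear_map S (free_module S (r (Suc (Suc l)))) (free_module S (r (Suc l))) t"
    and u: "linear_map S (free_module S (r (Suc (Suc l)))) (free_module S (r (Suc (Suc l)))) u"
    and Ds: "\<And>v. v \<in> carrier (free_module S (r (Suc (Suc l)))) \<Longrightarrow> D (Suc l) (s (D (Suc l) v)) =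
      b \<odot>\<^bsub>free_module S (r (Suc l))\<^esub> D (Suc l) v \<oplus>\<^bsub>free_module S (r (Suc l))\<^esub>
      x \<odot>\<^bsub>free_module S (r (Suc l))\<^esub> t v"
    and tu: "\<And>v. v \<in> carrier (free_module S (r (Suc (Suc l)))) \<Longrightarrow> t v = D (Suc l) (u v)"
    and tk: "\<And>v. v \<in> carrier (free_module S (r (Suc (Suc l)))) \<Longrightarrow>
      D (Suc l) v = \<zero>\<^bsub>free_module S (r (Suc l))\<^esub> \<Longrightarrow> t v = \<zero>\<^bsub>free_module S (r (Suc l))\<^esub>"
    by (rule lift_homotopy[OF b ex]) blast
  obtain c where c: "linear_map S (free_module S (r (Suc l))) (free_module S (r (Suc (Suc l)))) c"
    and Dc: "\<And>v. v \<in> carrier (free_module S (r (Suc (Suc l)))) \<Longrightarrow>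
        D (Suc l) (c (D (Suc l) v)) = x \<odot>\<^bsub>free_module S (r (Suc l))\<^esub> D (Suc l) v"
    by (rule syzygy_annE[OF xl ex]) blast
  note [simp] = b(1) linear_map_closed[OF linD] linear_map_closed[OF s] linear_map_closed[OF t]
    linear_map_closed[OF u] linear_map_closed[OF c]
  let ?s = "\<lambda>w. s w \<ominus>\<^bsub>free_module S (r (Suc (Suc l)))\<^esub> u (c w)"
  have "D (Suc l) (?s (D (Suc l) v)) = b \<odot>\<^bsub>free_module S (r (Suc l))\<^esub> D (Suc l) v"
    if v: "v \<in> carrier (free_module S (r (Suc (Suc l))))" for v
  proof -
    let ?k = "x \<odot>\<^bsub>free_module S (r (Suc (Suc l)))\<^esub> v \<ominus>\<^bsub>free_module S (r (Suc (Suc l)))\<^esub> c (D (Suc l) v)"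
    have "t ?k = \<zero>\<^bsub>free_module S (r (Suc l))\<^esub>"
    proof (rule tk)
      show "D (Suc l) ?k = \<zero>\<^bsub>free_module S (r (Suc l))\<^esub>"
        using v by (simp add: linear_map_minus[OF S.module_free S.module_free linD]
            linear_map_smult[OF linD] Dc S.F.minus_eq_zero_iff)
    qed (use v in simp)
    then have "x \<odot>\<^bsub>free_module S (r (Suc l))\<^esub> t v = t (c (D (Suc l) v))"
      using v by (simp add: linear_map_minus[OF S.module_free S.module_free t]
            linear_map_smult[OF t] S.F.minus_eq_zero_iff)
    then show ?thesis
      using v by (simp add: S.linear_map_free_simps[OF linD] Ds tu[symmetric]
          S.F.add_minus_cancel)
  qed
  then show "\<exists>s. linear_map S (free_module S (r (Suc l))) (free_module S (r (Suc (Suc l)))) s \<and>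
      (\<forall>v\<in>carrier (free_module S (r (Suc (Suc l)))). D (Suc l) (s (D (Suc l) v)) =
        b \<odot>\<^bsub>free_module S (r (Suc l))\<^esub> D (Suc l) v)"
    by (intro exI[of _ ?s] conjI ballI linear_map_diff S.module_free s linear_map_comp[OF u c])
qed

section \<open>The mapping cone of a lifted exact sequence\<close>

context
  fixes r :: "nat \<Rightarrow> nat" and d :: "nat \<Rightarrow> (nat \<Rightarrow> 'c) \<Rightarrow> nat \<Rightarrow> 'c"
    and D E :: "nat \<Rightarrow> (nat \<Rightarrow> 'a) \<Rightarrow> nat \<Rightarrow> 'a"
  assumes ex: "free_exact R r d"
    and linD: "\<And>j. linear_map S (free_module S (r (Suc j))) (free_module S (r j)) (D j)"
    and linE: "\<And>j. linear_map S (free_module S (r (Suc (Suc j)))) (free_module S (r j)) (E j)"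
    and D: "\<And>j v. v \<in> carrier (free_module S (r (Suc j))) \<Longrightarrow>
      map_vec \<phi> (r j) (D j v) = d j (map_vec \<phi> (r (Suc j)) v)"
    and DD: "\<And>j v. v \<in> carrier (free_module S (r (Suc (Suc j)))) \<Longrightarrow>
      D j (D (Suc j) v) = x \<odot>\<^bsub>free_module S (r j)\<^esub> E j v"
begin

text \<open>
  The mapping cone below is exact over \<open>S\<close>: it resolves the first syzygy over \<open>S\<close> of the module
  resolved by \<open>d\<close> over \<open>R = S/(x)\<close>.
\<close>

definition cone_rank :: "nat \<Rightarrow> nat" where
  "cone_rank j = r (Suc j) + r j"

text \<open>The block matrix with rows \<open>(D, x)\<close> and \<open>(-E, -D)\<close>. Its square
  has the entries \<open>D D - x E\<close>, \<open>D x - x D\<close>, \<open>D E - E D\<close> and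
  \<open>D D - E x\<close>, which vanish once \<open>D\<close> and \<open>E\<close> commute.\<close>

definition cone_diff :: "nat \<Rightarrow> (nat \<Rightarrow> 'a) \<Rightarrow> nat \<Rightarrow> 'a" where
  "cone_diff j w =
    (let u = vec_fst (r (Suc (Suc j))) w; v = vec_snd (r (Suc (Suc j))) (r (Suc j)) w
     in vec_append (r (Suc j)) (r j)
      (D (Suc j) u \<oplus>\<^bsub>free_module S (r (Suc j))\<^esub> x \<odot>\<^bsub>free_module S (r (Suc j))\<^esub> v)
      (\<ominus>\<^bsub>free_module S (r j)\<^esub> E j u \<ominus>\<^bsub>free_module S (r j)\<^esub> D j v))"

lemma cone_diff_append:
  assumes "u \<in> carrier (free_module S (r (Suc (Suc j))))" "v \<in> carrier (free_module S (r (Suc j)))"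
  shows "cone_diff j (vec_append (r (Suc (Suc j))) (r (Suc j)) u v) =
    vec_append (r (Suc j)) (r j)
      (D (Suc j) u \<oplus>\<^bsub>free_module S (r (Suc j))\<^esub> x \<odot>\<^bsub>free_module S (r (Suc j))\<^esub> v)
      (\<ominus>\<^bsub>free_module S (r j)\<^esub> E j u \<ominus>\<^bsub>free_module S (r j)\<^esub> D j v)"
  using assms by (simp add: cone_diff_def Let_def)

lemma cone_diff_linear:
  "linear_map S (free_module S (cone_rank (Suc j))) (free_module S (cone_rank j)) (cone_diff j)"
  unfolding cone_diff_def Let_def cone_rank_def
  by (intro S.vec_append_linear linear_map_plus linear_map_diff linear_map_neg linear_map_scale
      linear_map_comp[OF linD] linear_map_comp[OF linE] S.module_free S.vec_fst_linear
      S.vec_snd_linear x_closed)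

text \<open>After multiplication by \<open>x\<close> both sides become \<open>D D D\<close>, and
  \<open>x\<close> cancels.\<close>

lemma homotopy_commutes:
  assumes v: "v \<in> carrier (free_module S (r (Suc (Suc (Suc j)))))"
  shows "D j (E (Suc j) v) = E j (D (Suc (Suc j)) v)"
proof (rule smult_x_cancel)
  note [simp] = linear_map_closed[OF linD] linear_map_closed[OF linE] v
  show "x \<odot>\<^bsub>free_module S (r j)\<^esub> D j (E (Suc j) v) =
      x \<odot>\<^bsub>free_module S (r j)\<^esub> E j (D (Suc (Suc j)) v)"
    using DD[of "D (Suc (Suc j)) v" j] by (simp add: linear_map_smult[OF linD, symmetric] DD[symmetric])
qed (use v in \<open>simp_all add: linear_map_closed[OF linD] linear_map_closed[OF linE]\<close>)

lemma cone_exact: "free_exact S cone_rank cone_diff"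
  unfolding free_exact_def
proof (intro conjI allI ballI cone_diff_linear)
  fix j w assume w: "w \<in> carrier (free_module S (cone_rank (Suc j)))"
  note [simp] = linear_map_closed[OF linD] linear_map_closed[OF linE]
  note lin = S.linear_map_free_simps[OF linD] S.linear_map_free_simps[OF linE]
  define a where "a = vec_fst (r (Suc (Suc j))) w"
  define b where "b = vec_snd (r (Suc (Suc j))) (r (Suc j)) w"
  have a [simp]: "a \<in> carrier (free_module S (r (Suc (Suc j))))"
    and b [simp]: "b \<in> carrier (free_module S (r (Suc j)))"
    using linear_map_closed[OF S.vec_fst_linear] linear_map_closed[OF S.vec_snd_linear] w
    unfolding a_def b_def cone_rank_def by blast+
  have wab: "w = vec_append (r (Suc (Suc j))) (r (Suc j)) a b"
    unfolding a_def b_def using S.vec_append_split w by (simp add: cone_rank_def)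
  have zero_iff: "cone_diff j w = \<zero>\<^bsub>free_module S (cone_rank j)\<^esub> \<longleftrightarrow>
      D (Suc j) a \<oplus>\<^bsub>free_module S (r (Suc j))\<^esub> x \<odot>\<^bsub>free_module S (r (Suc j))\<^esub> b =
        \<zero>\<^bsub>free_module S (r (Suc j))\<^esub> \<and>
      \<ominus>\<^bsub>free_module S (r j)\<^esub> E j a \<ominus>\<^bsub>free_module S (r j)\<^esub> D j b = \<zero>\<^bsub>free_module S (r j)\<^esub>"
    unfolding wab cone_diff_append[OF a b] cone_rank_def S.vec_append_zero[symmetric]
    by (rule S.vec_append_inject) simp_all
  show "cone_diff j w = \<zero>\<^bsub>free_module S (cone_rank j)\<^esub> \<longleftrightarrow>
    w \<in> cone_diff (Suc j) ` carrier (free_module S (cone_rank (Suc (Suc j))))"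
  proof
    assume "w \<in> cone_diff (Suc j) ` carrier (free_module S (cone_rank (Suc (Suc j))))"
    then obtain w' where w': "w' \<in> carrier (free_module S (r (Suc (Suc (Suc j))) + r (Suc (Suc j))))"
      "w = cone_diff (Suc j) w'"
      by (auto simp: cone_rank_def)
    define a' where "a' = vec_fst (r (Suc (Suc (Suc j)))) w'"
    define b' where "b' = vec_snd (r (Suc (Suc (Suc j)))) (r (Suc (Suc j))) w'"
    have a' [simp]: "a' \<in> carrier (free_module S (r (Suc (Suc (Suc j)))))"
      and b' [simp]: "b' \<in> carrier (free_module S (r (Suc (Suc j))))"
      using linear_map_closed[OF S.vec_fst_linear] linear_map_closed[OF S.vec_snd_linear] w'
      unfolding a'_def b'_def by blast+
    have "w' = vec_append (r (Suc (Suc (Suc j)))) (r (Suc (Suc j))) a' b'"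
      unfolding a'_def b'_def using S.vec_append_split w' by simp
    then have "vec_append (r (Suc (Suc j))) (r (Suc j)) a b =
      vec_append (r (Suc (Suc j))) (r (Suc j))
      (D (Suc (Suc j)) a' \<oplus>\<^bsub>free_module S (r (Suc (Suc j)))\<^esub>
        x \<odot>\<^bsub>free_module S (r (Suc (Suc j)))\<^esub> b')
      (\<ominus>\<^bsub>free_module S (r (Suc j))\<^esub> E (Suc j) a' \<ominus>\<^bsub>free_module S (r (Suc j))\<^esub> D (Suc j) b')"
      using w'(2) cone_diff_append[OF a' b'] wab by simp
    then have ab: "a = D (Suc (Suc j)) a' \<oplus>\<^bsub>free_module S (r (Suc (Suc j)))\<^esub>
        x \<odot>\<^bsub>free_module S (r (Suc (Suc j)))\<^esub> b'"
      "b = \<ominus>\<^bsub>free_module S (r (Suc j))\<^esub> E (Suc j) a' \<ominus>\<^bsub>free_module S (r (Suc j))\<^esub> D (Suc j) b'"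
      by (subst (asm) S.vec_append_inject; simp)+
    show "cone_diff j w = \<zero>\<^bsub>free_module S (cone_rank j)\<^esub>"
      unfolding zero_iff
    proof
      show "D (Suc j) a \<oplus>\<^bsub>free_module S (r (Suc j))\<^esub> x \<odot>\<^bsub>free_module S (r (Suc j))\<^esub> b =
        \<zero>\<^bsub>free_module S (r (Suc j))\<^esub>"
        unfolding ab by (simp add: lin DD S.F.group_norm)
      have "\<ominus>\<^bsub>free_module S (r j)\<^esub> E j a \<ominus>\<^bsub>free_module S (r j)\<^esub> D j b =
        \<ominus>\<^bsub>free_module S (r j)\<^esub> (E j (D (Suc (Suc j)) a') \<oplus>\<^bsub>free_module S (r j)\<^esub>
          x \<odot>\<^bsub>free_module S (r j)\<^esub> E j b') \<ominus>\<^bsub>free_module S (r j)\<^esub>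
        (\<ominus>\<^bsub>free_module S (r j)\<^esub> E j (D (Suc (Suc j)) a') \<ominus>\<^bsub>free_module S (r j)\<^esub>
          x \<odot>\<^bsub>free_module S (r j)\<^esub> E j b')"
        unfolding ab by (simp add: lin DD homotopy_commutes)
      also have "\<dots> = \<zero>\<^bsub>free_module S (r j)\<^esub>"
        by (simp add: S.F.group_norm)
      finally show "\<ominus>\<^bsub>free_module S (r j)\<^esub> E j a \<ominus>\<^bsub>free_module S (r j)\<^esub> D j b =
        \<zero>\<^bsub>free_module S (r j)\<^esub>" .
    qed
  next
    assume "cone_diff j w = \<zero>\<^bsub>free_module S (cone_rank j)\<^esub>"
    \<comment> \<open>Modulo \<open>x\<close> the first component says that \<open>a\<close> is a
      cycle for \<open>d\<close>, whence \<open>a = D a' + x b'\<close>. Inserting this and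
      cancelling \<open>x\<close> determines \<open>b\<close>.\<close>
    then have zero: "D (Suc j) a \<oplus>\<^bsub>free_module S (r (Suc j))\<^esub> x \<odot>\<^bsub>free_module S (r (Suc j))\<^esub> b =
        \<zero>\<^bsub>free_module S (r (Suc j))\<^esub>" using zero_iff by blast
    have "d (Suc j) (map_vec \<phi> (r (Suc (Suc j))) a) =
        map_vec \<phi> (r (Suc j)) (D (Suc j) a \<oplus>\<^bsub>free_module S (r (Suc j))\<^esub> x \<odot>\<^bsub>free_module S (r (Suc j))\<^esub> b)"
      by (simp add: map_vec_simps map_vec_x x_zero D[symmetric])
    then have "d (Suc j) (map_vec \<phi> (r (Suc (Suc j))) a) = \<zero>\<^bsub>free_module R (r (Suc j))\<^esub>"
      unfolding zero by (simp add: map_vec_zero)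
    then obtain z where z: "z \<in> carrier (free_module R (r (Suc (Suc (Suc j)))))"
      "map_vec \<phi> (r (Suc (Suc j))) a = d (Suc (Suc j)) z"
      using free_exact_lift[OF ex map_vec_closed[OF a]] by blast
    obtain a' where a' [simp]: "a' \<in> carrier (free_module S (r (Suc (Suc (Suc j)))))"
      and a'z: "map_vec \<phi> (r (Suc (Suc (Suc j)))) a' = z"
      using map_vec_surj[OF z(1)] by blast
    let ?k = "a \<ominus>\<^bsub>free_module S (r (Suc (Suc j)))\<^esub> D (Suc (Suc j)) a'"
    have "map_vec \<phi> (r (Suc (Suc j))) ?k = \<zero>\<^bsub>free_module R (r (Suc (Suc j)))\<^esub>"
      using linear_map_closed[OF free_exact_linear[OF ex] z(1)]
      by (simp add: map_vec_minus D a'z z(2) R.F.minus_eq_zero_iff)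
    then obtain b' where b' [simp]: "b' \<in> carrier (free_module S (r (Suc (Suc j))))"
      and kb: "?k = x \<odot>\<^bsub>free_module S (r (Suc (Suc j)))\<^esub> b'"
      by (rule map_vec_kernel[rotated]) auto
    have aa: "a = D (Suc (Suc j)) a' \<oplus>\<^bsub>free_module S (r (Suc (Suc j)))\<^esub>
        x \<odot>\<^bsub>free_module S (r (Suc (Suc j)))\<^esub> b'"
      unfolding kb[symmetric] by (simp add: S.F.group_norm)
    have "x \<odot>\<^bsub>free_module S (r (Suc j))\<^esub> (E (Suc j) a' \<oplus>\<^bsub>free_module S (r (Suc j))\<^esub>
        D (Suc j) b' \<oplus>\<^bsub>free_module S (r (Suc j))\<^esub> b) =
        D (Suc j) a \<oplus>\<^bsub>free_module S (r (Suc j))\<^esub> x \<odot>\<^bsub>free_module S (r (Suc j))\<^esub> b"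
      unfolding aa by (simp add: lin DD S.F.group_norm)
    then have *: "E (Suc j) a' \<oplus>\<^bsub>free_module S (r (Suc j))\<^esub>
        D (Suc j) b' \<oplus>\<^bsub>free_module S (r (Suc j))\<^esub> b = \<zero>\<^bsub>free_module S (r (Suc j))\<^esub>"
      unfolding zero by (rule smult_x_zero[rotated]) simp
    have bb: "b = \<ominus>\<^bsub>free_module S (r (Suc j))\<^esub> E (Suc j) a' \<ominus>\<^bsub>free_module S (r (Suc j))\<^esub> D (Suc j) b'"
      using S.F.eq_minus_of_add_eq_zero[OF _ _ _ *] by simp
    have "w = cone_diff (Suc j) (vec_append (r (Suc (Suc (Suc j)))) (r (Suc (Suc j))) a' b')"
      unfolding wab cone_diff_append[OF a' b'] using aa bb by simp
    then show "w \<in> cone_diff (Suc j) ` carrier (free_module S (cone_rank (Suc (Suc j))))"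
      using S.vec_append_closed[OF a' b'] by (auto simp: cone_rank_def)
  qed
qed

text \<open>A homotopy on the cone is a 2 by 2 block matrix. On the columns
  \<open>(x v, -D v)\<close> of the cone differential the blocks reading the first summand
  contribute multiples of \<open>x\<close>; what survives modulo \<open>x\<close> is a relation for
  \<open>s2\<close> and \<open>s4\<close>, the blocks reading the second.\<close>

lemma cone_blocks:
  assumes b: "b \<in> syzygy_ann S l"
  obtains s2 s4 where
    "linear_map S (free_module S (r l)) (free_module S (r (Suc (Suc l)))) s2"
    "linear_map S (free_module S (r l)) (free_module S (r (Suc l))) s4"
    "\<And>v. v \<in> carrier (free_module S (r (Suc l))) \<Longrightarrow>
      \<exists>z\<in>carrier (free_module S (r (Suc l))).
        D (Suc l) (s2 (D l v)) = x \<odot>\<^bsub>free_module S (r (Suc l))\<^esub> z"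
    "\<And>v. v \<in> carrier (free_module S (r (Suc l))) \<Longrightarrow>
      \<exists>z\<in>carrier (free_module S (r l)).
        E l (s2 (D l v)) \<oplus>\<^bsub>free_module S (r l)\<^esub> D l (s4 (D l v)) =
        x \<odot>\<^bsub>free_module S (r l)\<^esub> z \<ominus>\<^bsub>free_module S (r l)\<^esub> b \<odot>\<^bsub>free_module S (r l)\<^esub> D l v"
proof -
  let ?F = "\<lambda>p. free_module S p"
  have bc [simp]: "b \<in> carrier S" using syzygy_ann_closed[OF b] .
  obtain s where s: "linear_map S (?F (cone_rank l)) (?F (cone_rank (Suc l))) s"
    and cs: "\<And>w. w \<in> carrier (?F (cone_rank (Suc l))) \<Longrightarrow>
      cone_diff l (s (cone_diff l w)) = b \<odot>\<^bsub>?F (cone_rank l)\<^esub> cone_diff l w"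
    by (rule syzygy_annE[OF b cone_exact]) blast
  note [simp] = linear_map_closed[OF linD] linear_map_closed[OF linE]
  note lin = S.linear_map_free_simps[OF linD] S.linear_map_free_simps[OF linE]
  define i1 where "i1 = (\<lambda>u. vec_append (r (Suc l)) (r l) u \<zero>\<^bsub>?F (r l)\<^esub>)"
  define i2 where "i2 = (\<lambda>u. vec_append (r (Suc l)) (r l) \<zero>\<^bsub>?F (r (Suc l))\<^esub> u)"
  have i1: "linear_map S (?F (r (Suc l))) (?F (cone_rank l)) i1"
    unfolding i1_def cone_rank_def
    by (intro S.vec_append_linear linear_map_id linear_map_0 S.module_free)
  have i2: "linear_map S (?F (r l)) (?F (cone_rank l)) i2"
    unfolding i2_def cone_rank_def
    by (intro S.vec_append_linear linear_map_id linear_map_0 S.module_free)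
  define p1 where "p1 = vec_fst (r (Suc (Suc l))) \<circ> s"
  define p2 where "p2 = vec_snd (r (Suc (Suc l))) (r (Suc l)) \<circ> s"
  have p1: "linear_map S (?F (cone_rank l)) (?F (r (Suc (Suc l)))) p1"
    unfolding p1_def o_def
    by (rule linear_map_comp[OF S.vec_fst_linear s[unfolded cone_rank_def[of "Suc l"]]])
  have p2: "linear_map S (?F (cone_rank l)) (?F (r (Suc l))) p2"
    unfolding p2_def o_def
    by (rule linear_map_comp[OF S.vec_snd_linear s[unfolded cone_rank_def[of "Suc l"]]])
  note [simp] = linear_map_closed[OF i1] linear_map_closed[OF i2]
    linear_map_closed[OF p1] linear_map_closed[OF p2] linear_map_closed[OF s]
  note lin' = S.linear_map_free_simps[OF p1] S.linear_map_free_simps[OF p2]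
  define s2 where "s2 = (\<lambda>v. p1 (i2 v))"
  define s4 where "s4 = (\<lambda>v. p2 (i2 v))"
  have s2: "linear_map S (?F (r l)) (?F (r (Suc (Suc l)))) s2"
    unfolding s2_def by (rule linear_map_comp[OF p1 i2])
  have s4: "linear_map S (?F (r l)) (?F (r (Suc l))) s4"
    unfolding s4_def by (rule linear_map_comp[OF p2 i2])
  note [simp] = linear_map_closed[OF s2] linear_map_closed[OF s4]
  have key: "D (Suc l) (x \<odot>\<^bsub>?F (r (Suc (Suc l)))\<^esub> p1 (i1 v) \<ominus>\<^bsub>?F (r (Suc (Suc l)))\<^esub> s2 (D l v))
        \<oplus>\<^bsub>?F (r (Suc l))\<^esub> x \<odot>\<^bsub>?F (r (Suc l))\<^esub>
          (x \<odot>\<^bsub>?F (r (Suc l))\<^esub> p2 (i1 v) \<ominus>\<^bsub>?F (r (Suc l))\<^esub> s4 (D l v)) =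
        b \<odot>\<^bsub>?F (r (Suc l))\<^esub> (x \<odot>\<^bsub>?F (r (Suc l))\<^esub> v)"
      "\<ominus>\<^bsub>?F (r l)\<^esub> E l (x \<odot>\<^bsub>?F (r (Suc (Suc l)))\<^esub> p1 (i1 v) \<ominus>\<^bsub>?F (r (Suc (Suc l)))\<^esub> s2 (D l v))
        \<ominus>\<^bsub>?F (r l)\<^esub> D l (x \<odot>\<^bsub>?F (r (Suc l))\<^esub> p2 (i1 v) \<ominus>\<^bsub>?F (r (Suc l))\<^esub> s4 (D l v)) =
        b \<odot>\<^bsub>?F (r l)\<^esub> (\<ominus>\<^bsub>?F (r l)\<^esub> D l v)"
    if v [simp]: "v \<in> carrier (?F (r (Suc l)))" for v
  proof -
    let ?w = "vec_append (r (Suc (Suc l))) (r (Suc l)) \<zero>\<^bsub>?F (r (Suc (Suc l)))\<^esub> v"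
    have w: "?w \<in> carrier (?F (cone_rank (Suc l)))"
      by (simp add: cone_rank_def)
    have cw: "cone_diff l ?w = vec_append (r (Suc l)) (r l) (x \<odot>\<^bsub>?F (r (Suc l))\<^esub> v) (\<ominus>\<^bsub>?F (r l)\<^esub> D l v)"
      by (subst cone_diff_append) (simp_all add: lin S.F.M.minus_eq S.F.neg_zero)
    have "x \<odot>\<^bsub>?F (cone_rank l)\<^esub> i1 v \<oplus>\<^bsub>?F (cone_rank l)\<^esub> i2 (\<ominus>\<^bsub>?F (r l)\<^esub> D l v) = cone_diff l ?w"
      unfolding cw unfolding i1_def i2_def cone_rank_def S.vec_append_smult S.vec_append_add
      by simp
    then have cw': "cone_diff l ?w = x \<odot>\<^bsub>?F (cone_rank l)\<^esub> i1 v \<ominus>\<^bsub>?F (cone_rank l)\<^esub> i2 (D l v)"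
      by (simp add: S.linear_map_free_simps[OF i2] a_minus_def)
    have sw: "s (cone_diff l ?w) = vec_append (r (Suc (Suc l))) (r (Suc l))
        (p1 (cone_diff l ?w)) (p2 (cone_diff l ?w))"
      unfolding p1_def p2_def using cw'
      by (simp add: S.vec_append_split linear_map_closed[OF s, unfolded cone_rank_def[of "Suc l"]])
    have p: "p1 (cone_diff l ?w) =
        x \<odot>\<^bsub>?F (r (Suc (Suc l)))\<^esub> p1 (i1 v) \<ominus>\<^bsub>?F (r (Suc (Suc l)))\<^esub> s2 (D l v)"
      "p2 (cone_diff l ?w) = x \<odot>\<^bsub>?F (r (Suc l))\<^esub> p2 (i1 v) \<ominus>\<^bsub>?F (r (Suc l))\<^esub> s4 (D l v)"
      unfolding cw' s2_def s4_def by (simp_all add: lin')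
    have "cone_diff l (s (cone_diff l ?w)) =
        vec_append (r (Suc l)) (r l) (b \<odot>\<^bsub>?F (r (Suc l))\<^esub> (x \<odot>\<^bsub>?F (r (Suc l))\<^esub> v))
          (b \<odot>\<^bsub>?F (r l)\<^esub> (\<ominus>\<^bsub>?F (r l)\<^esub> D l v))"
      unfolding cs[OF w] unfolding cw cone_rank_def S.vec_append_smult ..
    then have eq: "vec_append (r (Suc l)) (r l)
      (D (Suc l) (p1 (cone_diff l ?w)) \<oplus>\<^bsub>?F (r (Suc l))\<^esub> x \<odot>\<^bsub>?F (r (Suc l))\<^esub> p2 (cone_diff l ?w))
      (\<ominus>\<^bsub>?F (r l)\<^esub> E l (p1 (cone_diff l ?w)) \<ominus>\<^bsub>?F (r l)\<^esub> D l (p2 (cone_diff l ?w))) =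
      vec_append (r (Suc l)) (r l) (b \<odot>\<^bsub>?F (r (Suc l))\<^esub> (x \<odot>\<^bsub>?F (r (Suc l))\<^esub> v))
          (b \<odot>\<^bsub>?F (r l)\<^esub> (\<ominus>\<^bsub>?F (r l)\<^esub> D l v))"
      unfolding sw by (subst (asm) cone_diff_append) (simp_all add: p)
    then show "D (Suc l) (x \<odot>\<^bsub>?F (r (Suc (Suc l)))\<^esub> p1 (i1 v) \<ominus>\<^bsub>?F (r (Suc (Suc l)))\<^esub> s2 (D l v))
        \<oplus>\<^bsub>?F (r (Suc l))\<^esub> x \<odot>\<^bsub>?F (r (Suc l))\<^esub>
          (x \<odot>\<^bsub>?F (r (Suc l))\<^esub> p2 (i1 v) \<ominus>\<^bsub>?F (r (Suc l))\<^esub> s4 (D l v)) =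
        b \<odot>\<^bsub>?F (r (Suc l))\<^esub> (x \<odot>\<^bsub>?F (r (Suc l))\<^esub> v)"
      unfolding p by (subst (asm) S.vec_append_inject) simp_all
    show "\<ominus>\<^bsub>?F (r l)\<^esub> E l (x \<odot>\<^bsub>?F (r (Suc (Suc l)))\<^esub> p1 (i1 v) \<ominus>\<^bsub>?F (r (Suc (Suc l)))\<^esub> s2 (D l v))
        \<ominus>\<^bsub>?F (r l)\<^esub> D l (x \<odot>\<^bsub>?F (r (Suc l))\<^esub> p2 (i1 v) \<ominus>\<^bsub>?F (r (Suc l))\<^esub> s4 (D l v)) =
        b \<odot>\<^bsub>?F (r l)\<^esub> (\<ominus>\<^bsub>?F (r l)\<^esub> D l v)"
      using eq unfolding p by (subst (asm) S.vec_append_inject) simp_all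
  qed
  show ?thesis
  proof (rule that[OF s2 s4])
    fix v assume v [simp]: "v \<in> carrier (?F (r (Suc l)))"
    \<comment> \<open>Obtained by solving the first block equation for \<open>D (s2 (D v))\<close>:
      every other term has a factor \<open>x\<close>.\<close>
    let ?z = "D (Suc l) (p1 (i1 v)) \<oplus>\<^bsub>?F (r (Suc l))\<^esub>
      (x \<odot>\<^bsub>?F (r (Suc l))\<^esub> p2 (i1 v) \<ominus>\<^bsub>?F (r (Suc l))\<^esub> s4 (D l v))
      \<ominus>\<^bsub>?F (r (Suc l))\<^esub> b \<odot>\<^bsub>?F (r (Suc l))\<^esub> v"
    have "x \<odot>\<^bsub>?F (r (Suc l))\<^esub> (b \<odot>\<^bsub>?F (r (Suc l))\<^esub> v) =
        b \<odot>\<^bsub>?F (r (Suc l))\<^esub> (x \<odot>\<^bsub>?F (r (Suc l))\<^esub> v)"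
      by (simp add: S.F.smult_assoc1[symmetric] S.m_comm)
    then have "x \<odot>\<^bsub>?F (r (Suc l))\<^esub> ?z = D (Suc l) (x \<odot>\<^bsub>?F (r (Suc (Suc l)))\<^esub> p1 (i1 v))
      \<oplus>\<^bsub>?F (r (Suc l))\<^esub>
      x \<odot>\<^bsub>?F (r (Suc l))\<^esub> (x \<odot>\<^bsub>?F (r (Suc l))\<^esub> p2 (i1 v) \<ominus>\<^bsub>?F (r (Suc l))\<^esub> s4 (D l v))
      \<ominus>\<^bsub>?F (r (Suc l))\<^esub> b \<odot>\<^bsub>?F (r (Suc l))\<^esub> (x \<odot>\<^bsub>?F (r (Suc l))\<^esub> v)"
      by (simp add: S.F.smult_r_distr S.F.smult_r_diff lin)
    also have "\<dots> = D (Suc l) (s2 (D l v))"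
      unfolding key(1)[OF v, symmetric]
      by (simp add: lin S.F.add_minus_diff_add)
    finally show "\<exists>z\<in>carrier (?F (r (Suc l))). D (Suc l) (s2 (D l v)) = x \<odot>\<^bsub>?F (r (Suc l))\<^esub> z"
      by (intro bexI[of _ ?z]) simp_all
    let ?z = "E l (p1 (i1 v)) \<oplus>\<^bsub>?F (r l)\<^esub> D l (p2 (i1 v))"
    have "x \<odot>\<^bsub>?F (r l)\<^esub> ?z \<ominus>\<^bsub>?F (r l)\<^esub> b \<odot>\<^bsub>?F (r l)\<^esub> D l v =
      x \<odot>\<^bsub>?F (r l)\<^esub> ?z \<oplus>\<^bsub>?F (r l)\<^esub> b \<odot>\<^bsub>?F (r l)\<^esub> (\<ominus>\<^bsub>?F (r l)\<^esub> D l v)"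
      by (simp add: a_minus_def S.F.smult_r_minus)
    also have "\<dots> = E l (s2 (D l v)) \<oplus>\<^bsub>?F (r l)\<^esub> D l (s4 (D l v))"
      unfolding key(2)[OF v, symmetric]
      by (simp add: lin S.F.smult_r_distr S.F.add_neg_diffs)
    finally show "\<exists>z\<in>carrier (?F (r l)). E l (s2 (D l v)) \<oplus>\<^bsub>?F (r l)\<^esub> D l (s4 (D l v)) =
        x \<odot>\<^bsub>?F (r l)\<^esub> z \<ominus>\<^bsub>?F (r l)\<^esub> b \<odot>\<^bsub>?F (r l)\<^esub> D l v"
      by (intro bexI[of _ ?z]) simp_all
  qed
qed

end

end

section \<open>Descent of homotopies, and differentiation of lifted differentials\<close>

lemma map_vec_comp: "map_vec \<phi> r (map_vec \<psi> r v) = map_vec (\<lambda>a. \<phi> (\<psi> a)) r v"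
  by (simp add: map_vec_def restrict_def fun_eq_iff)

context nzd_quotient
begin

text \<open>
  The elements of \<open>T\<close> vanishing in \<open>R\<close> are divisible by \<open>x\<^sup>2\<close> in \<open>S\<close>, so lifting a resolution
  over \<open>R\<close> to \<open>T\<close> makes the corner \<open>E\<close> of the cone divisible by \<open>x\<close>: modulo \<open>x\<close> the cone
  splits, and the original resolution is a direct summand.
\<close>

lemma descend_syzygy_ann:
  assumes T: "ring_change T S \<iota>" and surjT: "(\<lambda>a. \<phi> (\<iota> a)) ` carrier T = carrier R"
    and sq: "\<And>a. a \<in> carrier T \<Longrightarrow> \<phi> (\<iota> a) = \<zero>\<^bsub>R\<^esub> \<Longrightarrow> \<exists>c\<in>carrier S. \<iota> a = x \<otimes>\<^bsub>S\<^esub> (x \<otimes>\<^bsub>S\<^esub> c)"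
    and b: "b \<in> syzygy_ann S l"
  shows "\<phi> b \<in> syzygy_ann R l"
proof (rule syzygy_annI)
  let ?F = "\<lambda>p. free_module S p"
  have bc [simp]: "b \<in> carrier S" using syzygy_ann_closed[OF b] .
  show "\<phi> b \<in> carrier R" by simp
  fix r d assume ex: "free_exact R r d"
  interpret I: ring_change T S \<iota> by fact
  interpret C: surjective_ring_change T R "\<lambda>a. \<phi> (\<iota> a)"
    by unfold_locales (auto intro!: ring_hom_memI simp: surjT)
  have "\<exists>\<delta> D. linear_map T (free_module T (r (Suc j))) (free_module T (r j)) \<delta> \<and>
      linear_map S (?F (r (Suc j))) (?F (r j)) D \<and>
      (\<forall>v\<in>carrier (free_module T (r (Suc j))).
        map_vec (\<lambda>a. \<phi> (\<iota> a)) (r j) (\<delta> v) = d j (map_vec (\<lambda>a. \<phi> (\<iota> a)) (r (Suc j)) v)) \<and>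
      (\<forall>v\<in>carrier (free_module T (r (Suc j))). D (map_vec \<iota> (r (Suc j)) v) = map_vec \<iota> (r j) (\<delta> v))" for j
  proof -
    obtain \<delta> where \<delta>: "linear_map T (free_module T (r (Suc j))) (free_module T (r j)) \<delta>"
      "\<And>v. v \<in> carrier (free_module T (r (Suc j))) \<Longrightarrow>
        map_vec (\<lambda>a. \<phi> (\<iota> a)) (r j) (\<delta> v) = d j (map_vec (\<lambda>a. \<phi> (\<iota> a)) (r (Suc j)) v)"
      by (rule C.lift_linear_map[OF free_exact_linear[OF ex]]) blast
    obtain D where "linear_map S (?F (r (Suc j))) (?F (r j)) D"
      "\<And>v. v \<in> carrier (free_module T (r (Suc j))) \<Longrightarrow> D (map_vec \<iota> (r (Suc j)) v) = map_vec \<iota> (r j) (\<delta> v)"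
      by (rule I.base_change[OF \<delta>(1)]) blast
    then show ?thesis using \<delta> by blast
  qed
  then obtain \<delta> D where
    lin\<delta>: "\<And>j. linear_map T (free_module T (r (Suc j))) (free_module T (r j)) (\<delta> j)" and
    linD: "\<And>j. linear_map S (?F (r (Suc j))) (?F (r j)) (D j)" and
    \<delta>: "\<And>j v. v \<in> carrier (free_module T (r (Suc j))) \<Longrightarrow>
        map_vec (\<lambda>a. \<phi> (\<iota> a)) (r j) (\<delta> j v) = d j (map_vec (\<lambda>a. \<phi> (\<iota> a)) (r (Suc j)) v)" and
    D\<delta>: "\<And>j v. v \<in> carrier (free_module T (r (Suc j))) \<Longrightarrow>
        D j (map_vec \<iota> (r (Suc j)) v) = map_vec \<iota> (r j) (\<delta> j v)"
    by metis
  note [simp] = linear_map_closed[OF linD] linear_map_closed[OF lin\<delta>]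
  have D: "map_vec \<phi> (r j) (D j v) = d j (map_vec \<phi> (r (Suc j)) v)"
    if v: "v \<in> carrier (?F (r (Suc j)))" for j v
  proof (rule S.linear_map_eqI[OF module_restrict linear_map_comp[OF map_vec_linear linD]
        linear_map_comp[OF linear_map_restrict_scalars[OF hom free_exact_linear[OF ex]] map_vec_linear] _ v])
    fix k
    show "map_vec \<phi> (r j) (D j (std_vec S (r (Suc j)) k)) = d j (map_vec \<phi> (r (Suc j)) (std_vec S (r (Suc j)) k))"
      using D\<delta>[OF I.S.std_vec_closed, of j k] \<delta>[OF I.S.std_vec_closed, of j k]
      by (simp add: I.map_vec_std map_vec_comp C.map_vec_std map_vec_std)
  qed
  have vsq: "\<exists>z\<in>carrier (?F p). map_vec \<iota> p w = x \<odot>\<^bsub>?F p\<^esub> (x \<odot>\<^bsub>?F p\<^esub> z)"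
    if w: "w \<in> carrier (free_module T p)" "map_vec (\<lambda>a. \<phi> (\<iota> a)) p w = \<zero>\<^bsub>free_module R p\<^esub>" for p w
  proof -
    have "\<phi> (\<iota> (w i)) = \<zero>\<^bsub>R\<^esub>" if "i < p" for i
      using that fun_cong[OF w(2), of i] by (simp add: map_vec_def R.zero_free)
    then have "\<forall>i. \<exists>c. i < p \<longrightarrow> c \<in> carrier S \<and> \<iota> (w i) = x \<otimes>\<^bsub>S\<^esub> (x \<otimes>\<^bsub>S\<^esub> c)"
      using sq I.S.free_closed[OF w(1)] by blast
    then obtain c where c: "\<And>i. i < p \<Longrightarrow> c i \<in> carrier S \<and> \<iota> (w i) = x \<otimes>\<^bsub>S\<^esub> (x \<otimes>\<^bsub>S\<^esub> c i)" by metis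
    show ?thesis
    proof (rule bexI)
      show "(\<lambda>i\<in>{..<p}. c i) \<in> carrier (?F p)" using c by (intro S.restrict_closed) blast
      then show "map_vec \<iota> p w = x \<odot>\<^bsub>?F p\<^esub> (x \<odot>\<^bsub>?F p\<^esub> (\<lambda>i\<in>{..<p}. c i))"
        using c by (simp add: map_vec_def S.smult_free restrict_def fun_eq_iff)
    qed
  qed
  \<comment> \<open>\<open>D D\<close> comes from \<open>\<delta> \<delta>\<close> over
    \<open>T\<close>, which vanishes in \<open>R\<close>; its entries are therefore divisible by
    \<open>x\<close> twice.\<close>
  have "\<exists>E. linear_map S (?F (r (Suc (Suc j)))) (?F (r j)) E \<and> (\<forall>v\<in>carrier (?F (r (Suc (Suc j)))).
      x \<odot>\<^bsub>?F (r j)\<^esub> (x \<odot>\<^bsub>?F (r j)\<^esub> E v) = D j (D (Suc j) v))" for j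
  proof (rule S.linear_map_factor[OF S.module_free S.module_free
        linear_map_scale[OF S.module_free linear_map_scale[OF S.module_free linear_map_id x_closed] x_closed]
        linear_map_comp[OF linD linD]])
    fix k
    let ?e = "std_vec T (r (Suc (Suc j))) k"
    have "D j (D (Suc j) (std_vec S (r (Suc (Suc j))) k)) = map_vec \<iota> (r j) (\<delta> j (\<delta> (Suc j) ?e))"
      using D\<delta>[of ?e "Suc j"] D\<delta>[of "\<delta> (Suc j) ?e" j] by (simp add: I.map_vec_std)
    moreover have "map_vec (\<lambda>a. \<phi> (\<iota> a)) (r j) (\<delta> j (\<delta> (Suc j) ?e)) = \<zero>\<^bsub>free_module R (r j)\<^esub>"
      using free_exact_complex[OF ex R.std_vec_closed] by (simp add: \<delta> C.map_vec_std)
    ultimately show "D j (D (Suc j) (std_vec S (r (Suc (Suc j))) k)) \<in>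
        (\<lambda>v. x \<odot>\<^bsub>?F (r j)\<^esub> (x \<odot>\<^bsub>?F (r j)\<^esub> v)) ` carrier (?F (r j))"
      using vsq[of "\<delta> j (\<delta> (Suc j) ?e)" "r j"] by auto
  qed blast
  then obtain E' where linE': "\<And>j. linear_map S (?F (r (Suc (Suc j)))) (?F (r j)) (E' j)"
    and DD': "\<And>j v. v \<in> carrier (?F (r (Suc (Suc j)))) \<Longrightarrow>
      x \<odot>\<^bsub>?F (r j)\<^esub> (x \<odot>\<^bsub>?F (r j)\<^esub> E' j v) = D j (D (Suc j) v)"
    by metis
  note [simp] = linear_map_closed[OF linE']
  \<comment> \<open>The corner of this cone is \<open>x E'\<close>, which is zero modulo
    \<open>x\<close>. The second block relation reduces to \<open>d s d = -\<phi> b d\<close>,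
    whence the sign in the homotopy below.\<close>
  obtain s2 s4 where
    s2: "linear_map S (?F (r l)) (?F (r (Suc (Suc l)))) s2"
    and s4: "linear_map S (?F (r l)) (?F (r (Suc l))) s4"
    and blk: "\<And>v. v \<in> carrier (?F (r (Suc l))) \<Longrightarrow>
      \<exists>z\<in>carrier (?F (r l)). x \<odot>\<^bsub>?F (r l)\<^esub> E' l (s2 (D l v)) \<oplus>\<^bsub>?F (r l)\<^esub> D l (s4 (D l v)) =
        x \<odot>\<^bsub>?F (r l)\<^esub> z \<ominus>\<^bsub>?F (r l)\<^esub> b \<odot>\<^bsub>?F (r l)\<^esub> D l v"
    by (rule cone_blocks[OF ex linD linear_map_scale[OF S.module_free linE' x_closed] D DD'[symmetric] b])
      blast+
  note [simp] = linear_map_closed[OF s2] linear_map_closed[OF s4]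
  obtain s where s: "linear_map R (free_module R (r l)) (free_module R (r (Suc l))) s"
    and ss: "\<And>v. v \<in> carrier (?F (r l)) \<Longrightarrow> s (map_vec \<phi> (r l) v) = map_vec \<phi> (r (Suc l)) (s4 v)"
    by (rule base_change[OF s4]) blast
  have "d l (\<ominus>\<^bsub>free_module R (r (Suc l))\<^esub> s (d l w)) = \<phi> b \<odot>\<^bsub>free_module R (r l)\<^esub> d l w"
    if w: "w \<in> carrier (free_module R (r (Suc l)))" for w
  proof -
    obtain v where v [simp]: "v \<in> carrier (?F (r (Suc l)))" and vw: "map_vec \<phi> (r (Suc l)) v = w"
      using map_vec_surj[OF w] by blast
    note dl = R.linear_map_free_simps[OF free_exact_linear[OF ex, of l]]
    have [simp]: "d l w \<in> carrier (free_module R (r l))" using dl(1) w .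
    have dD: "map_vec \<phi> (r l) (D l v) = d l w" using D[OF v] vw by simp
    obtain z where z: "z \<in> carrier (?F (r l))"
      "x \<odot>\<^bsub>?F (r l)\<^esub> E' l (s2 (D l v)) \<oplus>\<^bsub>?F (r l)\<^esub> D l (s4 (D l v)) =
        x \<odot>\<^bsub>?F (r l)\<^esub> z \<ominus>\<^bsub>?F (r l)\<^esub> b \<odot>\<^bsub>?F (r l)\<^esub> D l v"
      using blk[OF v] by blast
    have "map_vec \<phi> (r l) (D l (s4 (D l v))) = \<ominus>\<^bsub>free_module R (r l)\<^esub> (\<phi> b \<odot>\<^bsub>free_module R (r l)\<^esub> d l w)"
      using arg_cong[OF z(2), of "map_vec \<phi> (r l)"] z(1)
      by (simp add: map_vec_simps map_vec_x dD x_zero R.F.M.minus_eq)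
    then have "d l (s (d l w)) = \<ominus>\<^bsub>free_module R (r l)\<^esub> (\<phi> b \<odot>\<^bsub>free_module R (r l)\<^esub> d l w)"
      using ss[of "D l v"] D[of "s4 (D l v)" l] by (simp add: dD)
    then show ?thesis
      using linear_map_closed[OF s] by (simp add: dl R.F.M.minus_minus)
  qed
  then show "\<exists>s. linear_map R (free_module R (r l)) (free_module R (r (Suc l))) s \<and>
      (\<forall>v\<in>carrier (free_module R (r (Suc l))). d l (s (d l v)) = \<phi> b \<odot>\<^bsub>free_module R (r l)\<^esub> d l v)"
    by (intro exI[of _ "\<lambda>w. \<ominus>\<^bsub>free_module R (r (Suc l))\<^esub> s w"] conjI ballI linear_map_neg R.module_free s)
qed

text \<open>
  For \<open>S\<close> regular, resolutions over \<open>R = S/(x)\<close> come from matrix factorizations of \<open>x\<close>.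
  Differentiating the relation between the differentials and \<open>x\<close> shows that the derivative of
  \<open>x\<close> is homotopic to zero.
\<close>

lemma derivative_syzygy_ann:
  assumes one: "\<one>\<^bsub>S\<^esub> \<in> syzygy_ann S l"
    and der_c [simp]: "\<And>a. a \<in> carrier S \<Longrightarrow> der a \<in> carrier S"
    and der_a: "\<And>a b. a \<in> carrier S \<Longrightarrow> b \<in> carrier S \<Longrightarrow> der (a \<oplus>\<^bsub>S\<^esub> b) = der a \<oplus>\<^bsub>S\<^esub> der b"
    and der_m: "\<And>a b. a \<in> carrier S \<Longrightarrow> b \<in> carrier S \<Longrightarrow>
      der (a \<otimes>\<^bsub>S\<^esub> b) = der a \<otimes>\<^bsub>S\<^esub> b \<oplus>\<^bsub>S\<^esub> a \<otimes>\<^bsub>S\<^esub> der b"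
  shows "\<phi> (der x) \<in> syzygy_ann R l"
proof (rule syzygy_annI)
  let ?F = "\<lambda>p. free_module S p"
  show "\<phi> (der x) \<in> carrier R" by simp
  fix r d assume ex: "free_exact R r d"
  have "\<exists>D. linear_map S (?F (r (Suc j))) (?F (r j)) D \<and> (\<forall>v\<in>carrier (?F (r (Suc j))).
      map_vec \<phi> (r j) (D v) = d j (map_vec \<phi> (r (Suc j)) v))" for j
    by (rule lift_linear_map[OF free_exact_linear[OF ex]]) blast
  then obtain D where
    linD: "\<And>j. linear_map S (?F (r (Suc j))) (?F (r j)) (D j)" and
    D: "\<And>j v. v \<in> carrier (?F (r (Suc j))) \<Longrightarrow>
      map_vec \<phi> (r j) (D j v) = d j (map_vec \<phi> (r (Suc j)) v)"
    by metis
  note [simp] = linear_map_closed[OF linD]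
  note lin = S.linear_map_free_simps[OF linD]
  have DD0: "map_vec \<phi> (r j) (D j (D (Suc j) v)) = \<zero>\<^bsub>free_module R (r j)\<^esub>"
    if v: "v \<in> carrier (?F (r (Suc (Suc j))))" for j v
    using v free_exact_complex[OF ex map_vec_closed[OF v]] by (simp add: D)
  have "\<exists>E. linear_map S (?F (r (Suc (Suc j)))) (?F (r j)) E \<and>
      (\<forall>v\<in>carrier (?F (r (Suc (Suc j)))). D j (D (Suc j) v) = x \<odot>\<^bsub>?F (r j)\<^esub> E v)" for j
    by (rule divide_linear_map[OF linear_map_comp[OF linD linD] DD0[OF S.std_vec_closed]]) blast
  then obtain E where linE: "\<And>j. linear_map S (?F (r (Suc (Suc j)))) (?F (r j)) (E j)"
    and DD: "\<And>j v. v \<in> carrier (?F (r (Suc (Suc j)))) \<Longrightarrow> D j (D (Suc j) v) = x \<odot>\<^bsub>?F (r j)\<^esub> E j v"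
    by metis
  note [simp] = linear_map_closed[OF linE]
  obtain s2 s4 where
    s2: "linear_map S (?F (r l)) (?F (r (Suc (Suc l)))) s2"
    and s4: "linear_map S (?F (r l)) (?F (r (Suc l))) s4"
    and blk1: "\<And>v. v \<in> carrier (?F (r (Suc l))) \<Longrightarrow>
      \<exists>z\<in>carrier (?F (r (Suc l))). D (Suc l) (s2 (D l v)) = x \<odot>\<^bsub>?F (r (Suc l))\<^esub> z"
    and blk2: "\<And>v. v \<in> carrier (?F (r (Suc l))) \<Longrightarrow>
      \<exists>z\<in>carrier (?F (r l)). E l (s2 (D l v)) \<oplus>\<^bsub>?F (r l)\<^esub> D l (s4 (D l v)) =
        x \<odot>\<^bsub>?F (r l)\<^esub> z \<ominus>\<^bsub>?F (r l)\<^esub> \<one>\<^bsub>S\<^esub> \<odot>\<^bsub>?F (r l)\<^esub> D l v"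
    by (rule cone_blocks[OF ex linD linE D DD one]) blast+
  note [simp] = linear_map_closed[OF s2] linear_map_closed[OF s4]
  have der_v [simp]: "map_vec der p v \<in> carrier (?F p)" if "v \<in> carrier (?F p)" for p v
    unfolding map_vec_def using S.free_closed[OF that] by (intro S.restrict_closed) simp
  have der_va: "map_vec der p (v \<oplus>\<^bsub>?F p\<^esub> w) = map_vec der p v \<oplus>\<^bsub>?F p\<^esub> map_vec der p w"
    if "v \<in> carrier (?F p)" "w \<in> carrier (?F p)" for p v w
    using that by (simp add: map_vec_def S.add_free S.free_closed der_a restrict_def fun_eq_iff)
  have der_vm: "map_vec der p (a \<odot>\<^bsub>?F p\<^esub> v) = der a \<odot>\<^bsub>?F p\<^esub> v \<oplus>\<^bsub>?F p\<^esub> a \<odot>\<^bsub>?F p\<^esub> map_vec der p v"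
    if "a \<in> carrier S" "v \<in> carrier (?F p)" for p v a
    using that by (simp add: map_vec_def S.add_free S.smult_free S.free_closed der_m restrict_def fun_eq_iff)
  \<comment> \<open>The commutator of coordinatewise differentiation with \<open>D\<close>.
    Differentiation is not linear over \<open>S\<close>, but by the product rule the commutator is;
    its matrix is the derivative of that of \<open>D\<close>.\<close>
  define \<Delta> where "\<Delta> = (\<lambda>v. map_vec der (r (Suc l)) (D (Suc l) v) \<ominus>\<^bsub>?F (r (Suc l))\<^esub>
      D (Suc l) (map_vec der (r (Suc (Suc l))) v))"
  have lin\<Delta>: "linear_map S (?F (r (Suc (Suc l)))) (?F (r (Suc l))) \<Delta>"
    by (rule linear_mapI)
      (simp_all add: \<Delta>_def der_va der_vm lin S.F.add_minus_add_cancel_left S.F.add_minus_add S.F.smult_r_diff)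
  note [simp] = linear_map_closed[OF lin\<Delta>]
  \<comment> \<open>For \<open>c = s2 (D v)\<close> one has \<open>D c = x z\<close> and
    \<open>D z = E c\<close>. Differentiating \<open>D c = x z\<close> and applying \<open>D\<close>
    gives \<open>D \<Delta> c = x' E c\<close> modulo \<open>x\<close>, with \<open>x'\<close> the
    derivative of \<open>x\<close>; moreover \<open>E c + D s4 D v = -D v\<close> modulo
    \<open>x\<close>. Hence \<open>D (\<Delta> s2 + x' s4) D = -x' D\<close> modulo
    \<open>x\<close>.\<close>
  let ?\<sigma> = "\<lambda>w. \<ominus>\<^bsub>?F (r (Suc l))\<^esub> (\<Delta> (s2 w) \<oplus>\<^bsub>?F (r (Suc l))\<^esub> der x \<odot>\<^bsub>?F (r (Suc l))\<^esub> s4 w)"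
  have "linear_map S (?F (r l)) (?F (r (Suc l))) ?\<sigma>"
    by (intro linear_map_neg linear_map_plus linear_map_scale S.module_free s4 linear_map_comp[OF lin\<Delta> s2]
        der_c x_closed)
  then obtain s where s: "linear_map R (free_module R (r l)) (free_module R (r (Suc l))) s"
    and ss: "\<And>v. v \<in> carrier (?F (r l)) \<Longrightarrow> s (map_vec \<phi> (r l) v) = map_vec \<phi> (r (Suc l)) (?\<sigma> v)"
    by (rule base_change) blast
  have "d l (s (d l w)) = \<phi> (der x) \<odot>\<^bsub>free_module R (r l)\<^esub> d l w"
    if w: "w \<in> carrier (free_module R (r (Suc l)))" for w
  proof -
    let ?M = "map_vec \<phi> (r l)" and ?G = "free_module R (r l)"
    obtain v where v [simp]: "v \<in> carrier (?F (r (Suc l)))" and vw: "map_vec \<phi> (r (Suc l)) v = w"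
      using map_vec_surj[OF w] by blast
    note dl = R.linear_map_free_simps[OF free_exact_linear[OF ex, of l]]
    have [simp]: "d l w \<in> carrier ?G" using dl(1) w .
    have dD: "?M (D l v) = d l w" using D[OF v] vw by simp
    define c where "c = s2 (D l v)"
    have c [simp]: "c \<in> carrier (?F (r (Suc (Suc l))))" unfolding c_def by simp
    obtain z where z [simp]: "z \<in> carrier (?F (r (Suc l)))" and zc: "D (Suc l) c = x \<odot>\<^bsub>?F (r (Suc l))\<^esub> z"
      using blk1[OF v] unfolding c_def by blast
    obtain y where y [simp]: "y \<in> carrier (?F (r l))" and yc: "E l c \<oplus>\<^bsub>?F (r l)\<^esub> D l (s4 (D l v)) =
        x \<odot>\<^bsub>?F (r l)\<^esub> y \<ominus>\<^bsub>?F (r l)\<^esub> \<one>\<^bsub>S\<^esub> \<odot>\<^bsub>?F (r l)\<^esub> D l v"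
      using blk2[OF v] unfolding c_def by blast
    have Dz: "D l z = E l c"
    proof (rule smult_x_cancel)
      show "x \<odot>\<^bsub>?F (r l)\<^esub> D l z = x \<odot>\<^bsub>?F (r l)\<^esub> E l c"
        by (simp add: DD[symmetric] zc lin)
    qed simp_all
    have "\<Delta> c \<oplus>\<^bsub>?F (r (Suc l))\<^esub> D (Suc l) (map_vec der (r (Suc (Suc l))) c) =
        der x \<odot>\<^bsub>?F (r (Suc l))\<^esub> z \<oplus>\<^bsub>?F (r (Suc l))\<^esub> x \<odot>\<^bsub>?F (r (Suc l))\<^esub> map_vec der (r (Suc l)) z"
      by (simp add: \<Delta>_def zc der_vm S.F.minus_add_cancel)
    from arg_cong[OF this, of "D l"]
    have "D l (\<Delta> c) \<oplus>\<^bsub>?F (r l)\<^esub> x \<odot>\<^bsub>?F (r l)\<^esub> E l (map_vec der (r (Suc (Suc l))) c) =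
        der x \<odot>\<^bsub>?F (r l)\<^esub> E l c \<oplus>\<^bsub>?F (r l)\<^esub> x \<odot>\<^bsub>?F (r l)\<^esub> D l (map_vec der (r (Suc l)) z)"
      by (simp add: lin DD Dz)
    from arg_cong[OF this, of ?M]
    have 1: "?M (D l (\<Delta> c)) = \<phi> (der x) \<odot>\<^bsub>?G\<^esub> ?M (E l c)"
      by (simp add: map_vec_simps x_zero)
    from arg_cong[OF yc, of ?M]
    have 2: "?M (E l c) \<oplus>\<^bsub>?G\<^esub> ?M (D l (s4 (D l v))) = \<ominus>\<^bsub>?G\<^esub> d l w"
      by (simp add: map_vec_simps x_zero dD R.F.M.minus_eq)
    have "d l (s (d l w)) = ?M (D l (?\<sigma> (D l v)))"
      using ss[of "D l v"] D[of "?\<sigma> (D l v)" l] by (simp add: dD)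
    also have "\<dots> = \<ominus>\<^bsub>?G\<^esub> (\<phi> (der x) \<odot>\<^bsub>?G\<^esub> (?M (E l c) \<oplus>\<^bsub>?G\<^esub> ?M (D l (s4 (D l v)))))"
      by (simp add: lin map_vec_simps 1 c_def[symmetric] R.F.smult_r_distr)
    also have "\<dots> = \<phi> (der x) \<odot>\<^bsub>?G\<^esub> d l w"
      unfolding 2 by (simp add: R.F.smult_r_minus R.F.M.minus_minus)
    finally show ?thesis .
  qed
  then show "\<exists>s. linear_map R (free_module R (r l)) (free_module R (r (Suc l))) s \<and>
      (\<forall>v\<in>carrier (free_module R (r (Suc l))). d l (s (d l v)) = \<phi> (der x) \<odot>\<^bsub>free_module R (r l)\<^esub> d l v)"
    using s by blast
qed

end

text \<open>Meant for \<open>f = 0\<close>: the factor ring \<open>S/(0)\<close> consists of cosets,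
  so it is isomorphic to \<open>S\<close> but not equal to it.\<close>

lemma (in surjective_ring_change) syzygy_ann_iso:
  assumes inj: "inj_on \<phi> (carrier S)" and a: "a \<in> syzygy_ann S l"
  shows "\<phi> a \<in> syzygy_ann R l"
proof (rule syzygy_annI)
  let ?F = "\<lambda>p. free_module S p"
  have ac [simp]: "a \<in> carrier S" using syzygy_ann_closed[OF a] .
  show "\<phi> a \<in> carrier R" by simp
  fix r d assume ex: "free_exact R r d"
  have inj': "v = w" if "v \<in> carrier (?F p)" "w \<in> carrier (?F p)" "map_vec \<phi> p v = map_vec \<phi> p w" for p v w
  proof (rule S.free_eqI[OF that(1,2)])
    fix i assume "i < p"
    then show "v i = w i"
      using inj_onD[OF inj] S.free_closed[OF that(1)] S.free_closed[OF that(2)] fun_cong[OF that(3), of i]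
      by (simp add: map_vec_def)
  qed
  have "\<exists>D. linear_map S (?F (r (Suc j))) (?F (r j)) D \<and> (\<forall>v\<in>carrier (?F (r (Suc j))).
      map_vec \<phi> (r j) (D v) = d j (map_vec \<phi> (r (Suc j)) v))" for j
    by (rule lift_linear_map[OF free_exact_linear[OF ex]]) blast
  then obtain D where
    linD: "\<And>j. linear_map S (?F (r (Suc j))) (?F (r j)) (D j)" and
    D: "\<And>j v. v \<in> carrier (?F (r (Suc j))) \<Longrightarrow>
      map_vec \<phi> (r j) (D j v) = d j (map_vec \<phi> (r (Suc j)) v)"
    by metis
  note [simp] = linear_map_closed[OF linD]
  have "free_exact S r D"
    unfolding free_exact_def
  proof (intro conjI allI ballI linD)
    fix j v assume v [simp]: "v \<in> carrier (?F (r (Suc j)))"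
    show "D j v = \<zero>\<^bsub>?F (r j)\<^esub> \<longleftrightarrow> v \<in> D (Suc j) ` carrier (?F (r (Suc (Suc j))))"
    proof
      assume "D j v = \<zero>\<^bsub>?F (r j)\<^esub>"
      then have "d j (map_vec \<phi> (r (Suc j)) v) = \<zero>\<^bsub>free_module R (r j)\<^esub>"
        using D[OF v] by (simp add: map_vec_zero)
      then obtain w where w: "w \<in> carrier (free_module R (r (Suc (Suc j))))"
        "map_vec \<phi> (r (Suc j)) v = d (Suc j) w"
        using free_exact_lift[OF ex map_vec_closed[OF v]] by blast
      obtain w' where w': "w' \<in> carrier (?F (r (Suc (Suc j))))" "map_vec \<phi> (r (Suc (Suc j))) w' = w"
        using map_vec_surj[OF w(1)] by blast
      have "v = D (Suc j) w'"
        using w w' by (intro inj'[OF v]) (simp_all add: D)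
      then show "v \<in> D (Suc j) ` carrier (?F (r (Suc (Suc j))))" using w'(1) by blast
    next
      assume "v \<in> D (Suc j) ` carrier (?F (r (Suc (Suc j))))"
      then obtain w where w: "w \<in> carrier (?F (r (Suc (Suc j))))" "v = D (Suc j) w" by blast
      show "D j v = \<zero>\<^bsub>?F (r j)\<^esub>"
        using w free_exact_complex[OF ex map_vec_closed[OF w(1)]]
        by (intro inj'[of _ "r j"]) (simp_all add: D map_vec_zero)
    qed
  qed
  then obtain s0 where s0: "linear_map S (?F (r l)) (?F (r (Suc l))) s0"
    and Ds: "\<And>v. v \<in> carrier (?F (r (Suc l))) \<Longrightarrow> D l (s0 (D l v)) = a \<odot>\<^bsub>?F (r l)\<^esub> D l v"
    by (rule syzygy_annE[OF a]) blast
  obtain s where s: "linear_map R (free_module R (r l)) (free_module R (r (Suc l))) s"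
    and ss: "\<And>v. v \<in> carrier (?F (r l)) \<Longrightarrow> s (map_vec \<phi> (r l) v) = map_vec \<phi> (r (Suc l)) (s0 v)"
    by (rule base_change[OF s0]) blast
  have "d l (s (d l w)) = \<phi> a \<odot>\<^bsub>free_module R (r l)\<^esub> d l w"
    if w: "w \<in> carrier (free_module R (r (Suc l)))" for w
  proof -
    obtain v where v [simp]: "v \<in> carrier (?F (r (Suc l)))" and vw: "map_vec \<phi> (r (Suc l)) v = w"
      using map_vec_surj[OF w] by blast
    have "map_vec \<phi> (r l) (D l (s0 (D l v))) = d l (s (d l w))"
      using linear_map_closed[OF s0] by (simp add: D ss[symmetric] vw[symmetric])
    then show ?thesis
      by (simp add: Ds map_vec_smult D vw)
  qed
  then show "\<exists>s. linear_map R (free_module R (r l)) (free_module R (r (Suc l))) s \<and>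
      (\<forall>v\<in>carrier (free_module R (r (Suc l))). d l (s (d l v)) = \<phi> a \<odot>\<^bsub>free_module R (r l)\<^esub> d l v)"
    using s by blast
qed

section \<open>Regularity and finiteness of adically complete rings\<close>

text \<open>The Noetherian property, stated for submodules of free modules instead of ideals: it
  then yields the next term of a resolution directly, and it passes to quotients and to power series
  for all \<open>p\<close> at once.\<close>

definition fg_submodules :: "('a, 'e) ring_scheme \<Rightarrow> bool" where
  "fg_submodules A \<longleftrightarrow> (\<forall>p U. submodule U A (free_module A p) \<longrightarrow>
    (\<exists>n h. linear_map A (free_module A n) (free_module A p) h \<and> h ` carrier (free_module A n) = U))"

lemma fg_submodulesE:
  assumes "fg_submodules A" "submodule U A (free_module A p)"
  obtains n h where "linear_map A (free_module A n) (free_module A p) h"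
    "h ` carrier (free_module A n) = U"
  using assms unfolding fg_submodules_def by blast

context free_modules
begin

lemma linear_map_into_submodule:
  assumes "module R M" "submodule U R M" "\<And>k. k < n \<Longrightarrow> c k \<in> U"
  obtains h where "linear_map R (free_module R n) M h" "h ` carrier (free_module R n) \<subseteq> U"
    "\<And>k. k < n \<Longrightarrow> h (std_vec R n k) = c k"
proof -
  interpret M: module R M by fact
  have U: "U \<subseteq> carrier M" using M.submoduleE[OF assms(2)] by blast
  obtain h where h: "linear_map R (free_module R n) (M\<lparr>carrier := U\<rparr>) h" "\<forall>k<n. h (std_vec R n k) = c k"
    using linear_map_exists[OF submodule.submodule_is_module[OF assms(2,1)], of n c] assms(3) by auto
  show ?thesis
  proof (rule that[of h])
    show "linear_map R (free_module R n) M h"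
      using h(1) U by (auto simp: linear_map_def)
    show "h ` carrier (free_module R n) \<subseteq> U"
      using linear_map_closed[OF h(1)] by auto
  qed (use h(2) in blast)
qed

lemma submodule_std_vec:
  assumes "submodule U R (free_module R n)" "\<And>k. k < n \<Longrightarrow> std_vec R n k \<in> U"
  shows "U = carrier (free_module R n)"
proof
  show "U \<subseteq> carrier (free_module R n)" using F.submoduleE[OF assms(1)] by blast
  obtain h where h: "linear_map R (free_module R n) (free_module R n) h"
    "h ` carrier (free_module R n) \<subseteq> U" "\<And>k. k < n \<Longrightarrow> h (std_vec R n k) = std_vec R n k"
    by (rule linear_map_into_submodule[OF module_free assms]) blast+
  have "h v = v" if "v \<in> carrier (free_module R n)" for v
    by (rule linear_map_eqI[OF module_free h(1) linear_map_id h(3) that])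
  then show "carrier (free_module R n) \<subseteq> U" using h(2) by force
qed

end

text \<open>The preimage of \<open>U\<close> in \<open>S^p\<close> is the image of a map
  \<open>h\<close> of free modules; the base change of \<open>h\<close> has image
  \<open>U\<close>.\<close>

lemma (in surjective_ring_change) fg_submodules_quotient:
  assumes "fg_submodules S"
  shows "fg_submodules R"
  unfolding fg_submodules_def
proof (intro allI impI)
  fix p U assume U: "submodule U R (free_module R p)"
  note U' = R.F.submoduleE[OF U]
  have "submodule U S (restrict_scalars \<phi> (free_module R p))"
  proof -
    interpret N: module S "restrict_scalars \<phi> (free_module R p)" by (rule module_restrict)
    have "\<ominus>\<^bsub>restrict_scalars \<phi> (free_module R p)\<^esub> a \<in> U" if "a \<in> U" for a
    proof -
      have "\<ominus>\<^bsub>restrict_scalars \<phi> (free_module R p)\<^esub> a = \<ominus>\<^bsub>free_module R p\<^esub> a"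
        using that U' by (intro N.M.minus_equality) (auto simp: R.F.M.l_neg)
      then show ?thesis using U' that by simp
    qed
    then show ?thesis
      using U' R.F.submodule_zero_closed[OF U] by (intro N.submoduleI) simp_all
  qed
  from submodule_vimage[OF S.module_free module_restrict map_vec_linear this]
  obtain n h where h: "linear_map S (free_module S n) (free_module S p) h"
    "h ` carrier (free_module S n) = {v \<in> carrier (free_module S p). map_vec \<phi> p v \<in> U}"
    by (rule fg_submodulesE[OF assms])
  obtain g where g: "linear_map R (free_module R n) (free_module R p) g"
    "\<And>v. v \<in> carrier (free_module S n) \<Longrightarrow> g (map_vec \<phi> n v) = map_vec \<phi> p (h v)"
    by (rule base_change[OF h(1)]) blast
  have "g ` carrier (free_module R n) = U"
  proof
    show "g ` carrier (free_module R n) \<subseteq> U"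
    proof (rule image_subsetI)
      fix w assume "w \<in> carrier (free_module R n)"
      then obtain v where v: "v \<in> carrier (free_module S n)" "map_vec \<phi> n v = w"
        by (rule map_vec_surj)
      have "h v \<in> h ` carrier (free_module S n)" using v(1) by blast
      then show "g w \<in> U" using g(2)[OF v(1)] v(2) h(2) by simp
    qed
    show "U \<subseteq> g ` carrier (free_module R n)"
    proof
      fix u assume u: "u \<in> U"
      then have "u \<in> carrier (free_module R p)" using U'(1) by blast
      then obtain v where v: "v \<in> carrier (free_module S p)" "map_vec \<phi> p v = u"
        by (rule map_vec_surj)
      then have "v \<in> h ` carrier (free_module S n)" using u h(2) by simp
      then obtain w where "w \<in> carrier (free_module S n)" "v = h w" by blast
      then show "u \<in> g ` carrier (free_module R n)"
        using g(2) v(2) map_vec_closed by (metis imageI)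
    qed
  qed
  then show "\<exists>n h. linear_map R (free_module R n) (free_module R p) h \<and>
      h ` carrier (free_module R n) = U" using g(1) by blast
qed

text \<open>
  The last two assumptions say that \<open>S\<close> is \<open>x\<close>-adically separated and complete: \<open>F k\<close> is the
  tail \<open>\<Sum>i\<ge>k. x^(i - k) c i\<close>.
\<close>

locale adic_quotient = nzd_quotient +
  assumes separated: "(\<And>k::nat. a k \<in> carrier S) \<Longrightarrow> (\<And>k. a k = x \<otimes>\<^bsub>S\<^esub> a (Suc k)) \<Longrightarrow> a 0 = \<zero>\<^bsub>S\<^esub>"
    and complete: "(\<And>k::nat. c k \<in> carrier S) \<Longrightarrow>
      \<exists>F. (\<forall>k. F k \<in> carrier S) \<and> (\<forall>k. F k = c k \<oplus>\<^bsub>S\<^esub> x \<otimes>\<^bsub>S\<^esub> F (Suc k))"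
begin

lemma vec_separated:
  assumes "\<And>k. v k \<in> carrier (free_module S p)"
    "\<And>k. v k = x \<odot>\<^bsub>free_module S p\<^esub> v (Suc k)"
  shows "v 0 = \<zero>\<^bsub>free_module S p\<^esub>"
proof (rule S.free_eqI[OF assms(1)])
  fix i assume i: "i < p"
  have "v 0 i = \<zero>\<^bsub>S\<^esub>"
  proof (rule separated[of "\<lambda>k. v k i"])
    show "v k i \<in> carrier S" for k using S.free_closed[OF assms(1) i] .
    show "v k i = x \<otimes>\<^bsub>S\<^esub> v (Suc k) i" for k
      using assms(2)[of k] i by (metis S.smult_apply)
  qed
  then show "v 0 i = \<zero>\<^bsub>free_module S p\<^esub> i" using i by (simp add: S.zero_apply)
qed simp

lemma vec_complete:
  assumes "\<And>k. c k \<in> carrier (free_module S p)"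
  obtains F where "\<And>k. F k \<in> carrier (free_module S p)"
    "\<And>k. F k = c k \<oplus>\<^bsub>free_module S p\<^esub> x \<odot>\<^bsub>free_module S p\<^esub> F (Suc k)"
proof -
  have "\<exists>F. i < p \<longrightarrow> (\<forall>k. F k \<in> carrier S) \<and> (\<forall>k. F k = c k i \<oplus>\<^bsub>S\<^esub> x \<otimes>\<^bsub>S\<^esub> F (Suc k))" for i
    using complete[of "\<lambda>k. c k i"] S.free_closed[OF assms] by blast
  then obtain G where G: "\<And>i k. i < p \<Longrightarrow> G i k \<in> carrier S"
    "\<And>i k. i < p \<Longrightarrow> G i k = c k i \<oplus>\<^bsub>S\<^esub> x \<otimes>\<^bsub>S\<^esub> G i (Suc k)"
    by metis
  show ?thesis
  proof (rule that[of "\<lambda>k. \<lambda>i\<in>{..<p}. G i k"])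
    show "(\<lambda>i\<in>{..<p}. G i k) \<in> carrier (free_module S p)" for k
      by (rule S.restrict_closed) (rule G(1))
    show "(\<lambda>i\<in>{..<p}. G i k) = c k \<oplus>\<^bsub>free_module S p\<^esub>
        x \<odot>\<^bsub>free_module S p\<^esub> (\<lambda>i\<in>{..<p}. G i (Suc k))" for k
      unfolding S.add_free S.smult_free
    proof
      fix i
      show "(\<lambda>i\<in>{..<p}. G i k) i = (\<lambda>i\<in>{..<p}. c k i \<oplus>\<^bsub>S\<^esub>
          (\<lambda>i\<in>{..<p}. x \<otimes>\<^bsub>S\<^esub> (\<lambda>i\<in>{..<p}. G i (Suc k)) i) i) i"
        using G(2)[of i k] by (cases "i < p") simp_all
    qed
  qed
qed

text \<open>The geometric series: on a basis vector \<open>e\<close> the inverse is the sum of the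
  \<open>x^k c k\<close> with \<open>c k = (-u)^k e\<close>, and the \<open>F k\<close> are its
  tails.\<close>

lemma one_plus_x_invertible:
  assumes u: "linear_map S (free_module S p) (free_module S p) u"
  obtains V where "linear_map S (free_module S p) (free_module S p) V"
    "\<And>w. w \<in> carrier (free_module S p) \<Longrightarrow>
      V w \<oplus>\<^bsub>free_module S p\<^esub> x \<odot>\<^bsub>free_module S p\<^esub> u (V w) = w"
proof -
  let ?F = "free_module S p"
  note [simp] = linear_map_closed[OF u]
  note lin = S.linear_map_free_simps[OF u]
  have "\<exists>y\<in>carrier ?F. y \<oplus>\<^bsub>?F\<^esub> x \<odot>\<^bsub>?F\<^esub> u y = e" if e: "e \<in> carrier ?F" for e
  proof -
    define c where "c k = ((\<lambda>z. \<ominus>\<^bsub>?F\<^esub> u z) ^^ k) e" for k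
    have c [simp]: "c k \<in> carrier ?F" for k unfolding c_def using e by (induction k) simp_all
    have cS: "c (Suc k) = \<ominus>\<^bsub>?F\<^esub> u (c k)" for k by (simp add: c_def)
    obtain F where F [simp]: "\<And>k. F k \<in> carrier ?F" and Fr: "\<And>k. F k = c k \<oplus>\<^bsub>?F\<^esub> x \<odot>\<^bsub>?F\<^esub> F (Suc k)"
      by (rule vec_complete[of c p, OF c], rule that)
    \<comment> \<open>That \<open>u\<close> may be applied termwise comes from separatedness:
      \<open>u (F k) + F (k + 1)\<close> is \<open>x\<close> times its successor, so it is zero for
      \<open>k = 0\<close>.\<close>
    have "u (F 0) \<oplus>\<^bsub>?F\<^esub> F (Suc 0) = \<zero>\<^bsub>?F\<^esub>"
    proof (rule vec_separated[of "\<lambda>k. u (F k) \<oplus>\<^bsub>?F\<^esub> F (Suc k)"])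
      show "u (F k) \<oplus>\<^bsub>?F\<^esub> F (Suc k) = x \<odot>\<^bsub>?F\<^esub> (u (F (Suc k)) \<oplus>\<^bsub>?F\<^esub> F (Suc (Suc k)))" for k
      proof -
        have "u (F k) = u (c k) \<oplus>\<^bsub>?F\<^esub> x \<odot>\<^bsub>?F\<^esub> u (F (Suc k))"
          by (subst Fr[of k]) (simp add: lin)
        moreover have "F (Suc k) = \<ominus>\<^bsub>?F\<^esub> u (c k) \<oplus>\<^bsub>?F\<^esub> x \<odot>\<^bsub>?F\<^esub> F (Suc (Suc k))"
          unfolding cS[symmetric] by (rule Fr)
        ultimately have "u (F k) \<oplus>\<^bsub>?F\<^esub> F (Suc k) = (u (c k) \<oplus>\<^bsub>?F\<^esub> x \<odot>\<^bsub>?F\<^esub> u (F (Suc k))) \<oplus>\<^bsub>?F\<^esub>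
            (\<ominus>\<^bsub>?F\<^esub> u (c k) \<oplus>\<^bsub>?F\<^esub> x \<odot>\<^bsub>?F\<^esub> F (Suc (Suc k)))"
          by (rule arg_cong2)
        also have "\<dots> = x \<odot>\<^bsub>?F\<^esub> (u (F (Suc k)) \<oplus>\<^bsub>?F\<^esub> F (Suc (Suc k)))"
          by (simp add: S.F.smult_r_distr S.F.add_neg_add_cancel)
        finally show ?thesis .
      qed
    qed simp
    then have F1: "F (Suc 0) = \<ominus>\<^bsub>?F\<^esub> u (F 0)"
      by (metis F S.F.M.add.inv_comm S.F.M.minus_equality linear_map_closed[OF u])
    have "F 0 = e \<ominus>\<^bsub>?F\<^esub> x \<odot>\<^bsub>?F\<^esub> u (F 0)"
      using Fr[of 0] by (simp add: F1 c_def a_minus_def S.F.smult_r_minus)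
    then have "F 0 \<oplus>\<^bsub>?F\<^esub> x \<odot>\<^bsub>?F\<^esub> u (F 0) = e"
      using e by (metis F S.F.minus_add_cancel S.F.smult_closed linear_map_closed[OF u] x_closed)
    then show ?thesis using F by blast
  qed
  then obtain y where y: "\<And>e. e \<in> carrier ?F \<Longrightarrow> y e \<in> carrier ?F \<and> y e \<oplus>\<^bsub>?F\<^esub> x \<odot>\<^bsub>?F\<^esub> u (y e) = e"
    by metis
  have yc: "y (std_vec S p k) \<in> carrier ?F" for k using y S.std_vec_closed by blast
  obtain V where V: "linear_map S ?F ?F V" "\<forall>k<p. V (std_vec S p k) = y (std_vec S p k)"
    using S.linear_map_exists[OF S.module_free, of p "\<lambda>k. y (std_vec S p k)" p] yc by blast
  have lin: "linear_map S ?F ?F (\<lambda>w. V w \<oplus>\<^bsub>?F\<^esub> x \<odot>\<^bsub>?F\<^esub> u (V w))"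
    by (intro linear_map_plus linear_map_scale S.module_free V(1) linear_map_comp[OF u V(1)] x_closed)
  have "V w \<oplus>\<^bsub>?F\<^esub> x \<odot>\<^bsub>?F\<^esub> u (V w) = w" if "w \<in> carrier ?F" for w
    by (rule S.linear_map_eqI[OF S.module_free lin linear_map_id _ that]) (simp add: V(2) y)
  then show ?thesis using that V(1) by blast
qed

text \<open>The lifted homotopy satisfies \<open>D s D = D (1 + x u)\<close>, with the error inside
  \<open>D\<close>. If \<open>V\<close> is a right inverse of \<open>1 + x u\<close>, then
  \<open>V s\<close> is a homotopy for \<open>1\<close>.\<close>

lemma one_in_syzygy_ann:
  assumes one: "\<one>\<^bsub>R\<^esub> \<in> syzygy_ann R l"
  shows "\<one>\<^bsub>S\<^esub> \<in> syzygy_ann S (Suc l)"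
proof (rule syzygy_annI)
  show "\<one>\<^bsub>S\<^esub> \<in> carrier S" by simp
  fix r D assume ex: "free_exact S r D"
  let ?P = "free_module S (r (Suc l))" and ?Q = "free_module S (r (Suc (Suc l)))"
  note linD = free_exact_linear[OF ex, of "Suc l"]
  obtain s t u where
    s: "linear_map S ?P ?Q s" and t: "linear_map S ?Q ?P t" and u: "linear_map S ?Q ?Q u"
    and Ds: "\<And>v. v \<in> carrier ?Q \<Longrightarrow> D (Suc l) (s (D (Suc l) v)) =
      \<one>\<^bsub>S\<^esub> \<odot>\<^bsub>?P\<^esub> D (Suc l) v \<oplus>\<^bsub>?P\<^esub> x \<odot>\<^bsub>?P\<^esub> t v"
    and tu: "\<And>v. v \<in> carrier ?Q \<Longrightarrow> t v = D (Suc l) (u v)"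
    and tk: "\<And>v. v \<in> carrier ?Q \<Longrightarrow> D (Suc l) v = \<zero>\<^bsub>?P\<^esub> \<Longrightarrow> t v = \<zero>\<^bsub>?P\<^esub>"
    by (rule lift_homotopy[OF S.one_closed _ ex, of l]) (simp_all add: one)
  note [simp] = linear_map_closed[OF linD] linear_map_closed[OF s] linear_map_closed[OF t]
    linear_map_closed[OF u]
  note lin = S.linear_map_free_simps[OF linD] S.linear_map_free_simps[OF s] S.linear_map_free_simps[OF u]
  obtain V where V: "linear_map S ?Q ?Q V"
    and Vu: "\<And>w. w \<in> carrier ?Q \<Longrightarrow> V w \<oplus>\<^bsub>?Q\<^esub> x \<odot>\<^bsub>?Q\<^esub> u (V w) = w"
    by (rule one_plus_x_invertible[OF u]) blast
  note [simp] = linear_map_closed[OF V]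
  have DsD: "D (Suc l) (s (D (Suc l) w)) = D (Suc l) (w \<oplus>\<^bsub>?Q\<^esub> x \<odot>\<^bsub>?Q\<^esub> u w)" if "w \<in> carrier ?Q" for w
    using that by (simp add: Ds tu lin)
  have "D (Suc l) (V (s (D (Suc l) v))) = \<one>\<^bsub>S\<^esub> \<odot>\<^bsub>?P\<^esub> D (Suc l) v" if v: "v \<in> carrier ?Q" for v
  proof -
    define y where "y = V (s (D (Suc l) v)) \<ominus>\<^bsub>?Q\<^esub> v"
    have y [simp]: "y \<in> carrier ?Q" unfolding y_def using v by simp
    have "D (Suc l) (s (D (Suc l) y)) = D (Suc l) (s (D (Suc l) (V (s (D (Suc l) v))))) \<ominus>\<^bsub>?P\<^esub>
        D (Suc l) (s (D (Suc l) v))"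
      unfolding y_def using v by (simp add: lin)
    also have "\<dots> = \<zero>\<^bsub>?P\<^esub>"
      using v by (subst DsD) (simp_all add: Vu S.F.minus_eq_zero_iff)
    finally have y0: "D (Suc l) (y \<oplus>\<^bsub>?Q\<^esub> x \<odot>\<^bsub>?Q\<^esub> u y) = \<zero>\<^bsub>?P\<^esub>"
      by (simp add: DsD)
    \<comment> \<open>To be shown is \<open>D y = 0\<close>, known is
      \<open>D (1 + x u) y = 0\<close>. As \<open>t = D u\<close> vanishes on the kernel of
      \<open>D\<close>, \<open>u\<close> preserves this kernel, so \<open>D (1 + x u)\<close> kills
      all \<open>(-u)^k y\<close>. Thus \<open>D (a k) = x D (a (k + 1))\<close>, and separatedness
      applies.\<close>
    define a where "a k = ((\<lambda>z. \<ominus>\<^bsub>?Q\<^esub> u z) ^^ k) y" for k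
    have a [simp]: "a k \<in> carrier ?Q" for k unfolding a_def by (induction k) simp_all
    have aS: "a (Suc k) = \<ominus>\<^bsub>?Q\<^esub> u (a k)" for k by (simp add: a_def)
    have a0: "D (Suc l) (a k \<oplus>\<^bsub>?Q\<^esub> x \<odot>\<^bsub>?Q\<^esub> u (a k)) = \<zero>\<^bsub>?P\<^esub>" for k
    proof (induction k)
      case 0
      then show ?case using y0 by (simp add: a_def)
    next
      case (Suc k)
      have "a (Suc k) \<oplus>\<^bsub>?Q\<^esub> x \<odot>\<^bsub>?Q\<^esub> u (a (Suc k)) = \<ominus>\<^bsub>?Q\<^esub> u (a k \<oplus>\<^bsub>?Q\<^esub> x \<odot>\<^bsub>?Q\<^esub> u (a k))"
        by (simp add: aS lin S.F.group_norm)
      then show ?case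
        using tk[OF _ Suc] tu[of "a k \<oplus>\<^bsub>?Q\<^esub> x \<odot>\<^bsub>?Q\<^esub> u (a k)"] linear_map_uminus[OF S.module_free S.module_free linD]
        by (simp add: S.F.neg_zero)
    qed
    have "D (Suc l) (a 0) = \<zero>\<^bsub>?P\<^esub>"
    proof (rule vec_separated[of "\<lambda>k. D (Suc l) (a k)"])
      fix k
      have "D (Suc l) (a k) \<ominus>\<^bsub>?P\<^esub> x \<odot>\<^bsub>?P\<^esub> D (Suc l) (a (Suc k)) = \<zero>\<^bsub>?P\<^esub>"
        using a0[of k] by (simp add: aS lin S.F.smult_r_minus a_minus_def S.F.M.minus_minus)
      then show "D (Suc l) (a k) = x \<odot>\<^bsub>?P\<^esub> D (Suc l) (a (Suc k))"
        by (simp add: S.F.minus_eq_zero_iff)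
    qed simp
    then have "D (Suc l) y = \<zero>\<^bsub>?P\<^esub>" by (simp add: a_def)
    then show ?thesis
      unfolding y_def using v by (simp add: lin S.F.minus_eq_zero_iff)
  qed
  then show "\<exists>s. linear_map S ?P ?Q s \<and>
      (\<forall>v\<in>carrier ?Q. D (Suc l) (s (D (Suc l) v)) = \<one>\<^bsub>S\<^esub> \<odot>\<^bsub>?P\<^esub> D (Suc l) v)"
    by (intro exI[of _ "\<lambda>w. V (s w)"] conjI ballI linear_map_comp[OF V s])
qed

section \<open>Adic order, the domain property, and finite generation\<close>

lemma x_pow_cancel:
  "a \<in> carrier S \<Longrightarrow> x [^]\<^bsub>S\<^esub> (n::nat) \<otimes>\<^bsub>S\<^esub> a = \<zero>\<^bsub>S\<^esub> \<Longrightarrow> a = \<zero>\<^bsub>S\<^esub>"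
proof (induction n)
  case (Suc n)
  have "x \<otimes>\<^bsub>S\<^esub> (x [^]\<^bsub>S\<^esub> n \<otimes>\<^bsub>S\<^esub> a) = x [^]\<^bsub>S\<^esub> Suc n \<otimes>\<^bsub>S\<^esub> a"
    using Suc.prems by (simp add: S.m_ac)
  then show ?case using Suc x_nzd[of "x [^]\<^bsub>S\<^esub> n \<otimes>\<^bsub>S\<^esub> a"] by simp
qed simp

text \<open>Otherwise \<open>a\<close> could be divided by \<open>x\<close> again and again, and
  separatedness would make it zero.\<close>

lemma x_adic_order:
  assumes a: "a \<in> carrier S" "a \<noteq> \<zero>\<^bsub>S\<^esub>"
  obtains n a' where "a' \<in> carrier S" "a = x [^]\<^bsub>S\<^esub> (n::nat) \<otimes>\<^bsub>S\<^esub> a'" "\<phi> a' \<noteq> \<zero>\<^bsub>R\<^esub>"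
proof (rule ccontr)
  assume "\<not> thesis"
  then have *: "\<phi> b = \<zero>\<^bsub>R\<^esub>" if "b \<in> carrier S" "a = x [^]\<^bsub>S\<^esub> (n::nat) \<otimes>\<^bsub>S\<^esub> b" for b n
    using that \<open>\<And>n a'. \<lbrakk>a' \<in> carrier S; a = x [^]\<^bsub>S\<^esub> n \<otimes>\<^bsub>S\<^esub> a'; \<phi> a' \<noteq> \<zero>\<^bsub>R\<^esub>\<rbrakk> \<Longrightarrow> thesis\<close> by blast
  \<comment> \<open>The sequence of successive quotients of \<open>a\<close> by \<open>x\<close>;
    the clause for \<open>n = 0\<close> ties its start to \<open>a\<close>.\<close>
  have "\<exists>f. \<forall>n. (f n \<in> carrier S \<and> a = x [^]\<^bsub>S\<^esub> n \<otimes>\<^bsub>S\<^esub> f n \<and> (n = 0 \<longrightarrow> f n = a)) \<and> f n = x \<otimes>\<^bsub>S\<^esub> f (Suc n)"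
  proof (rule dependent_nat_choice)
    show "\<exists>b. b \<in> carrier S \<and> a = x [^]\<^bsub>S\<^esub> (0::nat) \<otimes>\<^bsub>S\<^esub> b \<and> ((0::nat) = 0 \<longrightarrow> b = a)"
      using a by (intro exI[of _ a]) simp
    fix b n assume b: "b \<in> carrier S \<and> a = x [^]\<^bsub>S\<^esub> (n::nat) \<otimes>\<^bsub>S\<^esub> b \<and> (n = 0 \<longrightarrow> b = a)"
    then obtain c where c: "c \<in> carrier S" "b = x \<otimes>\<^bsub>S\<^esub> c"
      using x_kernel[of b] * by blast
    then show "\<exists>c. (c \<in> carrier S \<and> a = x [^]\<^bsub>S\<^esub> Suc n \<otimes>\<^bsub>S\<^esub> c \<and> (Suc n = 0 \<longrightarrow> c = a)) \<and> b = x \<otimes>\<^bsub>S\<^esub> c"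
      using b by (intro exI[of _ c]) (simp add: S.m_assoc)
  qed
  then obtain f where f: "\<And>n. f n \<in> carrier S" "\<And>n. f n = x \<otimes>\<^bsub>S\<^esub> f (Suc n)" "f 0 = a" by metis
  show False using separated[of f] f a(2) by metis
qed

text \<open>Nonzero elements have nonzero leading coefficients in \<open>R\<close>. After cancelling
  the powers of \<open>x\<close>, a product zero in \<open>S\<close> would give a product zero of
  these in \<open>R\<close>.\<close>

lemma domain_lift:
  assumes "domain R"
  shows "domain S"
proof -
  interpret D: domain R by fact
  show ?thesis
  proof
    show "\<one>\<^bsub>S\<^esub> \<noteq> \<zero>\<^bsub>S\<^esub>"
      using hom_simps(4,5) D.one_not_zero by metis
    fix a b assume ab: "a \<otimes>\<^bsub>S\<^esub> b = \<zero>\<^bsub>S\<^esub>" "a \<in> carrier S" "b \<in> carrier S"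
    show "a = \<zero>\<^bsub>S\<^esub> \<or> b = \<zero>\<^bsub>S\<^esub>"
    proof (rule ccontr)
      assume "\<not> (a = \<zero>\<^bsub>S\<^esub> \<or> b = \<zero>\<^bsub>S\<^esub>)"
      then have n: "a \<noteq> \<zero>\<^bsub>S\<^esub>" "b \<noteq> \<zero>\<^bsub>S\<^esub>" by blast+
      obtain i a' where a': "a' \<in> carrier S" "a = x [^]\<^bsub>S\<^esub> (i::nat) \<otimes>\<^bsub>S\<^esub> a'" "\<phi> a' \<noteq> \<zero>\<^bsub>R\<^esub>"
        by (rule x_adic_order[OF ab(2) n(1)])
      obtain j b' where b': "b' \<in> carrier S" "b = x [^]\<^bsub>S\<^esub> (j::nat) \<otimes>\<^bsub>S\<^esub> b'" "\<phi> b' \<noteq> \<zero>\<^bsub>R\<^esub>"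
        by (rule x_adic_order[OF ab(3) n(2)])
      have "x [^]\<^bsub>S\<^esub> i \<otimes>\<^bsub>S\<^esub> (x [^]\<^bsub>S\<^esub> j \<otimes>\<^bsub>S\<^esub> (a' \<otimes>\<^bsub>S\<^esub> b')) = \<zero>\<^bsub>S\<^esub>"
        using ab(1) a'(1,2) b'(1,2) by (simp add: S.m_ac)
      then have "a' \<otimes>\<^bsub>S\<^esub> b' = \<zero>\<^bsub>S\<^esub>"
        using a'(1) b'(1) x_pow_cancel by (metis S.m_closed S.nat_pow_closed x_closed)
      then have "\<phi> a' \<otimes>\<^bsub>R\<^esub> \<phi> b' = \<zero>\<^bsub>R\<^esub>"
        using a'(1) b'(1) hom_simps(3)[of a' b'] hom_simps(5) by simp
      then show False using D.integral[of "\<phi> a'" "\<phi> b'"] a'(1,3) b'(1,3) by simp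
    qed
  qed
qed

text \<open>Generators of the image of \<open>U\<close> modulo \<open>x\<close> are lifted into
  \<open>U\<close>. The remainder is \<open>x v'\<close> with \<open>v'\<close> in the whole free
  module; whether \<open>v'\<close> lies in \<open>U\<close> decides how the division can be
  iterated.\<close>

lemma lift_generators:
  assumes noeth: "fg_submodules R" and U: "submodule U S (free_module S p)"
  obtains n h where "linear_map S (free_module S n) (free_module S p) h"
    "h ` carrier (free_module S n) \<subseteq> U"
    "\<And>v. v \<in> U \<Longrightarrow> \<exists>w\<in>carrier (free_module S n). \<exists>v'\<in>carrier (free_module S p).
      v = h w \<oplus>\<^bsub>free_module S p\<^esub> x \<odot>\<^bsub>free_module S p\<^esub> v'"
proof -
  let ?F = "free_module S p" and ?G = "free_module R p"
  note U' = S.F.submoduleE[OF U]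
  have Uc: "u \<in> carrier ?F" if "u \<in> U" for u using U'(1) that by blast
  have "submodule (map_vec \<phi> p ` U) R ?G"
  proof (rule R.F.submoduleI)
    show "\<zero>\<^bsub>?G\<^esub> \<in> map_vec \<phi> p ` U"
      using S.F.submodule_zero_closed[OF U] map_vec_zero by (metis imageI)
    show "\<ominus>\<^bsub>?G\<^esub> a \<in> map_vec \<phi> p ` U" if a: "a \<in> map_vec \<phi> p ` U" for a
    proof -
      obtain u where "u \<in> U" "a = map_vec \<phi> p u" using a by blast
      then show ?thesis using U'(3)[of u] Uc by (metis imageI map_vec_uminus)
    qed
    show "a \<oplus>\<^bsub>?G\<^esub> b \<in> map_vec \<phi> p ` U"
      if a: "a \<in> map_vec \<phi> p ` U" and b: "b \<in> map_vec \<phi> p ` U" for a b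
    proof -
      obtain u where "u \<in> U" "a = map_vec \<phi> p u" using a by blast
      moreover obtain w where "w \<in> U" "b = map_vec \<phi> p w" using b by blast
      ultimately show ?thesis using U'(5)[of u w] Uc by (metis imageI map_vec_add)
    qed
    show "a \<odot>\<^bsub>?G\<^esub> b \<in> map_vec \<phi> p ` U"
      if a: "a \<in> carrier R" and b: "b \<in> map_vec \<phi> p ` U" for a b
    proof -
      obtain c where "c \<in> carrier S" "a = \<phi> c" using a surj by blast
      moreover obtain w where "w \<in> U" "b = map_vec \<phi> p w" using b by blast
      ultimately show ?thesis using U'(4)[of c w] Uc by (metis imageI map_vec_smult)
    qed
  qed (use Uc in \<open>simp add: image_subset_iff\<close>)
  then obtain n g where g: "linear_map R (free_module R n) ?G g"
    "g ` carrier (free_module R n) = map_vec \<phi> p ` U"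
    by (rule fg_submodulesE[OF noeth])
  have "\<exists>u\<in>U. map_vec \<phi> p u = g (std_vec R n k)" for k
  proof -
    have "g (std_vec R n k) \<in> map_vec \<phi> p ` U" using g(2) R.std_vec_closed by blast
    then show ?thesis by (metis imageE)
  qed
  then obtain c where c: "\<And>k. c k \<in> U" "\<And>k. map_vec \<phi> p (c k) = g (std_vec R n k)" by metis
  obtain h where h: "linear_map S (free_module S n) ?F h" "h ` carrier (free_module S n) \<subseteq> U"
    "\<And>k. k < n \<Longrightarrow> h (std_vec S n k) = c k"
    by (rule S.linear_map_into_submodule[OF S.module_free U, of n c]) (use c in blast)+
  have hg: "map_vec \<phi> p (h w) = g (map_vec \<phi> n w)" if "w \<in> carrier (free_module S n)" for w
    by (rule S.linear_map_eqI[OF module_restrict linear_map_comp[OF map_vec_linear h(1)]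
          linear_map_comp[OF linear_map_restrict_scalars[OF hom g(1)] map_vec_linear] _ that])
      (simp add: h(3) c(2) map_vec_std)
  show ?thesis
  proof (rule that[OF h(1,2)])
    fix v assume v: "v \<in> U"
    then have "map_vec \<phi> p v \<in> g ` carrier (free_module R n)" using g(2) by blast
    then obtain w0 where w0: "w0 \<in> carrier (free_module R n)" "map_vec \<phi> p v = g w0" by blast
    obtain w where w: "w \<in> carrier (free_module S n)" "map_vec \<phi> n w = w0"
      using map_vec_surj[OF w0(1)] by blast
    have vc: "v \<in> carrier ?F" and hc: "h w \<in> carrier ?F"
      using Uc v linear_map_closed[OF h(1) w(1)] by auto
    have "map_vec \<phi> p (v \<ominus>\<^bsub>?F\<^esub> h w) = \<zero>\<^bsub>?G\<^esub>"
      using vc hc linear_map_closed[OF g(1) w0(1)]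
      by (simp add: map_vec_minus hg[OF w(1)] w(2) w0(2) R.F.minus_eq_zero_iff)
    then obtain v' where v': "v' \<in> carrier ?F" "v \<ominus>\<^bsub>?F\<^esub> h w = x \<odot>\<^bsub>?F\<^esub> v'"
      using map_vec_kernel[OF S.F.M.minus_closed[OF vc hc]] by blast
    have "v = h w \<oplus>\<^bsub>?F\<^esub> x \<odot>\<^bsub>?F\<^esub> v'"
      unfolding v'(2)[symmetric] using vc hc by (metis S.F.M.a_comm S.F.M.minus_closed S.F.minus_add_cancel)
    then show "\<exists>w\<in>carrier (free_module S n). \<exists>v'\<in>carrier ?F. v = h w \<oplus>\<^bsub>?F\<^esub> x \<odot>\<^bsub>?F\<^esub> v'"
      using w(1) v'(1) by blast
  qed
qed

text \<open>Saturation puts the remainder \<open>v'\<close> back into \<open>U\<close>, so the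
  division can be iterated: \<open>v = h (W v) + x N v\<close>, and \<open>v\<close> is the image of
  the sum of the \<open>x^k W (N^k v)\<close>.\<close>

lemma fg_saturated:
  assumes noeth: "fg_submodules R" and U: "submodule U S (free_module S p)"
    and sat: "\<And>v. v \<in> carrier (free_module S p) \<Longrightarrow> x \<odot>\<^bsub>free_module S p\<^esub> v \<in> U \<Longrightarrow> v \<in> U"
  shows "\<exists>n h. linear_map S (free_module S n) (free_module S p) h \<and> h ` carrier (free_module S n) = U"
proof -
  let ?F = "free_module S p"
  note U' = S.F.submoduleE[OF U]
  obtain n h where h: "linear_map S (free_module S n) ?F h" "h ` carrier (free_module S n) \<subseteq> U"
    and hU: "\<And>v. v \<in> U \<Longrightarrow> \<exists>w\<in>carrier (free_module S n). \<exists>v'\<in>carrier ?F.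
      v = h w \<oplus>\<^bsub>?F\<^esub> x \<odot>\<^bsub>?F\<^esub> v'"
    by (rule lift_generators[OF noeth U]) blast
  note [simp] = linear_map_closed[OF h(1)]
  have "\<exists>w v'. v \<in> U \<longrightarrow> w \<in> carrier (free_module S n) \<and> v' \<in> U \<and> v = h w \<oplus>\<^bsub>?F\<^esub> x \<odot>\<^bsub>?F\<^esub> v'" for v
  proof (cases "v \<in> U")
    case v: True
    then obtain w v' where w: "w \<in> carrier (free_module S n)" "v' \<in> carrier ?F"
      "v = h w \<oplus>\<^bsub>?F\<^esub> x \<odot>\<^bsub>?F\<^esub> v'" using hU by blast
    have "x \<odot>\<^bsub>?F\<^esub> v' = v \<oplus>\<^bsub>?F\<^esub> \<ominus>\<^bsub>?F\<^esub> h w"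
      unfolding w(3) using w(1,2) by (simp add: S.F.add_neg_cancel_left)
    moreover have "v \<oplus>\<^bsub>?F\<^esub> \<ominus>\<^bsub>?F\<^esub> h w \<in> U" using U'(3,5) v h(2) w(1) by blast
    ultimately have "v' \<in> U" using sat w(2) by metis
    then show ?thesis using w by blast
  qed blast
  then obtain W N where WN: "\<And>v. v \<in> U \<Longrightarrow> W v \<in> carrier (free_module S n)" "\<And>v. v \<in> U \<Longrightarrow> N v \<in> U"
    "\<And>v. v \<in> U \<Longrightarrow> v = h (W v) \<oplus>\<^bsub>?F\<^esub> x \<odot>\<^bsub>?F\<^esub> N v"
    by metis
  have "v \<in> h ` carrier (free_module S n)" if v: "v \<in> U" for v
  proof -
    define f where "f k = (N ^^ k) v" for k
    have fU: "f k \<in> U" for k unfolding f_def using v WN(2) by (induction k) simp_all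
    have f [simp]: "f k \<in> carrier ?F" for k using fU U'(1) by blast
    have fS: "f k = h (W (f k)) \<oplus>\<^bsub>?F\<^esub> x \<odot>\<^bsub>?F\<^esub> f (Suc k)" for k
      using WN(3)[OF fU[of k]] by (simp add: f_def)
    have Wc [simp]: "W (f k) \<in> carrier (free_module S n)" for k using WN(1) fU by blast
    \<comment> \<open>\<open>C 0\<close> is the sum of the \<open>x^k W (f k)\<close>; that
      \<open>h\<close> may be applied termwise follows from separatedness, applied to the
      differences \<open>f k - h (C k)\<close>.\<close>
    obtain C where C [simp]: "\<And>k. C k \<in> carrier (free_module S n)"
      and CS: "\<And>k. C k = W (f k) \<oplus>\<^bsub>free_module S n\<^esub> x \<odot>\<^bsub>free_module S n\<^esub> C (Suc k)"
      by (rule vec_complete[of "\<lambda>k. W (f k)" n, OF Wc], rule that)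
    have "f 0 \<ominus>\<^bsub>?F\<^esub> h (C 0) = \<zero>\<^bsub>?F\<^esub>"
    proof (rule vec_separated[of "\<lambda>k. f k \<ominus>\<^bsub>?F\<^esub> h (C k)"])
      fix k
      have "h (C k) = h (W (f k)) \<oplus>\<^bsub>?F\<^esub> x \<odot>\<^bsub>?F\<^esub> h (C (Suc k))"
        using arg_cong[OF CS[of k], of h] by (simp add: S.linear_map_free_simps[OF h(1)])
      then have "f k \<ominus>\<^bsub>?F\<^esub> h (C k) = (h (W (f k)) \<oplus>\<^bsub>?F\<^esub> x \<odot>\<^bsub>?F\<^esub> f (Suc k)) \<ominus>\<^bsub>?F\<^esub>
          (h (W (f k)) \<oplus>\<^bsub>?F\<^esub> x \<odot>\<^bsub>?F\<^esub> h (C (Suc k)))"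
        using fS[of k] by simp
      then show "f k \<ominus>\<^bsub>?F\<^esub> h (C k) = x \<odot>\<^bsub>?F\<^esub> (f (Suc k) \<ominus>\<^bsub>?F\<^esub> h (C (Suc k)))"
        by (simp add: S.F.add_minus_add_cancel_left S.F.smult_r_diff)
    qed simp
    then have "v = h (C 0)" by (simp add: S.F.minus_eq_zero_iff) (simp add: f_def)
    then show ?thesis using C by blast
  qed
  then have "h ` carrier (free_module S n) = U" using h(2) by blast
  then show ?thesis using h(1) by blast
qed

text \<open>The torsion of \<open>S^p / U\<close> by powers of \<open>x\<close> has bounded
  exponent, because the saturation of \<open>U\<close> is finitely generated; induction on the
  exponent reduces to the saturated case.\<close>

lemma fg_submodules_lift:
  assumes noeth: "fg_submodules R"
  shows "fg_submodules S"
  unfolding fg_submodules_def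
proof (intro allI impI)
  fix p U assume U: "submodule U S (free_module S p)"
  let ?F = "free_module S p"
  have pow [simp]: "x [^]\<^bsub>S\<^esub> (k::nat) \<in> carrier S" for k by simp
  have powS: "x [^]\<^bsub>S\<^esub> Suc k \<odot>\<^bsub>?F\<^esub> v = x [^]\<^bsub>S\<^esub> k \<odot>\<^bsub>?F\<^esub> (x \<odot>\<^bsub>?F\<^esub> v)"
    if "v \<in> carrier ?F" for k v using that by (simp add: S.F.smult_assoc1)
  have powS': "x [^]\<^bsub>S\<^esub> Suc k \<odot>\<^bsub>?F\<^esub> v = x \<odot>\<^bsub>?F\<^esub> (x [^]\<^bsub>S\<^esub> k \<odot>\<^bsub>?F\<^esub> v)"
    if "v \<in> carrier ?F" for k v using that by (simp add: S.F.smult_assoc1[symmetric] S.m_comm)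
  \<comment> \<open>The condition says that whatever some power of \<open>x\<close> carries into
    \<open>U\<close> is already carried there by \<open>x^K\<close>; for \<open>K = 0\<close> this
    gives saturation.\<close>
  have fg: "\<exists>n h. linear_map S (free_module S n) ?F h \<and> h ` carrier (free_module S n) = U"
    if "submodule U S ?F"
      "\<And>v k. v \<in> carrier ?F \<Longrightarrow> x [^]\<^bsub>S\<^esub> (k::nat) \<odot>\<^bsub>?F\<^esub> v \<in> U \<Longrightarrow> x [^]\<^bsub>S\<^esub> K \<odot>\<^bsub>?F\<^esub> v \<in> U"
    for K :: nat and U
    using that
  proof (induction K arbitrary: U)
    case 0
    show ?case
    proof (rule fg_saturated[OF noeth 0(1)])
      fix v assume v: "v \<in> carrier ?F" "x \<odot>\<^bsub>?F\<^esub> v \<in> U"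
      then show "v \<in> U" using 0(2)[of v 1] by simp
    qed
  next
    case (Suc K)
    note U' = S.F.submoduleE[OF Suc.prems(1)]
    \<comment> \<open>\<open>V\<close> is the colon submodule \<open>U : x\<close>, for which the
      exponent \<open>K\<close> suffices. In \<open>u = h w + x v'\<close> the remainder lies in
      \<open>U\<close>, so \<open>v'\<close> lies in \<open>V\<close>; the lifted generators and
      \<open>x\<close> times generators of \<open>V\<close> together generate
      \<open>U\<close>.\<close>
    define V where "V = {v \<in> carrier ?F. x \<odot>\<^bsub>?F\<^esub> v \<in> U}"
    have "submodule V S ?F"
      unfolding V_def by (rule submodule_vimage[OF S.module_free S.module_free
          linear_map_scale[OF S.module_free linear_map_id x_closed] Suc.prems(1)])
    then have "\<exists>n h. linear_map S (free_module S n) ?F h \<and> h ` carrier (free_module S n) = V"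
    proof (rule Suc.IH)
      fix v k assume v: "v \<in> carrier ?F" "x [^]\<^bsub>S\<^esub> (k::nat) \<odot>\<^bsub>?F\<^esub> v \<in> V"
      then have "x [^]\<^bsub>S\<^esub> Suc k \<odot>\<^bsub>?F\<^esub> v \<in> U" unfolding V_def powS'[OF v(1)] by blast
      then have "x [^]\<^bsub>S\<^esub> Suc K \<odot>\<^bsub>?F\<^esub> v \<in> U" using Suc.prems(2) v(1) by blast
      then show "x [^]\<^bsub>S\<^esub> K \<odot>\<^bsub>?F\<^esub> v \<in> V" using v(1) unfolding V_def powS'[OF v(1)] by simp
    qed
    then obtain n g where g: "linear_map S (free_module S n) ?F g" "g ` carrier (free_module S n) = V"
      by blast
    obtain m h where h: "linear_map S (free_module S m) ?F h" "h ` carrier (free_module S m) \<subseteq> U"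
      and hU: "\<And>v. v \<in> U \<Longrightarrow> \<exists>w\<in>carrier (free_module S m). \<exists>v'\<in>carrier ?F.
        v = h w \<oplus>\<^bsub>?F\<^esub> x \<odot>\<^bsub>?F\<^esub> v'"
      by (rule lift_generators[OF noeth Suc.prems(1)]) blast
    let ?f = "\<lambda>w. h (vec_fst m w) \<oplus>\<^bsub>?F\<^esub> x \<odot>\<^bsub>?F\<^esub> g (vec_snd m n w)"
    have "linear_map S (free_module S (m + n)) ?F ?f"
      by (intro linear_map_plus linear_map_scale linear_map_comp[OF h(1) S.vec_fst_linear]
          linear_map_comp[OF g(1) S.vec_snd_linear] S.module_free x_closed)
    moreover have "?f ` carrier (free_module S (m + n)) = U"
    proof (intro equalityI subsetI)
      fix u assume "u \<in> ?f ` carrier (free_module S (m + n))"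
      then obtain w where w: "w \<in> carrier (free_module S (m + n))" "u = ?f w" by blast
      have "h (vec_fst m w) \<in> U"
        using h(2) linear_map_closed[OF S.vec_fst_linear w(1)] by blast
      moreover have "x \<odot>\<^bsub>?F\<^esub> g (vec_snd m n w) \<in> U"
        using g(2) linear_map_closed[OF S.vec_snd_linear w(1)] unfolding V_def by blast
      ultimately show "u \<in> U" using w(2) U'(5) by blast
    next
      fix u assume u: "u \<in> U"
      then obtain w v' where w: "w \<in> carrier (free_module S m)" "v' \<in> carrier ?F"
        "u = h w \<oplus>\<^bsub>?F\<^esub> x \<odot>\<^bsub>?F\<^esub> v'" using hU by blast
      have "x \<odot>\<^bsub>?F\<^esub> v' = u \<oplus>\<^bsub>?F\<^esub> \<ominus>\<^bsub>?F\<^esub> h w"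
        unfolding w(3) using w(1,2) linear_map_closed[OF h(1)] by (simp add: S.F.add_neg_cancel_left)
      moreover have "u \<oplus>\<^bsub>?F\<^esub> \<ominus>\<^bsub>?F\<^esub> h w \<in> U" using U'(3,5) u h(2) w(1) by blast
      ultimately have "v' \<in> V" using w(2) unfolding V_def by simp
      then obtain z where z: "z \<in> carrier (free_module S n)" "v' = g z" using g(2) by blast
      have "u = ?f (vec_append m n w z)" using w z by simp
      then show "u \<in> ?f ` carrier (free_module S (m + n))"
        using S.vec_append_closed[OF w(1) z(1)] by blast
    qed
    ultimately show ?case by blast
  qed
  \<comment> \<open>\<open>W\<close> is the saturation of \<open>U\<close>. Being finitely
    generated, it is carried into \<open>U\<close> by a single power \<open>x^L\<close>, which is
    the bound that \<open>fg\<close> asks for.\<close>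
  define W where "W = {v \<in> carrier ?F. \<exists>k::nat. x [^]\<^bsub>S\<^esub> k \<odot>\<^bsub>?F\<^esub> v \<in> U}"
  note U' = S.F.submoduleE[OF U]
  have raise: "x [^]\<^bsub>S\<^esub> k \<odot>\<^bsub>?F\<^esub> v \<in> U" if "v \<in> carrier ?F" "x [^]\<^bsub>S\<^esub> j \<odot>\<^bsub>?F\<^esub> v \<in> U" "j \<le> k"
    for j k :: nat and v
  proof -
    have "x [^]\<^bsub>S\<^esub> k = x [^]\<^bsub>S\<^esub> (k - j) \<otimes>\<^bsub>S\<^esub> x [^]\<^bsub>S\<^esub> j"
      using that(3) by (simp add: S.nat_pow_mult)
    then show ?thesis using U'(4)[OF pow that(2)] that(1) by (simp add: S.F.smult_assoc1)
  qed
  have "submodule W S ?F"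
  proof (rule S.F.submoduleI)
    show "\<zero>\<^bsub>?F\<^esub> \<in> W" unfolding W_def using S.F.submodule_zero_closed[OF U] by simp
    fix a assume a: "a \<in> W"
    then obtain k where k: "a \<in> carrier ?F" "x [^]\<^bsub>S\<^esub> (k::nat) \<odot>\<^bsub>?F\<^esub> a \<in> U" unfolding W_def by blast
    show "\<ominus>\<^bsub>?F\<^esub> a \<in> W"
      unfolding W_def using k U'(3)[OF k(2)] by (auto simp: S.F.smult_r_minus intro!: exI[of _ k])
    show "c \<odot>\<^bsub>?F\<^esub> a \<in> W" if c: "c \<in> carrier S" for c
    proof -
      have "x [^]\<^bsub>S\<^esub> k \<odot>\<^bsub>?F\<^esub> (c \<odot>\<^bsub>?F\<^esub> a) = c \<odot>\<^bsub>?F\<^esub> (x [^]\<^bsub>S\<^esub> k \<odot>\<^bsub>?F\<^esub> a)"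
        using k(1) c by (simp add: S.F.smult_assoc1[symmetric] S.m_comm)
      then show ?thesis unfolding W_def using k c U'(4) by (metis (mono_tags, lifting) S.F.smult_closed mem_Collect_eq)
    qed
    fix b assume b: "b \<in> W"
    then obtain j where j: "b \<in> carrier ?F" "x [^]\<^bsub>S\<^esub> (j::nat) \<odot>\<^bsub>?F\<^esub> b \<in> U" unfolding W_def by blast
    have "x [^]\<^bsub>S\<^esub> (k + j) \<odot>\<^bsub>?F\<^esub> a \<in> U" "x [^]\<^bsub>S\<^esub> (k + j) \<odot>\<^bsub>?F\<^esub> b \<in> U"
      using raise k j by (metis le_add1, metis le_add2)
    then show "a \<oplus>\<^bsub>?F\<^esub> b \<in> W"
      unfolding W_def using k(1) j(1) U'(5) by (auto simp: S.F.smult_r_distr intro!: exI[of _ "k + j"])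
  qed (auto simp: W_def)
  then obtain n h where h: "linear_map S (free_module S n) ?F h" "h ` carrier (free_module S n) = W"
  proof -
    assume W: "submodule W S ?F"
    have "\<exists>n h. linear_map S (free_module S n) ?F h \<and> h ` carrier (free_module S n) = W"
    proof (rule fg_saturated[OF noeth W])
      fix v assume v: "v \<in> carrier ?F" "x \<odot>\<^bsub>?F\<^esub> v \<in> W"
      then obtain k where "x [^]\<^bsub>S\<^esub> (k::nat) \<odot>\<^bsub>?F\<^esub> (x \<odot>\<^bsub>?F\<^esub> v) \<in> U" unfolding W_def by blast
      then have "x [^]\<^bsub>S\<^esub> Suc k \<odot>\<^bsub>?F\<^esub> v \<in> U" unfolding powS[OF v(1)] .
      then show "v \<in> W" unfolding W_def using v(1) by blast
    qed
    then show ?thesis using that by blast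
  qed
  have "\<exists>k::nat. x [^]\<^bsub>S\<^esub> k \<odot>\<^bsub>?F\<^esub> h (std_vec S n i) \<in> U" for i
  proof -
    have "h (std_vec S n i) \<in> W" using h(2) S.std_vec_closed by blast
    then show ?thesis unfolding W_def by blast
  qed
  then obtain K where K: "\<And>i. x [^]\<^bsub>S\<^esub> (K i :: nat) \<odot>\<^bsub>?F\<^esub> h (std_vec S n i) \<in> U" by metis
  \<comment> \<open>The sum is just a common upper bound of the exponents of the generators.\<close>
  define L where "L = sum K {..<n}"
  have "{w \<in> carrier (free_module S n). x [^]\<^bsub>S\<^esub> L \<odot>\<^bsub>?F\<^esub> h w \<in> U} = carrier (free_module S n)"
  proof (rule S.submodule_std_vec)
    show "submodule {w \<in> carrier (free_module S n). x [^]\<^bsub>S\<^esub> L \<odot>\<^bsub>?F\<^esub> h w \<in> U} S (free_module S n)"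
      by (rule submodule_vimage[OF S.module_free S.module_free linear_map_scale[OF S.module_free h(1) pow] U])
    fix i assume "i < n"
    then have "K i \<le> L" unfolding L_def by (intro member_le_sum) auto
    then show "std_vec S n i \<in> {w \<in> carrier (free_module S n). x [^]\<^bsub>S\<^esub> L \<odot>\<^bsub>?F\<^esub> h w \<in> U}"
      using raise[OF linear_map_closed[OF h(1)] K] by simp
  qed
  then have L: "x [^]\<^bsub>S\<^esub> L \<odot>\<^bsub>?F\<^esub> h w \<in> U" if "w \<in> carrier (free_module S n)" for w
    using that by blast
  show "\<exists>n h. linear_map S (free_module S n) ?F h \<and> h ` carrier (free_module S n) = U"
  proof (rule fg[OF U, of L])
    fix v k assume "v \<in> carrier ?F" "x [^]\<^bsub>S\<^esub> (k::nat) \<odot>\<^bsub>?F\<^esub> v \<in> U"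
    then have "v \<in> h ` carrier (free_module S n)" unfolding h(2) W_def by blast
    then show "x [^]\<^bsub>S\<^esub> L \<odot>\<^bsub>?F\<^esub> v \<in> U" using L by blast
  qed
qed

end

section \<open>Linear algebra over a field, the start of the induction on variables\<close>

context free_modules
begin

text \<open>Gaussian elimination by columns: \<open>d'\<close> consists of the first
  \<open>p\<close> columns, and the last column \<open>j\<close> is corrected by
  \<open>d' s' j\<close>, the part of it accounted for by \<open>d'\<close>. What is left is zero or
  has an invertible entry to pivot on.\<close>

lemma field_generalised_inverse:
  assumes "field R" "linear_map R (free_module R p) (free_module R q) d"
  shows "\<exists>s. linear_map R (free_module R q) (free_module R p) s \<and>
    (\<forall>v\<in>carrier (free_module R p). d (s (d v)) = d v)"
  using assms(2)
proof (induction p arbitrary: d)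
  case 0
  have v: "v = \<zero>\<^bsub>free_module R 0\<^esub>" if "v \<in> carrier (free_module R 0)" for v
    using that by (rule free_eqI) simp_all
  show ?case
    using linear_map_zero[OF module_free module_free 0]
    by (intro exI[of _ "\<lambda>_. \<zero>\<^bsub>free_module R 0\<^esub>"] conjI ballI linear_map_0 module_free)
      (drule v, simp)
next
  case (Suc p)
  interpret field R by fact
  \<comment> \<open>A name for \<open>1\<close> keeps \<open>p + e\<close> from being rewritten to
    \<open>Suc p\<close>, so that the block lemmas apply.\<close>
  obtain e :: nat where e: "e = 1" by blast
  let ?p = "free_module R p" and ?q = "free_module R q" and ?l = "free_module R e"
  have d: "linear_map R (free_module R (p + e)) ?q d" using Suc.prems by (simp add: e)
  define d' where "d' w = d (vec_append p e w \<zero>\<^bsub>?l\<^esub>)" for w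
  define j where "j z = d (vec_append p e \<zero>\<^bsub>?p\<^esub> z)" for z
  have d': "linear_map R ?p ?q d'"
    unfolding d'_def by (intro linear_map_comp[OF d] vec_append_linear linear_map_id linear_map_0 module_free)
  have j: "linear_map R ?l ?q j"
    unfolding j_def by (intro linear_map_comp[OF d] vec_append_linear linear_map_id linear_map_0 module_free)
  have dj: "d (vec_append p e w z) = d' w \<oplus>\<^bsub>?q\<^esub> j z" if "w \<in> carrier ?p" "z \<in> carrier ?l" for w z
    unfolding d'_def j_def using that by (simp add: linear_map_add[OF d, symmetric] vec_append_add)
  obtain s' where s': "linear_map R ?q ?p s'" and ds': "\<And>v. v \<in> carrier ?p \<Longrightarrow> d' (s' (d' v)) = d' v"
    using Suc.IH[OF d'] by blast
  note [simp] = linear_map_closed[OF d'] linear_map_closed[OF j] linear_map_closed[OF s']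
  note lin = linear_map_free_simps[OF d'] linear_map_free_simps[OF j] linear_map_free_simps[OF s']
  define j' where "j' z = j z \<ominus>\<^bsub>?q\<^esub> d' (s' (j z))" for z
  have j': "linear_map R ?l ?q j'"
    unfolding j'_def by (intro linear_map_diff module_free j linear_map_comp[OF d'] linear_map_comp[OF s'])
  note [simp] = linear_map_closed[OF j']
  have "\<exists>\<kappa>. linear_map R ?q ?l \<kappa> \<and> (\<forall>z\<in>carrier ?l. j' (\<kappa> (j' z)) = j' z)"
  proof (cases "j' (std_vec R e 0) = \<zero>\<^bsub>?q\<^esub>")
    case True
    have z0: "j' z = \<zero>\<^bsub>?q\<^esub>" if "z \<in> carrier ?l" for z
      by (rule linear_map_eqI[OF module_free j' linear_map_0[OF module_free] _ that]) (use True in \<open>simp add: e\<close>)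
    show ?thesis
      by (intro exI[of _ "\<lambda>_. \<zero>\<^bsub>?l\<^esub>"] conjI ballI linear_map_0 module_free) (simp add: z0)
  next
    case False
    have "\<exists>i<q. j' (std_vec R e 0) i \<noteq> \<zero>"
    proof (rule ccontr)
      assume "\<not> ?thesis"
      then have "j' (std_vec R e 0) = \<zero>\<^bsub>?q\<^esub>"
        by (intro free_eqI[where r = q]) (simp_all add: zero_apply)
      then show False using False by contradiction
    qed
    then obtain i where i: "i < q" "j' (std_vec R e 0) i \<noteq> \<zero>" by blast
    let ?c = "j' (std_vec R e 0) i"
    have c: "?c \<in> Units R" using i free_closed[of "j' (std_vec R e 0)" q i] by (simp add: field_Units)
    \<comment> \<open>The pivot coordinate divided by the pivot: a left inverse of
      \<open>j'\<close>.\<close>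
    let ?\<kappa> = "\<lambda>w. inv ?c \<odot>\<^bsub>?l\<^esub> (\<lambda>k\<in>{..<e}. w i)"
    have "linear_map R ?q ?l (\<lambda>w. \<lambda>k\<in>{..<e}. w i)"
      by (rule linear_mapI, rule restrict_closed)
        (simp_all add: free_closed i(1) add_free smult_free restrict_def fun_eq_iff)
    then have \<kappa>: "linear_map R ?q ?l ?\<kappa>"
      using c by (intro linear_map_scale module_free) simp_all
    have \<kappa>j: "?\<kappa> (j' z) = z" if "z \<in> carrier ?l" for z
    proof (rule linear_map_eqI[OF module_free linear_map_comp[OF \<kappa> j'] linear_map_id _ that])
      fix k :: nat assume "k < e"
      then show "?\<kappa> (j' (std_vec R e k)) = std_vec R e k"
        using c by (simp add: e smult_free std_vec_def restrict_def fun_eq_iff)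
    qed
    show ?thesis using \<kappa> \<kappa>j by (intro exI[of _ ?\<kappa>]) simp
  qed
  then obtain \<kappa> where \<kappa>: "linear_map R ?q ?l \<kappa>" "\<And>z. z \<in> carrier ?l \<Longrightarrow> j' (\<kappa> (j' z)) = j' z"
    by blast
  note [simp] = linear_map_closed[OF \<kappa>(1)]
  \<comment> \<open>On \<open>u = d' w + j z\<close> the difference \<open>u - d' s' u\<close> is
    \<open>j' z\<close>, from which \<open>\<kappa>\<close> recovers \<open>z\<close> up to the
    kernel of \<open>j'\<close>.\<close>
  define \<kappa>' where "\<kappa>' u = \<kappa> (u \<ominus>\<^bsub>?q\<^esub> d' (s' u))" for u
  have \<kappa>': "linear_map R ?q ?l \<kappa>'"
    unfolding \<kappa>'_def
    by (intro linear_map_comp[OF \<kappa>(1)] linear_map_diff module_free linear_map_id linear_map_comp[OF d' s'])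
  note [simp] = linear_map_closed[OF \<kappa>']
  let ?s = "\<lambda>u. vec_append p e (s' u \<ominus>\<^bsub>?p\<^esub> s' (j (\<kappa>' u))) (\<kappa>' u)"
  have "linear_map R ?q (free_module R (p + e)) ?s"
    by (intro vec_append_linear linear_map_diff module_free s' \<kappa>' linear_map_comp[OF s'] linear_map_comp[OF j])
  moreover have "d (?s (d v)) = d v" if v: "v \<in> carrier (free_module R (p + e))" for v
  proof -
    define w where "w = vec_fst p v"
    define z where "z = vec_snd p e v"
    have w [simp]: "w \<in> carrier ?p" and z [simp]: "z \<in> carrier ?l"
      unfolding w_def z_def using linear_map_closed[OF vec_fst_linear v] linear_map_closed[OF vec_snd_linear v] .
    have dv: "d v = d' w \<oplus>\<^bsub>?q\<^esub> j z"
      using dj[OF w z] vec_append_split[OF v] by (simp add: w_def z_def)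
    have "d v \<ominus>\<^bsub>?q\<^esub> d' (s' (d v)) = j' z"
      unfolding dv j'_def by (simp add: lin ds' F.add_minus_add_cancel_left)
    then have \<kappa>v: "j' (\<kappa>' (d v)) = j' z" unfolding \<kappa>'_def using \<kappa>(2)[OF z] by simp
    have [simp]: "d v \<in> carrier ?q" unfolding dv by simp
    have "d (?s (d v)) = d' (s' (d v)) \<oplus>\<^bsub>?q\<^esub> j' (\<kappa>' (d v))"
      unfolding j'_def by (subst dj) (simp_all add: lin F.group_norm)
    also have "\<dots> = (d' w \<oplus>\<^bsub>?q\<^esub> d' (s' (j z))) \<oplus>\<^bsub>?q\<^esub> (j z \<ominus>\<^bsub>?q\<^esub> d' (s' (j z)))"
      unfolding \<kappa>v unfolding dv j'_def by (simp add: lin ds')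
    also have "\<dots> = d v" unfolding dv by (simp add: F.add_add_minus_cancel)
    finally show ?thesis .
  qed
  ultimately show ?case by (auto simp: e)
qed

lemma field_one_in_syzygy_ann:
  assumes "field R"
  shows "\<one> \<in> syzygy_ann R 0"
proof (rule syzygy_annI)
  fix r d assume "free_exact R r d"
  note d = free_exact_linear[OF this, of 0]
  show "\<exists>s. linear_map R (free_module R (r 0)) (free_module R (r (Suc 0))) s \<and>
      (\<forall>v\<in>carrier (free_module R (r (Suc 0))). d 0 (s (d 0 v)) = \<one> \<odot>\<^bsub>free_module R (r 0)\<^esub> d 0 v)"
    using field_generalised_inverse[OF assms d] linear_map_closed[OF d] by simp
qed simp

text \<open>Induction on the number of coordinates: the vectors of \<open>U\<close> with last
  coordinate zero are generated by induction, and one more vector \<open>u0\<close>, with nonzero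
  last coordinate if there is such, accounts for the rest.\<close>

lemma field_fg_submodules:
  assumes "field R"
  shows "fg_submodules R"
proof -
  interpret field R by fact
  have "\<exists>n h. linear_map R (free_module R n) (free_module R p) h \<and> h ` carrier (free_module R n) = U"
    if "submodule U R (free_module R p)" for p U
    using that
  proof (induction p arbitrary: U)
    case 0
    have v: "v = \<zero>\<^bsub>free_module R 0\<^esub>" if "v \<in> carrier (free_module R 0)" for v
      using that by (rule free_eqI) simp_all
    have "\<zero>\<^bsub>free_module R 0\<^esub> \<in> carrier (free_module R 0)" by simp
    then have "(\<lambda>_. \<zero>\<^bsub>free_module R 0\<^esub>) ` carrier (free_module R 0) = U"
      using v F.submodule_zero_closed[OF 0] F.submoduleE(1)[OF 0] by blast
    then show ?case using linear_map_0[OF module_free, of "free_module R 0"] by blast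
  next
    case (Suc p)
    obtain e :: nat where e: "e = 1" by blast
    let ?p = "free_module R p" and ?P = "free_module R (p + e)" and ?l = "free_module R e"
    have U: "submodule U R ?P" using Suc.prems by (simp add: e)
    note U' = F.submoduleE[OF U]
    have i1: "linear_map R ?p ?P (\<lambda>w. vec_append p e w \<zero>\<^bsub>?l\<^esub>)"
      by (intro vec_append_linear linear_map_id linear_map_0 module_free)
    obtain n g where g: "linear_map R (free_module R n) ?p g"
      "g ` carrier (free_module R n) = {w \<in> carrier ?p. vec_append p e w \<zero>\<^bsub>?l\<^esub> \<in> U}"
      using Suc.IH[OF submodule_vimage[OF module_free module_free i1 U]] by blast
    have snd: "vec_snd p e u \<in> carrier ?l" if "u \<in> U" for u
      using linear_map_closed[OF vec_snd_linear] U'(1) that by blast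
    have "\<exists>u0\<in>U. \<forall>u\<in>U. \<exists>c\<in>carrier R. vec_snd p e u = c \<odot>\<^bsub>?l\<^esub> vec_snd p e u0"
    proof (cases "\<forall>u\<in>U. vec_snd p e u = \<zero>\<^bsub>?l\<^esub>")
      case True
      show ?thesis
        using True F.submodule_zero_closed[OF U] by (intro bexI[of _ "\<zero>\<^bsub>?P\<^esub>"]) auto
    next
      case False
      then obtain u0 where u0: "u0 \<in> U" "vec_snd p e u0 \<noteq> \<zero>\<^bsub>?l\<^esub>" by blast
      have "vec_snd p e u0 0 \<noteq> \<zero>"
      proof
        assume "vec_snd p e u0 0 = \<zero>"
        then have "vec_snd p e u0 = \<zero>\<^bsub>?l\<^esub>"
          using snd[OF u0(1)] by (intro free_eqI[where r = e]) (simp_all add: zero_apply e)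
        then show False using u0(2) by contradiction
      qed
      then have c: "vec_snd p e u0 0 \<in> Units R"
        using free_closed[OF snd[OF u0(1)]] by (simp add: field_Units e)
      have "\<exists>c\<in>carrier R. vec_snd p e u = c \<odot>\<^bsub>?l\<^esub> vec_snd p e u0" if u: "u \<in> U" for u
      proof (rule bexI)
        let ?c = "vec_snd p e u 0 \<otimes> inv (vec_snd p e u0 0)"
        have u00: "vec_snd p e u 0 \<in> carrier R" using free_closed[OF snd[OF u]] by (simp add: e)
        then show c': "?c \<in> carrier R" using c by simp
        show "vec_snd p e u = ?c \<odot>\<^bsub>?l\<^esub> vec_snd p e u0"
          using snd[OF u] snd[OF u0(1)] c c' u00 Units_closed[OF c]
          by (intro free_eqI[where r = e]) (simp_all add: smult_apply m_assoc e)
      qed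
      then show ?thesis using u0(1) by blast
    qed
    then obtain u0 where u0: "u0 \<in> U"
      "\<And>u. u \<in> U \<Longrightarrow> \<exists>c\<in>carrier R. vec_snd p e u = c \<odot>\<^bsub>?l\<^esub> vec_snd p e u0" by blast
    obtain h where h: "linear_map R ?l ?P h" "h ` carrier ?l \<subseteq> U" "h (std_vec R e 0) = u0"
      by (rule linear_map_into_submodule[OF module_free U, of e "\<lambda>_. u0"]) (use u0(1) in \<open>auto simp: e\<close>)
    let ?f = "\<lambda>z. vec_append p e (g (vec_fst n z)) \<zero>\<^bsub>?l\<^esub> \<oplus>\<^bsub>?P\<^esub> h (vec_snd n e z)"
    have "linear_map R (free_module R (n + e)) ?P ?f"
      by (intro linear_map_plus module_free linear_map_comp[OF i1] linear_map_comp[OF h(1) vec_snd_linear]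
          linear_map_comp[OF g(1) vec_fst_linear])
    moreover have "?f ` carrier (free_module R (n + e)) = U"
    proof (intro equalityI subsetI)
      fix u assume "u \<in> ?f ` carrier (free_module R (n + e))"
      then obtain z where z: "z \<in> carrier (free_module R (n + e))" "u = ?f z" by blast
      have "g (vec_fst n z) \<in> g ` carrier (free_module R n)"
        using linear_map_closed[OF vec_fst_linear z(1)] by blast
      then have "vec_append p e (g (vec_fst n z)) \<zero>\<^bsub>?l\<^esub> \<in> U" unfolding g(2) by blast
      moreover have "h (vec_snd n e z) \<in> U"
        using h(2) linear_map_closed[OF vec_snd_linear z(1)] by blast
      ultimately show "u \<in> U" using z(2) U'(5) by blast
    next
      fix u assume u: "u \<in> U"
      obtain c where c: "c \<in> carrier R" "vec_snd p e u = c \<odot>\<^bsub>?l\<^esub> vec_snd p e u0" using u0(2)[OF u] by blast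
      define t where "t = u \<oplus>\<^bsub>?P\<^esub> \<ominus>\<^bsub>?P\<^esub> (c \<odot>\<^bsub>?P\<^esub> u0)"
      have tU: "t \<in> U" unfolding t_def using u u0(1) c(1) U'(3-5) by blast
      have uc: "u \<in> carrier ?P" "u0 \<in> carrier ?P" "t \<in> carrier ?P" using u u0(1) tU U'(1) by blast+
      have "vec_snd p e t = vec_snd p e u \<ominus>\<^bsub>?l\<^esub> c \<odot>\<^bsub>?l\<^esub> vec_snd p e u0"
        unfolding t_def a_minus_def using uc c(1)
        by (simp only: linear_map_free_simps[OF vec_snd_linear] F.smult_closed F.M.a_inv_closed)
      then have "vec_snd p e t = \<zero>\<^bsub>?l\<^esub>"
        using snd[OF u0(1)] c by (simp add: F.minus_eq_zero_iff)
      then have "t = vec_append p e (vec_fst p t) \<zero>\<^bsub>?l\<^esub>"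
        using vec_append_split[OF uc(3)] by simp
      then have "vec_fst p t \<in> g ` carrier (free_module R n)"
        unfolding g(2) using tU linear_map_closed[OF vec_fst_linear uc(3)] by simp
      then obtain z where z: "z \<in> carrier (free_module R n)" "vec_fst p t = g z" by blast
      have "u = ?f (vec_append n e z (c \<odot>\<^bsub>?l\<^esub> std_vec R e 0))"
      proof -
        have "h (c \<odot>\<^bsub>?l\<^esub> std_vec R e 0) = c \<odot>\<^bsub>?P\<^esub> u0"
          using linear_map_smult[OF h(1) c(1) std_vec_closed] h(3) by simp
        moreover have "u = t \<oplus>\<^bsub>?P\<^esub> c \<odot>\<^bsub>?P\<^esub> u0"
          unfolding t_def using uc(1,2) c(1) F.minus_add_cancel[of u _ "c \<odot>\<^bsub>?P\<^esub> u0"]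
          by (simp only: a_minus_def F.smult_closed)
        ultimately show ?thesis
          using z c(1) \<open>t = vec_append p e (vec_fst p t) \<zero>\<^bsub>?l\<^esub>\<close>
          by (simp only: vec_fst_append vec_snd_append F.smult_closed std_vec_closed)
      qed
      then show "u \<in> ?f ` carrier (free_module R (n + e))"
        using vec_append_closed[OF z(1) F.smult_closed[OF c(1) std_vec_closed]] by blast
    qed
    ultimately show ?case by (auto simp: e)
  qed
  then show ?thesis by (simp add: fg_submodules_def)
qed

end

section \<open>Cohomology annihilators in terms of syzygies\<close>

locale quotient_of_module = M: module A M for A and M (structure) +
  fixes U
  assumes U: "submodule U A M"
begin

sublocale abelian_subgroup U M
  by (rule abelian_subgroupI3)
    (auto intro: additive_subgroup.intro submodule.axioms(1)[OF U] M.M.abelian_group_axioms)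

abbreviation proj where "proj x \<equiv> U +>\<^bsub>M\<^esub> x"

lemma U_subset: "U \<subseteq> carrier M"
  using M.submoduleE[OF U] by blast

lemma mem_proj_iff: "x \<in> carrier M \<Longrightarrow> y \<in> carrier M \<Longrightarrow> x \<in> proj y \<longleftrightarrow> x \<ominus>\<^bsub>M\<^esub> y \<in> U"
  unfolding a_minus_def by (rule a_rcos_module)

lemma proj_eq_iff:
  assumes "x \<in> carrier M" "y \<in> carrier M"
  shows "proj x = proj y \<longleftrightarrow> x \<ominus>\<^bsub>M\<^esub> y \<in> U"
proof
  assume "proj x = proj y"
  then have "x \<in> proj y" using a_rcos_self[OF assms(1)] by simp
  then show "x \<ominus>\<^bsub>M\<^esub> y \<in> U" using mem_proj_iff[OF assms] by blast
next
  assume "x \<ominus>\<^bsub>M\<^esub> y \<in> U"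
  then have "x \<in> proj y" using mem_proj_iff[OF assms] by blast
  then show "proj x = proj y" using a_repr_independence'[OF _ assms(2)] by simp
qed

lemma quotient_carrier: "carrier (quotient_module M U) = proj ` carrier M"
  by (auto simp: quotient_module_def A_RCOSETS_def')

lemma quotient_zero: "\<zero>\<^bsub>quotient_module M U\<^esub> = proj \<zero>\<^bsub>M\<^esub>"
  using U_subset by (simp add: quotient_module_def)

lemma quotient_add: "x \<in> carrier M \<Longrightarrow> y \<in> carrier M \<Longrightarrow>
    proj x \<oplus>\<^bsub>quotient_module M U\<^esub> proj y = proj (x \<oplus>\<^bsub>M\<^esub> y)"
  by (simp add: quotient_module_def a_rcos_sum)

lemma quotient_smult:
  assumes "a \<in> carrier A" "x \<in> carrier M"
  shows "a \<odot>\<^bsub>quotient_module M U\<^esub> proj x = proj (a \<odot>\<^bsub>M\<^esub> x)"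
proof -
  have "proj (a \<odot>\<^bsub>M\<^esub> y) = proj (a \<odot>\<^bsub>M\<^esub> x)" if "y \<in> proj x" for y
  proof -
    have y: "y \<in> carrier M" using that a_elemrcos_carrier[OF assms(2)] by blast
    have "y \<ominus>\<^bsub>M\<^esub> x \<in> U" using mem_proj_iff[OF y assms(2)] that by blast
    then have "a \<odot>\<^bsub>M\<^esub> y \<ominus>\<^bsub>M\<^esub> a \<odot>\<^bsub>M\<^esub> x \<in> U"
      using M.submoduleE(4)[OF U assms(1)] y assms by (simp add: M.smult_r_diff[symmetric])
    then show ?thesis using proj_eq_iff y assms by simp
  qed
  then have "(\<Union>y\<in>proj x. proj (a \<odot>\<^bsub>M\<^esub> y)) = (\<Union>y\<in>proj x. proj (a \<odot>\<^bsub>M\<^esub> x))"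
    by (rule SUP_cong[OF refl])
  also have "\<dots> = proj (a \<odot>\<^bsub>M\<^esub> x)"
    using a_rcos_self[OF assms(2)] by blast
  finally show ?thesis by (simp add: quotient_module_def)
qed

lemma module_quotient: "module A (quotient_module M U)"
proof (rule moduleI)
  show "abelian_group (quotient_module M U)"
  proof (rule abelian_groupI)
    fix C assume "C \<in> carrier (quotient_module M U)"
    then obtain x where "x \<in> carrier M" "C = proj x" by (auto simp: quotient_carrier)
    then show "\<exists>C'\<in>carrier (quotient_module M U). C' \<oplus>\<^bsub>quotient_module M U\<^esub> C = \<zero>\<^bsub>quotient_module M U\<^esub>"
      by (intro bexI[of _ "proj (\<ominus>\<^bsub>M\<^esub> x)"])
        (auto simp: quotient_carrier quotient_add quotient_zero M.M.l_neg)
  qed (auto simp: quotient_carrier quotient_add quotient_zero M.M.a_ac)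
qed (auto simp: quotient_carrier quotient_add quotient_smult M.R.is_cring
    M.smult_l_distr M.smult_r_distr M.smult_assoc1)

lemma proj_linear: "linear_map A M (quotient_module M U) proj"
  by (rule linear_mapI) (auto simp: quotient_carrier quotient_add quotient_smult)

lemma proj_zero_iff: "x \<in> carrier M \<Longrightarrow> proj x = \<zero>\<^bsub>quotient_module M U\<^esub> \<longleftrightarrow> x \<in> U"
  using proj_eq_iff[of x "\<zero>\<^bsub>M\<^esub>"] by (simp add: quotient_zero M.M.minus_eq M.neg_zero)

end

lemma quotient_of_moduleI: "module A M \<Longrightarrow> submodule U A M \<Longrightarrow> quotient_of_module A M U"
  by (simp add: quotient_of_module_def quotient_of_module_axioms_def)

lemma module_hom_module:
  assumes "module A M" "module A N"
  shows "module A (hom_module A M N)"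
proof -
  interpret M: module A M by fact
  interpret N: module A N by fact
  let ?H = "hom_module A M N"
  have c: "carrier ?H = module_homs A M N" by (simp add: hom_module_def)
  have lin: "linear_map A M N h" if "h \<in> carrier ?H" for h using that by (simp add: c module_homs_iff)
  have [simp]: "h x \<in> carrier N" if "h \<in> carrier ?H" "x \<in> carrier M" for h x
    using linear_map_closed[OF lin] that by blast
  have ext: "g = h" if "g \<in> carrier ?H" "h \<in> carrier ?H" "\<And>x. x \<in> carrier M \<Longrightarrow> g x = h x" for g h
    using that by (intro extensionalityI[where A = "carrier M"]) (auto simp: c module_homs_iff)
  have add [simp]: "g \<oplus>\<^bsub>?H\<^esub> h \<in> carrier ?H" if "g \<in> carrier ?H" "h \<in> carrier ?H" for g h
    using restrict_in_module_homs[OF assms(1) linear_map_plus[OF assms(2) lin[OF that(1)] lin[OF that(2)]]]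
    by (simp add: hom_module_def)
  have smult [simp]: "a \<odot>\<^bsub>?H\<^esub> h \<in> carrier ?H" if "a \<in> carrier A" "h \<in> carrier ?H" for a h
    using restrict_in_module_homs[OF assms(1) linear_map_scale[OF assms(2) lin[OF that(2)] that(1)]]
    by (simp add: hom_module_def)
  have zero [simp]: "\<zero>\<^bsub>?H\<^esub> \<in> carrier ?H"
    using restrict_in_module_homs[OF assms(1) linear_map_0[OF assms(2)]] by (simp add: hom_module_def)
  have app [simp]: "(g \<oplus>\<^bsub>?H\<^esub> h) x = g x \<oplus>\<^bsub>N\<^esub> h x" "(a \<odot>\<^bsub>?H\<^esub> h) x = a \<odot>\<^bsub>N\<^esub> h x"
    "\<zero>\<^bsub>?H\<^esub> x = \<zero>\<^bsub>N\<^esub>" if "x \<in> carrier M" for g h a x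
    using that by (simp_all add: hom_module_def)
  show ?thesis
  proof (rule moduleI)
    show "abelian_group ?H"
    proof (rule abelian_groupI)
      fix h assume h: "h \<in> carrier ?H"
      have "(\<lambda>x\<in>carrier M. \<ominus>\<^bsub>N\<^esub> h x) \<in> carrier ?H"
        using restrict_in_module_homs[OF assms(1) linear_map_neg[OF assms(2) lin[OF h]]] by (simp add: c)
      then show "\<exists>g\<in>carrier ?H. g \<oplus>\<^bsub>?H\<^esub> h = \<zero>\<^bsub>?H\<^esub>"
        using h by (intro bexI[of _ "\<lambda>x\<in>carrier M. \<ominus>\<^bsub>N\<^esub> h x"] ext) (simp_all add: N.M.l_neg)
    qed (simp; fail | rule ext; simp add: N.M.a_ac)+
  qed (simp add: M.R.is_cring; fail | rule ext; simp add: N.smult_l_distr N.smult_r_distr N.smult_assoc1)+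
qed

section \<open>Resolutions of finitely generated modules and their comparison\<close>

context free_modules
begin

lemma finitely_generated_iff:
  assumes "module R M"
  shows "finitely_generated_module R M \<longleftrightarrow>
    (\<exists>n e. linear_map R (free_module R n) M e \<and> e ` carrier (free_module R n) = carrier M)"
proof
  interpret M: module R M by fact
  assume "finitely_generated_module R M"
  then obtain B where B: "finite B" "B \<subseteq> carrier M"
    "\<And>U. submodule U R M \<Longrightarrow> B \<subseteq> U \<Longrightarrow> U = carrier M"
    unfolding finitely_generated_module_def by blast
  obtain n :: nat and c where c: "B = c ` {i. i < n}"
    using finite_imp_nat_seg_image_inj_on[OF B(1)] by blast
  obtain e where e: "linear_map R (free_module R n) M e" "\<forall>k<n. e (std_vec R n k) = c k"
    using linear_map_exists[OF assms, of n c] B(2) c by blast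
  have "B \<subseteq> e ` carrier (free_module R n)"
  proof
    fix b assume "b \<in> B"
    then obtain k where "k < n" "b = e (std_vec R n k)" using c e(2) by auto
    then show "b \<in> e ` carrier (free_module R n)" using std_vec_closed by blast
  qed
  then have "e ` carrier (free_module R n) = carrier M"
    using B(3) submodule_image[OF module_free assms e(1)] by blast
  then show "\<exists>n e. linear_map R (free_module R n) M e \<and> e ` carrier (free_module R n) = carrier M"
    using e(1) by blast
next
  interpret M: module R M by fact
  assume "\<exists>n e. linear_map R (free_module R n) M e \<and> e ` carrier (free_module R n) = carrier M"
  then obtain n e where e: "linear_map R (free_module R n) M e" "e ` carrier (free_module R n) = carrier M"
    by blast
  let ?B = "(\<lambda>k. e (std_vec R n k)) ` {..<n}"
  have "U = carrier M" if U: "submodule U R M" "?B \<subseteq> U" for U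
  proof -
    have "{v \<in> carrier (free_module R n). e v \<in> U} = carrier (free_module R n)"
      using U(2) by (intro submodule_std_vec submodule_vimage[OF module_free assms e(1) U(1)]) auto
    then have "carrier M \<subseteq> U" unfolding e(2)[symmetric] by blast
    then show ?thesis using M.submoduleE(1)[OF U(1)] by blast
  qed
  moreover have "?B \<subseteq> carrier M" using linear_map_closed[OF e(1)] by auto
  ultimately show "finitely_generated_module R M"
    unfolding finitely_generated_module_def using assms by (intro conjI exI[of _ ?B]) auto
qed

lemma finitely_generated_quotient:
  assumes "submodule U R (free_module R n)"
  shows "finitely_generated_module R (quotient_module (free_module R n) U)"
proof -
  interpret Q: quotient_of_module R "free_module R n" U
    by (rule quotient_of_moduleI[OF module_free assms])
  show ?thesis
    unfolding finitely_generated_iff[OF Q.module_quotient]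
    using Q.proj_linear Q.quotient_carrier by blast
qed

text \<open>A form of \<open>free_resolution\<close> without extensionality of the maps, so that any
  \<open>free_exact\<close> sequence resolves the cokernel of its first map with the projection as
  augmentation.\<close>

definition resolves ::
    "('a, 'm, 'x) module_scheme \<Rightarrow> (nat \<Rightarrow> nat) \<Rightarrow> (nat \<Rightarrow> (nat \<Rightarrow> 'a) \<Rightarrow> (nat \<Rightarrow> 'a)) \<Rightarrow>
      ((nat \<Rightarrow> 'a) \<Rightarrow> 'm) \<Rightarrow> bool" where
  "resolves M r d e \<longleftrightarrow> free_exact R r d \<and> linear_map R (free_module R (r 0)) M e \<and>
    e ` carrier (free_module R (r 0)) = carrier M \<and>
    (\<forall>v\<in>carrier (free_module R (r 0)). e v = \<zero>\<^bsub>M\<^esub> \<longleftrightarrow> v \<in> d 0 ` carrier (free_module R (r 1)))"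

lemma resolves_of_free_resolution:
  assumes "free_resolution R M r d e"
  shows "resolves M r d e"
proof -
  have lin: "linear_map R (free_module R (r (Suc j))) (free_module R (r j)) (d j)" for j
    using assms by (simp add: free_resolution_def module_homs_iff)
  have "d (Suc j) ` carrier (free_module R (r (Suc (Suc j)))) =
      {v \<in> carrier (free_module R (r (Suc j))). d j v = \<zero>\<^bsub>free_module R (r j)\<^esub>}" for j
    using assms by (simp add: free_resolution_def a_kernel_def')
  moreover have "d 0 ` carrier (free_module R (r 1)) =
      {v \<in> carrier (free_module R (r 0)). e v = \<zero>\<^bsub>M\<^esub>}"
    using assms by (simp add: free_resolution_def a_kernel_def')
  ultimately show ?thesis
    using assms lin unfolding resolves_def free_exact_def free_resolution_def
    by (simp add: module_homs_iff a_kernel_def')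
qed

lemma free_resolution_exists:
  assumes fg: "fg_submodules R" and M: "module R M" "finitely_generated_module R M"
  obtains r d e where "free_resolution R M r d e"
proof -
  interpret M: module R M by fact
  obtain n e where e: "linear_map R (free_module R n) M e" "e ` carrier (free_module R n) = carrier M"
    using M(2) finitely_generated_iff[OF M(1)] by blast
  obtain m d0 where d0: "linear_map R (free_module R m) (free_module R n) d0"
    "d0 ` carrier (free_module R m) = {v \<in> carrier (free_module R n). e v = \<zero>\<^bsub>M\<^esub>}"
    by (rule fg_submodulesE[OF fg submodule_kernel[OF module_free M(1) e(1)]])
  \<comment> \<open>States are triples of target rank, source rank and differential; the clause for
    \<open>k = 0\<close> fixes the presentation of \<open>M\<close>, and \<open>?Q\<close> makes the
    next differential map onto the kernel of the present one.\<close>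
  let ?P = "\<lambda>(k::nat) x. linear_map R (free_module R (fst (snd x))) (free_module R (fst x)) (snd (snd x)) \<and>
      (k = 0 \<longrightarrow> x = (n, m, d0))"
  let ?Q = "\<lambda>(k::nat) x y. fst y = fst (snd x) \<and>
      snd (snd y) ` carrier (free_module R (fst (snd y))) =
        {v \<in> carrier (free_module R (fst (snd x))). snd (snd x) v = \<zero>\<^bsub>free_module R (fst x)\<^esub>}"
  have "\<exists>f. \<forall>k. ?P k (f k) \<and> ?Q k (f k) (f (Suc k))"
  proof (rule dependent_nat_choice)
    show "\<exists>x. ?P 0 x" using d0(1) by (intro exI[of _ "(n, m, d0)"]) simp
    fix x k assume x: "?P k x"
    then have h: "linear_map R (free_module R (fst (snd x))) (free_module R (fst x)) (snd (snd x))" by blast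
    obtain q' h' where "linear_map R (free_module R q') (free_module R (fst (snd x))) h'"
      "h' ` carrier (free_module R q') =
        {v \<in> carrier (free_module R (fst (snd x))). snd (snd x) v = \<zero>\<^bsub>free_module R (fst x)\<^esub>}"
      by (rule fg_submodulesE[OF fg submodule_kernel[OF module_free module_free h]])
    then show "\<exists>y. ?P (Suc k) y \<and> ?Q k x y"
      by (intro exI[of _ "(fst (snd x), q', h')"]) simp
  qed
  then obtain f where f: "\<forall>k. ?P k (f k) \<and> ?Q k (f k) (f (Suc k))" by (rule exE)
  define r where "r k = fst (f k)" for k
  define d where "d k = snd (snd (f k))" for k
  have rS: "fst (snd (f k)) = r (Suc k)" for k
    using f[rule_format, of k] by (simp add: r_def)
  have lin: "linear_map R (free_module R (r (Suc k))) (free_module R (r k)) (d k)" for k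
    using f[rule_format, of k] unfolding rS by (simp add: r_def d_def)
  have r0: "r 0 = n" and r1: "r 1 = m" and d0': "d 0 = d0"
    using f[rule_format, of 0] rS[of 0] by (simp_all add: r_def d_def)
  have ker: "d (Suc k) ` carrier (free_module R (r (Suc (Suc k)))) =
      {v \<in> carrier (free_module R (r (Suc k))). d k v = \<zero>\<^bsub>free_module R (r k)\<^esub>}" for k
    using f[rule_format, of k] unfolding rS by (simp add: r_def d_def)
  \<comment> \<open>Cutting the maps down to their domains meets the extensionality in
    \<open>module_homs\<close>.\<close>
  let ?d = "\<lambda>k. restrict (d k) (carrier (free_module R (r (Suc k))))"
  have "free_resolution R M r ?d (restrict e (carrier (free_module R (r 0))))"
    unfolding free_resolution_def
  proof (intro conjI allI)
    show "restrict e (carrier (free_module R (r 0))) \<in> module_homs R (free_module R (r 0)) M"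
      unfolding r0 by (rule restrict_in_module_homs[OF module_free e(1)])
    show "?d j \<in> module_homs R (free_module R (r (Suc j))) (free_module R (r j))" for j
      by (rule restrict_in_module_homs[OF module_free lin])
    show "restrict e (carrier (free_module R (r 0))) ` carrier (free_module R (r 0)) = carrier M"
      using e(2) by (simp add: r0)
    show "?d 0 ` carrier (free_module R (r 1)) =
        a_kernel (free_module R (r 0)) M (restrict e (carrier (free_module R (r 0))))"
      using d0(2) r1 by (auto simp: a_kernel_def' r0 d0')
    show "?d (Suc j) ` carrier (free_module R (r (Suc (Suc j)))) =
        a_kernel (free_module R (r (Suc j))) (free_module R (r j)) (?d j)" for j
      using ker[of j] by (auto simp: a_kernel_def')
  qed
  then show ?thesis by (rule that)
qed

text \<open>The comparison theorem cut down to one degree: \<open>f\<close> and \<open>g\<close> are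
  parts of chain maps over the identity of \<open>M\<close>, and \<open>h\<close> is part of a
  homotopy. Composing the homotopy relation with \<open>d j\<close> removes the term with the
  previous homotopy, so the statement can be carried along by induction as it stands.\<close>

lemma compare_resolutions:
  assumes M: "module R M" and res: "resolves M r d e" and res': "resolves M r' d' e'"
  shows "\<exists>f f' g g' h.
    linear_map R (free_module R (r j)) (free_module R (r' j)) f \<and>
    linear_map R (free_module R (r (Suc j))) (free_module R (r' (Suc j))) f' \<and>
    linear_map R (free_module R (r' j)) (free_module R (r j)) g \<and>
    linear_map R (free_module R (r' (Suc j))) (free_module R (r (Suc j))) g' \<and>
    linear_map R (free_module R (r j)) (free_module R (r (Suc j))) h \<and>
    (\<forall>v\<in>carrier (free_module R (r (Suc j))). f (d j v) = d' j (f' v)) \<and>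
    (\<forall>v\<in>carrier (free_module R (r' (Suc j))). g (d' j v) = d j (g' v)) \<and>
    (\<forall>v\<in>carrier (free_module R (r (Suc j))).
      d j (h (d j v)) = g (f (d j v)) \<ominus>\<^bsub>free_module R (r j)\<^esub> d j v)"
proof -
  interpret M: module R M by fact
  let ?F = "\<lambda>j. free_module R (r j)" and ?F' = "\<lambda>j. free_module R (r' j)"
  have ex: "free_exact R r d" "free_exact R r' d'"
    and e: "linear_map R (?F 0) M e" "e ` carrier (?F 0) = carrier M"
    and e': "linear_map R (?F' 0) M e'" "e' ` carrier (?F' 0) = carrier M"
    and ker: "\<And>v. v \<in> carrier (?F 0) \<Longrightarrow> e v = \<zero>\<^bsub>M\<^esub> \<longleftrightarrow> v \<in> d 0 ` carrier (?F (Suc 0))"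
    and ker': "\<And>v. v \<in> carrier (?F' 0) \<Longrightarrow> e' v = \<zero>\<^bsub>M\<^esub> \<longleftrightarrow> v \<in> d' 0 ` carrier (?F' (Suc 0))"
    using res res' unfolding resolves_def by simp_all
  note ld = free_exact_linear[OF ex(1)] and ld' = free_exact_linear[OF ex(2)]
  note [simp] = linear_map_closed[OF ld] linear_map_closed[OF ld'] linear_map_closed[OF e(1)]
    linear_map_closed[OF e'(1)]
  have exk: "v \<in> d (Suc j) ` carrier (?F (Suc (Suc j)))"
    if "v \<in> carrier (?F (Suc j))" "d j v = \<zero>\<^bsub>?F j\<^esub>" for j v
    by (rule free_exact_lift[OF ex(1) that]) blast
  have exk': "v \<in> d' (Suc j) ` carrier (?F' (Suc (Suc j)))"
    if "v \<in> carrier (?F' (Suc j))" "d' j v = \<zero>\<^bsub>?F' j\<^esub>" for j v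
    by (rule free_exact_lift[OF ex(2) that]) blast
  show ?thesis
  proof (induction j)
    case 0
    obtain f where f: "linear_map R (?F 0) (?F' 0) f" and ef: "\<And>v. v \<in> carrier (?F 0) \<Longrightarrow> e' (f v) = e v"
      by (rule linear_map_factor[OF module_free M e'(1) e(1)]) (use e'(2) in auto)
    obtain g where g: "linear_map R (?F' 0) (?F 0) g" and eg: "\<And>v. v \<in> carrier (?F' 0) \<Longrightarrow> e (g v) = e' v"
      by (rule linear_map_factor[OF module_free M e(1) e'(1)]) (use e(2) in auto)
    note [simp] = linear_map_closed[OF f] linear_map_closed[OF g]
    obtain f' where f': "linear_map R (?F (Suc 0)) (?F' (Suc 0)) f'"
      and df: "\<And>v. v \<in> carrier (?F (Suc 0)) \<Longrightarrow> d' 0 (f' v) = f (d 0 v)"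
    proof (rule linear_map_factor[OF module_free module_free ld' linear_map_comp[OF f ld]])
      show "f (d 0 (std_vec R (r (Suc 0)) k)) \<in> d' 0 ` carrier (?F' (Suc 0))" for k
        using ker[of "d 0 (std_vec R (r (Suc 0)) k)"] by (subst ker'[symmetric]) (simp_all add: ef)
    qed blast
    obtain g' where g': "linear_map R (?F' (Suc 0)) (?F (Suc 0)) g'"
      and dg: "\<And>v. v \<in> carrier (?F' (Suc 0)) \<Longrightarrow> d 0 (g' v) = g (d' 0 v)"
    proof (rule linear_map_factor[OF module_free module_free ld linear_map_comp[OF g ld']])
      show "g (d' 0 (std_vec R (r' (Suc 0)) k)) \<in> d 0 ` carrier (?F (Suc 0))" for k
        using ker'[of "d' 0 (std_vec R (r' (Suc 0)) k)"] by (subst ker[symmetric]) (simp_all add: eg)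
    qed blast
    obtain h where h: "linear_map R (?F 0) (?F (Suc 0)) h"
      and dh: "\<And>v. v \<in> carrier (?F 0) \<Longrightarrow> d 0 (h v) = g (f v) \<ominus>\<^bsub>?F 0\<^esub> v"
    proof (rule linear_map_factor[OF module_free module_free ld
          linear_map_diff[OF module_free linear_map_comp[OF g f] linear_map_id]])
      show "g (f (std_vec R (r 0) k)) \<ominus>\<^bsub>?F 0\<^esub> std_vec R (r 0) k \<in> d 0 ` carrier (?F (Suc 0))" for k
        by (subst ker[symmetric]) (simp_all add: linear_map_minus[OF module_free M e(1)] ef eg M.minus_eq_zero_iff)
    qed blast
    show ?case
      by (intro exI conjI; (rule f f' g g' h)?) (simp_all add: df dg dh)
  next
    case (Suc j)
    then obtain f f' g g' h where
      f: "linear_map R (?F j) (?F' j) f" and f': "linear_map R (?F (Suc j)) (?F' (Suc j)) f'" and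
      g: "linear_map R (?F' j) (?F j) g" and g': "linear_map R (?F' (Suc j)) (?F (Suc j)) g'" and
      h: "linear_map R (?F j) (?F (Suc j)) h" and
      df: "\<And>v. v \<in> carrier (?F (Suc j)) \<Longrightarrow> f (d j v) = d' j (f' v)" and
      dg: "\<And>v. v \<in> carrier (?F' (Suc j)) \<Longrightarrow> g (d' j v) = d j (g' v)" and
      dh: "\<And>v. v \<in> carrier (?F (Suc j)) \<Longrightarrow> d j (h (d j v)) = g (f (d j v)) \<ominus>\<^bsub>?F j\<^esub> d j v"
      by blast
    note [simp] = linear_map_closed[OF f'] linear_map_closed[OF g'] linear_map_closed[OF h]
      linear_map_closed[OF f] linear_map_closed[OF g]
    obtain f'' where f'': "linear_map R (?F (Suc (Suc j))) (?F' (Suc (Suc j))) f''"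
      and df'': "\<And>v. v \<in> carrier (?F (Suc (Suc j))) \<Longrightarrow> d' (Suc j) (f'' v) = f' (d (Suc j) v)"
    proof (rule linear_map_factor[OF module_free module_free ld' linear_map_comp[OF f' ld]])
      show "f' (d (Suc j) (std_vec R (r (Suc (Suc j))) k)) \<in> d' (Suc j) ` carrier (?F' (Suc (Suc j)))" for k
        by (rule exk') (simp_all add: df[symmetric] free_exact_complex[OF ex(1)] linear_map_free_simps[OF f])
    qed blast
    obtain g'' where g'': "linear_map R (?F' (Suc (Suc j))) (?F (Suc (Suc j))) g''"
      and dg'': "\<And>v. v \<in> carrier (?F' (Suc (Suc j))) \<Longrightarrow> d (Suc j) (g'' v) = g' (d' (Suc j) v)"
    proof (rule linear_map_factor[OF module_free module_free ld linear_map_comp[OF g' ld']])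
      show "g' (d' (Suc j) (std_vec R (r' (Suc (Suc j))) k)) \<in> d (Suc j) ` carrier (?F (Suc (Suc j)))" for k
        by (rule exk) (simp_all add: dg[symmetric] free_exact_complex[OF ex(2)] linear_map_free_simps[OF g])
    qed blast
    \<comment> \<open>By the induction hypothesis \<open>g' f' - 1 - h d\<close> takes values in the
      kernel of \<open>d j\<close>; the next homotopy is a lift of it.\<close>
    have lint: "linear_map R (?F (Suc j)) (?F (Suc j))
        (\<lambda>v. g' (f' v) \<ominus>\<^bsub>?F (Suc j)\<^esub> v \<ominus>\<^bsub>?F (Suc j)\<^esub> h (d j v))"
      by (intro linear_map_diff module_free linear_map_comp[OF g' f'] linear_map_id linear_map_comp[OF h ld])
    obtain h' where h': "linear_map R (?F (Suc j)) (?F (Suc (Suc j))) h'"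
      and dh': "\<And>v. v \<in> carrier (?F (Suc j)) \<Longrightarrow>
        d (Suc j) (h' v) = g' (f' v) \<ominus>\<^bsub>?F (Suc j)\<^esub> v \<ominus>\<^bsub>?F (Suc j)\<^esub> h (d j v)"
    proof (rule linear_map_factor[OF module_free module_free ld lint])
      fix k
      let ?e = "std_vec R (r (Suc j)) k"
      show "g' (f' ?e) \<ominus>\<^bsub>?F (Suc j)\<^esub> ?e \<ominus>\<^bsub>?F (Suc j)\<^esub> h (d j ?e) \<in> d (Suc j) ` carrier (?F (Suc (Suc j)))"
        by (rule exk) (simp_all add: linear_map_free_simps[OF ld] dg[symmetric] df[symmetric] dh F.minus_eq_zero_iff)
    qed blast
    show ?case
    proof (intro exI conjI; (rule f' f'' g' g'' h')?)
      show "\<forall>v\<in>carrier (?F (Suc (Suc j))). d (Suc j) (h' (d (Suc j) v)) =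
          g' (f' (d (Suc j) v)) \<ominus>\<^bsub>?F (Suc j)\<^esub> d (Suc j) v"
        by (simp add: dh' free_exact_complex[OF ex(1)] linear_map_free_simps[OF h] F.M.minus_eq F.neg_zero)
    qed (simp_all add: df'' dg'')
  qed
qed

section \<open>Annihilators of cohomology and of Ext\<close>

context
  fixes N :: "('a, 'n, 'x) module_scheme" and r d
  assumes N: "module R N"
    and lin: "\<And>j. linear_map R (free_module R (r (Suc j))) (free_module R (r j)) (d j)"
    and cpx: "\<And>j v. v \<in> carrier (free_module R (r (Suc (Suc j)))) \<Longrightarrow>
      d j (d (Suc j) v) = \<zero>\<^bsub>free_module R (r j)\<^esub>"
begin

interpretation N: module R N by (rule N)

lemma submodule_cocycles:
  "submodule (ext_cocycles R r d N i) R (hom_module R (free_module R (r i)) N)"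
proof -
  let ?H = "hom_module R (free_module R (r i)) N"
  interpret H: module R ?H by (rule module_hom_module[OF module_free N])
  note [simp] = linear_map_closed[OF lin]
  have c: "carrier ?H = module_homs R (free_module R (r i)) N" by (simp add: hom_module_def)
  have neg: "(\<ominus>\<^bsub>?H\<^esub> h) x = \<ominus>\<^bsub>N\<^esub> h x" if h: "h \<in> carrier ?H" and x: "x \<in> carrier (free_module R (r i))" for h x
  proof -
    have hx: "g x \<in> carrier N" if "g \<in> carrier ?H" for g
      using that x by (simp add: c module_homs_iff linear_map_def Pi_iff)
    have "(\<ominus>\<^bsub>?H\<^esub> h \<oplus>\<^bsub>?H\<^esub> h) x = \<zero>\<^bsub>N\<^esub>"
      unfolding H.M.l_neg[OF h] using x by (simp add: hom_module_def)
    then have "(\<ominus>\<^bsub>?H\<^esub> h) x \<oplus>\<^bsub>N\<^esub> h x = \<zero>\<^bsub>N\<^esub>" using x by (simp add: hom_module_def)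
    then show ?thesis
      by (rule N.M.minus_equality[symmetric, OF _ hx[OF h] hx[OF H.M.a_inv_closed[OF h]]])
  qed
  have mem: "h \<in> ext_cocycles R r d N i \<longleftrightarrow> h \<in> carrier ?H \<and>
      (\<forall>v\<in>carrier (free_module R (r (Suc i))). h (d i v) = \<zero>\<^bsub>N\<^esub>)" for h
    by (simp add: ext_cocycles_def c)
  have app: "(g \<oplus>\<^bsub>?H\<^esub> h) x = g x \<oplus>\<^bsub>N\<^esub> h x" "(a \<odot>\<^bsub>?H\<^esub> h) x = a \<odot>\<^bsub>N\<^esub> h x" "\<zero>\<^bsub>?H\<^esub> x = \<zero>\<^bsub>N\<^esub>"
    if "x \<in> carrier (free_module R (r i))" for g h a x
    using that by (simp_all add: hom_module_def)
  show ?thesis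
    by (rule H.submoduleI) (auto simp: mem app neg N.neg_zero)
qed

lemma submodule_coboundaries:
  "submodule (ext_coboundaries R r d N i) R
    (hom_module R (free_module R (r i)) N \<lparr>carrier := ext_cocycles R r d N i\<rparr>)"
proof -
  let ?H = "\<lambda>i. hom_module R (free_module R (r i)) N"
  have H: "module R (?H i)" for i by (rule module_hom_module[OF module_free N])
  let ?Z = "?H i \<lparr>carrier := ext_cocycles R r d N i\<rparr>"
  have Z: "module R ?Z"
    by (rule submodule.submodule_is_module[OF submodule_cocycles H])
  note [simp] = linear_map_closed[OF lin]
  show ?thesis
  proof (cases i)
    case 0
    have "ext_coboundaries R r d N i = {\<zero>\<^bsub>?Z\<^esub>}"
      by (simp add: ext_coboundaries_def 0 hom_module_def)
    then show ?thesis using submodule_zero[OF Z] by simp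
  next
    case (Suc j)
    let ?F = "\<lambda>j. free_module R (r j)"
    let ?c = "\<lambda>h. compose (carrier (?F (Suc j))) h (d j)"
    have hl: "linear_map R (?F j) N h" if "h \<in> carrier (?H j)" for h
      using that by (simp add: hom_module_def module_homs_iff)
    have "linear_map R (?H j) ?Z ?c"
    proof (rule linear_mapI)
      fix h assume h: "h \<in> carrier (?H j)"
      have "?c h \<in> module_homs R (?F (Suc j)) N"
        using restrict_in_module_homs[OF module_free linear_map_comp[OF hl[OF h] lin[of j]]]
        by (simp add: compose_def)
      then show "?c h \<in> carrier ?Z"
        using linear_map_zero[OF module_free N hl[OF h]]
        by (simp add: Suc ext_cocycles_def compose_def cpx)
    next
      fix g h assume "g \<in> carrier (?H j)" "h \<in> carrier (?H j)"
      then show "?c (g \<oplus>\<^bsub>?H j\<^esub> h) = ?c g \<oplus>\<^bsub>?Z\<^esub> ?c h"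
        by (simp add: hom_module_def Suc compose_def restrict_def fun_eq_iff)
    next
      fix a h assume "a \<in> carrier R" "h \<in> carrier (?H j)"
      then show "?c (a \<odot>\<^bsub>?H j\<^esub> h) = a \<odot>\<^bsub>?Z\<^esub> ?c h"
        by (simp add: hom_module_def Suc compose_def restrict_def fun_eq_iff)
    qed
    from submodule_image[OF H Z this] show ?thesis
      by (simp add: Suc ext_coboundaries_def hom_module_def)
  qed
qed

lemma module_ann_cohomology:
  "a \<in> module_ann R (quotient_module
      (hom_module R (free_module R (r i)) N \<lparr>carrier := ext_cocycles R r d N i\<rparr>)
      (ext_coboundaries R r d N i)) \<longleftrightarrow>
    a \<in> carrier R \<and> (\<forall>h\<in>ext_cocycles R r d N i.
      (\<lambda>v\<in>carrier (free_module R (r i)). a \<odot>\<^bsub>N\<^esub> h v) \<in> ext_coboundaries R r d N i)"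
proof -
  let ?H = "hom_module R (free_module R (r i)) N"
  let ?Z = "?H \<lparr>carrier := ext_cocycles R r d N i\<rparr>"
  have Z: "module R ?Z"
    by (rule submodule.submodule_is_module[OF submodule_cocycles module_hom_module[OF module_free N]])
  interpret Z: module R ?Z by (rule Z)
  interpret Q: quotient_of_module R ?Z "ext_coboundaries R r d N i"
    by (rule quotient_of_moduleI[OF Z submodule_coboundaries])
  have s: "a \<odot>\<^bsub>?Z\<^esub> h = (\<lambda>v\<in>carrier (free_module R (r i)). a \<odot>\<^bsub>N\<^esub> h v)" for h
    by (simp add: hom_module_def)
  have "a \<odot>\<^bsub>quotient_module ?Z (ext_coboundaries R r d N i)\<^esub> Q.proj h =
      \<zero>\<^bsub>quotient_module ?Z (ext_coboundaries R r d N i)\<^esub> \<longleftrightarrow> a \<odot>\<^bsub>?Z\<^esub> h \<in> ext_coboundaries R r d N i"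
    if "a \<in> carrier R" "h \<in> carrier ?Z" for h
    using that Q.proj_zero_iff[OF Z.smult_closed[OF that]] by (simp only: Q.quotient_smult)
  then show ?thesis
    unfolding module_ann_def Q.quotient_carrier s[symmetric] by auto
qed

end

text \<open>Of the resolution picked by \<open>SOME\<close> nothing but
  \<open>free_resolution\<close> is known, so it is handed out as obtained, with a criterion for all
  \<open>i\<close> and all \<open>N\<close> at once.\<close>

lemma module_ann_Ext:
  assumes fg: "fg_submodules R" and M: "module R M" "finitely_generated_module R M"
  obtains r d e where "free_resolution R M r d e"
    "\<And>i (N :: ('a, 'n, 'x) module_scheme) a. module R N \<Longrightarrow> a \<in> module_ann R (Ext R i M N) \<longleftrightarrow>
      a \<in> carrier R \<and> (\<forall>h\<in>ext_cocycles R r d N i.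
      (\<lambda>v\<in>carrier (free_module R (r i)). a \<odot>\<^bsub>N\<^esub> h v) \<in> ext_coboundaries R r d N i)"
proof -
  let ?P = "\<lambda>(r, d, e). free_resolution R M r d e"
  obtain r d e where rde: "(SOME x. ?P x) = (r, d, e)" by (metis prod_cases3)
  have "\<exists>x. ?P x" using free_resolution_exists[OF fg M] by (metis case_prodI)
  then have res: "free_resolution R M r d e" using someI_ex[of ?P] unfolding rde by simp
  have ex: "free_exact R r d" using resolves_of_free_resolution[OF res] by (simp add: resolves_def)
  have "a \<in> module_ann R (Ext R i M N) \<longleftrightarrow> a \<in> carrier R \<and> (\<forall>h\<in>ext_cocycles R r d N i.
      (\<lambda>v\<in>carrier (free_module R (r i)). a \<odot>\<^bsub>N\<^esub> h v) \<in> ext_coboundaries R r d N i)"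
    if "module R N" for i a and N :: "('a, 'n, 'x) module_scheme"
    unfolding Ext_def rde Let_def prod.case
    using module_ann_cohomology[of N r d a i, OF that] free_exact_linear[OF ex] free_exact_complex[OF ex]
    by simp
  then show ?thesis using that res by blast
qed

text \<open>For a homotopy \<open>s\<close>, the vector \<open>s (d v) - a v\<close> is a cycle,
  hence a boundary, and a cocycle \<open>h\<close> vanishes on it. So \<open>a h = h s d\<close> is
  the coboundary of \<open>h s\<close>.\<close>

lemma syzygy_ann_subset_coh_ann:
  assumes fg: "fg_submodules R"
  shows "syzygy_ann R l \<subseteq> coh_ann_at R (Suc l)"
proof
  fix a assume a: "a \<in> syzygy_ann R l"
  have ac [simp]: "a \<in> carrier R" using syzygy_ann_closed[OF a] .
  have "a \<in> module_ann R (Ext R (Suc l) M N)"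
    if M: "finitely_generated_module R M" and N: "finitely_generated_module R N"
    for M N :: "('a, (nat \<Rightarrow> 'a) set) module"
  proof -
    have mM: "module R M" and mN: "module R N" using M N by (simp_all add: finitely_generated_module_def)
    obtain r d e where res: "free_resolution R M r d e" and
      ann: "\<And>i (N :: ('a, (nat \<Rightarrow> 'a) set) module) a. module R N \<Longrightarrow> a \<in> module_ann R (Ext R i M N) \<longleftrightarrow>
      a \<in> carrier R \<and> (\<forall>h\<in>ext_cocycles R r d N i.
      (\<lambda>v\<in>carrier (free_module R (r i)). a \<odot>\<^bsub>N\<^esub> h v) \<in> ext_coboundaries R r d N i)"
      by (rule module_ann_Ext[OF fg mM M]) blast
    have ex: "free_exact R r d" using resolves_of_free_resolution[OF res] by (simp add: resolves_def)
    let ?F = "\<lambda>j. free_module R (r j)"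
    obtain s where s: "linear_map R (?F l) (?F (Suc l)) s"
      and ds: "\<And>v. v \<in> carrier (?F (Suc l)) \<Longrightarrow> d l (s (d l v)) = a \<odot>\<^bsub>?F l\<^esub> d l v"
      by (rule syzygy_annE[OF a ex]) blast
    note dl = free_exact_linear[OF ex, of l]
    note [simp] = linear_map_closed[OF s] linear_map_closed[OF dl]
    have "(\<lambda>v\<in>carrier (?F (Suc l)). a \<odot>\<^bsub>N\<^esub> h v) \<in> ext_coboundaries R r d N (Suc l)"
      if h: "h \<in> ext_cocycles R r d N (Suc l)" for h
    proof -
      have hl: "linear_map R (?F (Suc l)) N h"
        and hd: "\<And>v. v \<in> carrier (?F (Suc (Suc l))) \<Longrightarrow> h (d (Suc l) v) = \<zero>\<^bsub>N\<^esub>"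
        using h by (simp_all add: ext_cocycles_def module_homs_iff)
      interpret N: module R N by (rule mN)
      let ?g = "restrict (\<lambda>w. h (s w)) (carrier (?F l))"
      have g: "?g \<in> module_homs R (?F l) N"
        by (rule restrict_in_module_homs[OF module_free linear_map_comp[OF hl s]])
      have "h (s (d l v)) = a \<odot>\<^bsub>N\<^esub> h v" if v [simp]: "v \<in> carrier (?F (Suc l))" for v
      proof -
        have "d l (s (d l v) \<ominus>\<^bsub>?F (Suc l)\<^esub> a \<odot>\<^bsub>?F (Suc l)\<^esub> v) = \<zero>\<^bsub>?F l\<^esub>"
          by (simp add: linear_map_free_simps[OF dl] ds F.minus_eq_zero_iff)
        then obtain w where "w \<in> carrier (?F (Suc (Suc l)))"
          "s (d l v) \<ominus>\<^bsub>?F (Suc l)\<^esub> a \<odot>\<^bsub>?F (Suc l)\<^esub> v = d (Suc l) w"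
          by (rule free_exact_lift[OF ex, rotated]) simp_all
        then have "h (s (d l v) \<ominus>\<^bsub>?F (Suc l)\<^esub> a \<odot>\<^bsub>?F (Suc l)\<^esub> v) = \<zero>\<^bsub>N\<^esub>" using hd by simp
        then show ?thesis
          using linear_map_closed[OF hl]
          by (simp add: linear_map_minus[OF module_free mN hl] linear_map_smult[OF hl] N.minus_eq_zero_iff)
      qed
      then have "(\<lambda>v\<in>carrier (?F (Suc l)). a \<odot>\<^bsub>N\<^esub> h v) = compose (carrier (?F (Suc l))) ?g (d l)"
        by (simp add: compose_def restrict_def fun_eq_iff)
      then show ?thesis using g by (auto simp: ext_coboundaries_def)
    qed
    then show ?thesis unfolding ann[OF mN] by simp
  qed
  then show "a \<in> coh_ann_at R (Suc l)" unfolding coh_ann_at_def by simp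
qed

text \<open>All test modules are cokernels of maps of finite free modules, so they live in the type
  over which \<open>coh_ann_at\<close> quantifies. The truncated \<open>i - 1\<close> puts degree
  \<open>0\<close> together with degree \<open>1\<close>.\<close>

lemma coh_ann_at_subset_syzygy_ann:
  assumes fg: "fg_submodules R" and a: "a \<in> coh_ann_at R i"
  shows "a \<in> syzygy_ann R (i - 1)"
proof (rule syzygy_annI)
  show ac [simp]: "a \<in> carrier R" using a by (simp add: coh_ann_at_def)
  have ann: "a \<in> module_ann R (Ext R i M N)"
    if "finitely_generated_module R M" "finitely_generated_module R N"
    for M N :: "('a, (nat \<Rightarrow> 'a) set) module"
    using a that unfolding coh_ann_at_def by blast
  fix r d assume ex: "free_exact R r d"
  let ?F = "\<lambda>j. free_module R (r j)"
  note ld = free_exact_linear[OF ex]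
  note [simp] = linear_map_closed[OF ld]
  show "\<exists>s. linear_map R (?F (i - 1)) (?F (Suc (i - 1))) s \<and>
    (\<forall>v\<in>carrier (?F (Suc (i - 1))). d (i - 1) (s (d (i - 1) v)) = a \<odot>\<^bsub>?F (i - 1)\<^esub> d (i - 1) v)"
  proof (cases i)
    case 0
    \<comment> \<open>Degree 0: the cocycle \<open>e'\<close> is the identity of the cokernel
      \<open>M\<close> of \<open>d 1\<close>, so \<open>a\<close> kills \<open>M\<close>. As
      \<open>M\<close> is isomorphic to the image of \<open>d 0\<close>, this gives
      \<open>a d 0 = 0\<close>, and \<open>s = 0\<close> is a homotopy.\<close>
    let ?U = "d 1 ` carrier (?F 2)"
    have U: "submodule ?U R (?F 1)"
      using submodule_image[OF module_free module_free ld[of 1]] by (simp add: numeral_2_eq_2)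
    let ?M = "quotient_module (?F 1) ?U"
    interpret Q: quotient_of_module R "?F 1" ?U by (rule quotient_of_moduleI[OF module_free U])
    interpret M: module R ?M by (rule Q.module_quotient)
    have fgM: "finitely_generated_module R ?M" by (rule finitely_generated_quotient[OF U])
    obtain r' d' e' where res: "free_resolution R ?M r' d' e'" and
      ann': "\<And>i (N :: ('a, (nat \<Rightarrow> 'a) set) module) a. module R N \<Longrightarrow> a \<in> module_ann R (Ext R i ?M N) \<longleftrightarrow>
      a \<in> carrier R \<and> (\<forall>h\<in>ext_cocycles R r' d' N i.
      (\<lambda>v\<in>carrier (free_module R (r' i)). a \<odot>\<^bsub>N\<^esub> h v) \<in> ext_coboundaries R r' d' N i)"
      by (rule module_ann_Ext[OF fg Q.module_quotient fgM]) blast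
    have e': "e' \<in> module_homs R (free_module R (r' 0)) ?M"
      "e' ` carrier (free_module R (r' 0)) = carrier ?M"
      "d' 0 ` carrier (free_module R (r' 1)) = a_kernel (free_module R (r' 0)) ?M e'"
      using res by (simp_all add: free_resolution_def)
    have "e' \<in> ext_cocycles R r' d' ?M 0"
      using e'(1,3) by (auto simp: ext_cocycles_def a_kernel_def')
    then have eq: "(\<lambda>v\<in>carrier (free_module R (r' 0)). a \<odot>\<^bsub>?M\<^esub> e' v) =
        (\<lambda>v\<in>carrier (free_module R (r' 0)). \<zero>\<^bsub>?M\<^esub>)"
      using ann[OF fgM fgM] ann'[OF Q.module_quotient, of a i] 0 by (auto simp: ext_coboundaries_def)
    have ae: "a \<odot>\<^bsub>?M\<^esub> e' v = \<zero>\<^bsub>?M\<^esub>" if "v \<in> carrier (free_module R (r' 0))" for v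
      using fun_cong[OF eq, of v] that by simp
    have aM: "a \<odot>\<^bsub>?M\<^esub> m = \<zero>\<^bsub>?M\<^esub>" if "m \<in> carrier ?M" for m
    proof -
      have "m \<in> e' ` carrier (free_module R (r' 0))" using that e'(2) by simp
      then show ?thesis using ae by blast
    qed
    have "a \<odot>\<^bsub>?F 0\<^esub> d 0 v = \<zero>\<^bsub>?F 0\<^esub>" if v: "v \<in> carrier (?F (Suc 0))" for v
    proof -
      have v1: "v \<in> carrier (?F 1)" using v by simp
      have "Q.proj (a \<odot>\<^bsub>?F 1\<^esub> v) = \<zero>\<^bsub>?M\<^esub>"
        using aM[of "Q.proj v"] v1 unfolding Q.quotient_smult[OF ac v1] Q.quotient_carrier by blast
      then have "a \<odot>\<^bsub>?F 1\<^esub> v \<in> ?U" using Q.proj_zero_iff[of "a \<odot>\<^bsub>?F 1\<^esub> v"] v1 ac F.smult_closed by blast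
      then obtain w where w: "w \<in> carrier (?F (Suc (Suc 0)))" "a \<odot>\<^bsub>?F (Suc 0)\<^esub> v = d (Suc 0) w"
        by (auto simp: numeral_2_eq_2)
      have "a \<odot>\<^bsub>?F 0\<^esub> d 0 v = d 0 (d (Suc 0) w)"
        using v by (simp add: w(2)[symmetric] linear_map_smult[OF ld])
      then show ?thesis using free_exact_complex[OF ex w(1)] by simp
    qed
    moreover have "d 0 \<zero>\<^bsub>?F (Suc 0)\<^esub> = \<zero>\<^bsub>?F 0\<^esub>" by (rule linear_map_zero[OF module_free module_free ld])
    ultimately show ?thesis
      using 0 by (intro exI[of _ "\<lambda>_. \<zero>\<^bsub>?F (Suc 0)\<^esub>"]) (simp add: linear_map_0[OF module_free])
  next
    case (Suc l)
    let ?U = "d 0 ` carrier (?F (Suc 0))"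
    have U: "submodule ?U R (?F 0)" by (rule submodule_image[OF module_free module_free ld])
    let ?M = "quotient_module (?F 0) ?U"
    interpret Q: quotient_of_module R "?F 0" ?U by (rule quotient_of_moduleI[OF module_free U])
    have fgM: "finitely_generated_module R ?M" by (rule finitely_generated_quotient[OF U])
    have res: "resolves ?M r d Q.proj"
      unfolding resolves_def using ex Q.proj_linear Q.proj_zero_iff by (simp add: Q.quotient_carrier)
    obtain r' d' e' where "free_resolution R ?M r' d' e'" and
      ann': "\<And>i (N :: ('a, (nat \<Rightarrow> 'a) set) module) a. module R N \<Longrightarrow> a \<in> module_ann R (Ext R i ?M N) \<longleftrightarrow>
      a \<in> carrier R \<and> (\<forall>h\<in>ext_cocycles R r' d' N i.
      (\<lambda>v\<in>carrier (free_module R (r' i)). a \<odot>\<^bsub>N\<^esub> h v) \<in> ext_coboundaries R r' d' N i)"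
      by (rule module_ann_Ext[OF fg Q.module_quotient fgM]) blast
    then have res': "resolves ?M r' d' e'" by (rule_tac resolves_of_free_resolution)
    then have ex': "free_exact R r' d'" by (simp add: resolves_def)
    let ?F' = "\<lambda>j. free_module R (r' j)"
    note ld' = free_exact_linear[OF ex']
    note [simp] = linear_map_closed[OF ld']
    let ?V = "d' (Suc l) ` carrier (?F' (Suc (Suc l)))"
    have V: "submodule ?V R (?F' (Suc l))" by (rule submodule_image[OF module_free module_free ld'])
    let ?N = "quotient_module (?F' (Suc l)) ?V"
    interpret C: quotient_of_module R "?F' (Suc l)" ?V by (rule quotient_of_moduleI[OF module_free V])
    have fgN: "finitely_generated_module R ?N" by (rule finitely_generated_quotient[OF V])
    \<comment> \<open>The universal cocycle. That \<open>a\<close> kills its class yields a homotopy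
      \<open>s'\<close> for the chosen resolution \<open>d'\<close>, still to be moved to
      \<open>d\<close>.\<close>
    let ?h = "restrict C.proj (carrier (?F' (Suc l)))"
    have "?h \<in> ext_cocycles R r' d' ?N (Suc l)"
      using restrict_in_module_homs[OF module_free C.proj_linear] C.proj_zero_iff
      by (simp add: ext_cocycles_def)
    then have "(\<lambda>v\<in>carrier (?F' (Suc l)). a \<odot>\<^bsub>?N\<^esub> ?h v) \<in> ext_coboundaries R r' d' ?N (Suc l)"
      using ann[OF fgM fgN] ann'[OF C.module_quotient, of a i] Suc by auto
    then obtain g where g: "g \<in> module_homs R (?F' l) ?N"
      "(\<lambda>v\<in>carrier (?F' (Suc l)). a \<odot>\<^bsub>?N\<^esub> ?h v) = compose (carrier (?F' (Suc l))) g (d' l)"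
      by (auto simp: ext_coboundaries_def)
    have gd: "g (d' l v) = a \<odot>\<^bsub>?N\<^esub> C.proj v" if "v \<in> carrier (?F' (Suc l))" for v
      using fun_cong[OF g(2), of v] that by (simp add: compose_def)
    have gl: "linear_map R (?F' l) ?N g" using g(1) by (simp add: module_homs_iff)
    obtain s' where s': "linear_map R (?F' l) (?F' (Suc l)) s'"
      and ps: "\<And>w. w \<in> carrier (?F' l) \<Longrightarrow> C.proj (s' w) = g w"
      by (rule linear_map_factor[OF module_free C.module_quotient C.proj_linear gl])
        (use linear_map_closed[OF gl] in \<open>auto simp: C.quotient_carrier\<close>)
    note [simp] = linear_map_closed[OF s']
    have ds': "d' l (s' (d' l v)) = a \<odot>\<^bsub>?F' l\<^esub> d' l v" if v [simp]: "v \<in> carrier (?F' (Suc l))" for v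
    proof -
      have "C.proj (s' (d' l v)) = C.proj (a \<odot>\<^bsub>?F' (Suc l)\<^esub> v)"
        by (simp add: ps gd C.quotient_smult)
      then have "s' (d' l v) \<ominus>\<^bsub>?F' (Suc l)\<^esub> a \<odot>\<^bsub>?F' (Suc l)\<^esub> v \<in> ?V"
        by (subst (asm) C.proj_eq_iff) simp_all
      then obtain w where w: "w \<in> carrier (?F' (Suc (Suc l)))"
        "s' (d' l v) \<ominus>\<^bsub>?F' (Suc l)\<^esub> a \<odot>\<^bsub>?F' (Suc l)\<^esub> v = d' (Suc l) w" by blast
      have "d' l (s' (d' l v) \<ominus>\<^bsub>?F' (Suc l)\<^esub> a \<odot>\<^bsub>?F' (Suc l)\<^esub> v) = \<zero>\<^bsub>?F' l\<^esub>"
        unfolding w(2) by (rule free_exact_complex[OF ex' w(1)])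
      then show ?thesis
        by (simp add: linear_map_free_simps[OF ld'] F.minus_eq_zero_iff)
    qed
    obtain f f' g g' h where
      f: "linear_map R (?F l) (?F' l) f" and f': "linear_map R (?F (Suc l)) (?F' (Suc l)) f'" and
      g: "linear_map R (?F' l) (?F l) g" and g': "linear_map R (?F' (Suc l)) (?F (Suc l)) g'" and
      h: "linear_map R (?F l) (?F (Suc l)) h" and
      df: "\<And>v. v \<in> carrier (?F (Suc l)) \<Longrightarrow> f (d l v) = d' l (f' v)" and
      dg: "\<And>v. v \<in> carrier (?F' (Suc l)) \<Longrightarrow> g (d' l v) = d l (g' v)" and
      dh: "\<And>v. v \<in> carrier (?F (Suc l)) \<Longrightarrow> d l (h (d l v)) = g (f (d l v)) \<ominus>\<^bsub>?F l\<^esub> d l v"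
      using compare_resolutions[OF Q.module_quotient res res', of l] by blast
    note [simp] = linear_map_closed[OF f'] linear_map_closed[OF g'] linear_map_closed[OF h]
      linear_map_closed[OF f] linear_map_closed[OF g]
    \<comment> \<open>Transported by the comparison maps, \<open>s'\<close> gives
      \<open>a g f\<close> in place of \<open>a\<close> on the image of \<open>d l\<close>;
      subtracting \<open>a h\<close> corrects the difference.\<close>
    let ?s = "\<lambda>w. g' (s' (f w)) \<ominus>\<^bsub>?F (Suc l)\<^esub> a \<odot>\<^bsub>?F (Suc l)\<^esub> h w"
    have "linear_map R (?F l) (?F (Suc l)) ?s"
      by (intro linear_map_diff linear_map_scale module_free h ac
          linear_map_comp[OF g'] linear_map_comp[OF s'] f)
    moreover have "d l (?s (d l v)) = a \<odot>\<^bsub>?F l\<^esub> d l v" if v [simp]: "v \<in> carrier (?F (Suc l))" for v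
    proof -
      have "d l (g' (s' (f (d l v)))) = g (d' l (s' (d' l (f' v))))"
        by (simp add: df dg)
      also have "\<dots> = a \<odot>\<^bsub>?F l\<^esub> g (f (d l v))"
        by (simp add: ds' df linear_map_smult[OF g])
      finally have "d l (?s (d l v)) =
          a \<odot>\<^bsub>?F l\<^esub> g (f (d l v)) \<ominus>\<^bsub>?F l\<^esub> (a \<odot>\<^bsub>?F l\<^esub> g (f (d l v)) \<ominus>\<^bsub>?F l\<^esub> a \<odot>\<^bsub>?F l\<^esub> d l v)"
        by (simp add: linear_map_free_simps[OF ld] dh F.smult_r_diff)
      then show ?thesis by (simp add: F.minus_minus_cancel)
    qed
    ultimately show ?thesis using Suc by (intro exI[of _ ?s]) simp
  qed
qed

text \<open>The shifts \<open>l + 1\<close> and \<open>i - 1\<close> of the two inclusions disappear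
  in the union over all degrees.\<close>

lemma coh_ann_eq:
  assumes "fg_submodules R"
  shows "coh_ann R = (\<Union>l. syzygy_ann R l)"
  using syzygy_ann_subset_coh_ann[OF assms] coh_ann_at_subset_syzygy_ann[OF assms]
  unfolding coh_ann_def by blast

end

section \<open>Formal power series\<close>

lemma finite_submultisets: "finite {u. u \<subseteq># m}"
proof (induction m)
  case (add x m)
  have "{u. u \<subseteq># add_mset x m} \<subseteq> {u. u \<subseteq># m} \<union> add_mset x ` {u. u \<subseteq># m}"
  proof
    fix u assume u: "u \<in> {u. u \<subseteq># add_mset x m}"
    show "u \<in> {u. u \<subseteq># m} \<union> add_mset x ` {u. u \<subseteq># m}"
    proof (cases "x \<in># u")
      case True
      then obtain v where "u = add_mset x v" by (metis insert_DiffM)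
      then show ?thesis using u by simp
    next
      case False
      then have "u \<subseteq># m"
        using u by (metis Diff_eq_empty_iff_mset add_mset_remove_trivial diff_diff_add_mset
            diff_single_trivial minus_add_mset_if_not_in_lhs subset_eq_diff_conv mem_Collect_eq
            add_mset_add_single)
      then show ?thesis by blast
    qed
  qed
  then show ?case using add finite_subset by blast
qed simp

section \<open>The ring structure on power series\<close>

context cring
begin

lemma nat_mult_finsum:
  "finite B \<Longrightarrow> (\<And>u. u \<in> B \<Longrightarrow> g u \<in> carrier R) \<Longrightarrow>
    add_pow R (k::nat) (\<Oplus>u\<in>B. g u) = (\<Oplus>u\<in>B. add_pow R k (g u))"
  by (induction B rule: finite_induct) (auto simp: Pi_def add.nat_pow_distrib)

lemma ps_carrier: "p \<in> carrier (power_series_ring R I) \<longleftrightarrow>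
    (\<forall>m. p m \<in> carrier R) \<and> (\<forall>m. \<not> set_mset m \<subseteq> I \<longrightarrow> p m = \<zero>)"
  and ps_mult: "(p \<otimes>\<^bsub>power_series_ring R I\<^esub> q) m = (\<Oplus>u\<in>{u. u \<subseteq># m}. p u \<otimes> q (m - u))"
  and ps_one: "\<one>\<^bsub>power_series_ring R I\<^esub> m = (if m = {#} then \<one> else \<zero>)"
  and ps_zero: "\<zero>\<^bsub>power_series_ring R I\<^esub> m = \<zero>"
  and ps_add: "(p \<oplus>\<^bsub>power_series_ring R I\<^esub> q) m = p m \<oplus> q m"
  by (simp_all add: power_series_ring_def indexed_const_def)

lemma ps_closed: "p \<in> carrier (power_series_ring R I) \<Longrightarrow> p m \<in> carrier R"
  by (simp add: ps_carrier)

lemma finsum_submultisets_single: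
  assumes "v \<subseteq># m" "g v \<in> carrier R" "\<And>u. u \<subseteq># m \<Longrightarrow> u \<noteq> v \<Longrightarrow> g u = \<zero>"
  shows "(\<Oplus>u\<in>{u. u \<subseteq># m}. g u) = g v"
proof -
  have "(\<Oplus>u\<in>{u. u \<subseteq># m}. g u) = (\<Oplus>u\<in>{u. u \<subseteq># m}. if v = u then g v else \<zero>)"
    using assms by (intro finsum_cong') auto
  also have "\<dots> = g v"
    using add.finprod_singleton[of v "{u. u \<subseteq># m}" "\<lambda>_. g v"] assms(1,2)
    by (simp add: finite_submultisets)
  finally show ?thesis .
qed

lemma finsum_submultisets_zero:
  "(\<And>u. u \<subseteq># m \<Longrightarrow> g u = \<zero>) \<Longrightarrow> (\<Oplus>u\<in>{u. u \<subseteq># m}. g u) = \<zero>"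
  by (rule add.finprod_one_eqI) simp

lemma finsum_submultisets_swap:
  assumes "\<And>u. u \<subseteq># m \<Longrightarrow> g u \<in> carrier R"
  shows "(\<Oplus>u\<in>{u. u \<subseteq># m}. g (m - u)) = (\<Oplus>u\<in>{u. u \<subseteq># m}. g u)"
proof -
  have im: "(\<lambda>u. m - u) ` {u. u \<subseteq># m} = {u. u \<subseteq># m}"
  proof (intro equalityI subsetI)
    fix u assume "u \<in> {u. u \<subseteq># m}"
    then have "u = m - (m - u)" "m - u \<subseteq># m"
      by (simp_all add: subset_mset.diff_diff_right)
    then show "u \<in> (\<lambda>u. m - u) ` {u. u \<subseteq># m}" by blast
  qed auto
  have inj: "inj_on (\<lambda>u. m - u) {u. u \<subseteq># m}"
    by (rule inj_onI) (metis mem_Collect_eq subset_mset.add_diff_inverse add_right_imp_eq diff_subset_eq_self)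
  show ?thesis
    using finsum_reindex[of g "\<lambda>u. m - u" "{u. u \<subseteq># m}"] inj assms unfolding im by auto
qed

text \<open>Both sides sum \<open>F\<close> over the pairs \<open>(v, w)\<close> with
  \<open>v + w\<close> contained in \<open>m\<close>, grouped by \<open>v + w\<close> on the left
  and by \<open>v\<close> on the right.\<close>

lemma finsum_submultisets_assoc:
  assumes F: "\<And>v w. F v w \<in> carrier R"
  shows "(\<Oplus>u\<in>{u. u \<subseteq># m}. \<Oplus>v\<in>{v. v \<subseteq># u}. F v (u - v)) =
    (\<Oplus>v\<in>{v. v \<subseteq># m}. \<Oplus>w\<in>{w. w \<subseteq># m - v}. F v w)"
proof -
  let ?f = "\<lambda>(v, w). F v w"
  let ?A = "\<lambda>u. (\<lambda>v. (v, u - v)) ` {v. v \<subseteq># u}" and ?B = "\<lambda>v. (\<lambda>w. (v, w)) ` {w. w \<subseteq># m - v}"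
  have A: "finsum R ?f (?A u) = (\<Oplus>v\<in>{v. v \<subseteq># u}. F v (u - v))" for u
    by (subst finsum_reindex) (auto simp: inj_on_def F)
  have B: "finsum R ?f (?B v) = (\<Oplus>w\<in>{w. w \<subseteq># m - v}. F v w)" for v
    by (subst finsum_reindex) (auto simp: inj_on_def F)
  have "(\<Oplus>u\<in>{u. u \<subseteq># m}. \<Oplus>v\<in>{v. v \<subseteq># u}. F v (u - v)) = (\<Oplus>u\<in>{u. u \<subseteq># m}. finsum R ?f (?A u))"
    unfolding A ..
  also have "\<dots> = finsum R ?f (\<Union>(?A ` {u. u \<subseteq># m}))"
    using F by (intro add.finprod_UN_disjoint[symmetric])
      (auto simp: finite_submultisets pairwise_def disjnt_def, metis subset_mset.add_diff_inverse)
  also have "(\<Union>(?A ` {u. u \<subseteq># m})) = (\<Union>(?B ` {v. v \<subseteq># m}))"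
  proof (intro equalityI subsetI)
    fix z assume "z \<in> (\<Union>(?A ` {u. u \<subseteq># m}))"
    then obtain u v where z: "u \<subseteq># m" "v \<subseteq># u" "z = (v, u - v)" by auto
    then have "v \<subseteq># m" "u - v \<subseteq># m - v"
      by (meson subset_mset.order_trans, simp add: subset_eq_diff_conv subset_mset.diff_add)
    then show "z \<in> (\<Union>(?B ` {v. v \<subseteq># m}))" using z(3) by auto
  next
    fix z assume "z \<in> (\<Union>(?B ` {v. v \<subseteq># m}))"
    then obtain v w where z: "v \<subseteq># m" "w \<subseteq># m - v" "z = (v, w)" by auto
    then have "v + w \<subseteq># m"
      by (metis subset_mset.add_left_mono subset_mset.add_diff_inverse)
    moreover have "z = (v, (v + w) - v)" "v \<subseteq># v + w" using z(3) by simp_all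
    ultimately show "z \<in> (\<Union>(?A ` {u. u \<subseteq># m}))" by blast
  qed
  also have "finsum R ?f (\<Union>(?B ` {v. v \<subseteq># m})) = (\<Oplus>v\<in>{v. v \<subseteq># m}. finsum R ?f (?B v))"
    using F by (intro add.finprod_UN_disjoint) (auto simp: finite_submultisets pairwise_def disjnt_def)
  also have "\<dots> = (\<Oplus>v\<in>{v. v \<subseteq># m}. \<Oplus>w\<in>{w. w \<subseteq># m - v}. F v w)"
    unfolding B ..
  finally show ?thesis .
qed

lemma ps_mult_closed:
  assumes p: "p \<in> carrier (power_series_ring R I)" and q: "q \<in> carrier (power_series_ring R I)"
  shows "p \<otimes>\<^bsub>power_series_ring R I\<^esub> q \<in> carrier (power_series_ring R I)"
  unfolding ps_carrier
proof (intro conjI allI impI)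
  show "(p \<otimes>\<^bsub>power_series_ring R I\<^esub> q) m \<in> carrier R" for m
    unfolding ps_mult using ps_closed[OF p] ps_closed[OF q] by (auto intro!: finsum_closed)
  fix m assume m: "\<not> set_mset m \<subseteq> I"
  show "(p \<otimes>\<^bsub>power_series_ring R I\<^esub> q) m = \<zero>"
    unfolding ps_mult
  proof (rule finsum_submultisets_zero)
    fix u assume "u \<subseteq># m"
    then have "set_mset m = set_mset u \<union> set_mset (m - u)"
      by (metis set_mset_union subset_mset.add_diff_inverse)
    then have "\<not> set_mset u \<subseteq> I \<or> \<not> set_mset (m - u) \<subseteq> I" using m by blast
    then show "p u \<otimes> q (m - u) = \<zero>"
      using p q ps_closed[OF p] ps_closed[OF q] unfolding ps_carrier by auto
  qed
qed

lemma ps_mult_comm: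
  assumes p: "p \<in> carrier (power_series_ring R I)" and q: "q \<in> carrier (power_series_ring R I)"
  shows "p \<otimes>\<^bsub>power_series_ring R I\<^esub> q = q \<otimes>\<^bsub>power_series_ring R I\<^esub> p"
proof
  fix m
  note c = ps_closed[OF p] ps_closed[OF q]
  have "(p \<otimes>\<^bsub>power_series_ring R I\<^esub> q) m = (\<Oplus>u\<in>{u. u \<subseteq># m}. p (m - u) \<otimes> q (m - (m - u)))"
    unfolding ps_mult using c by (intro finsum_submultisets_swap[symmetric]) simp
  also have "\<dots> = (\<Oplus>u\<in>{u. u \<subseteq># m}. q u \<otimes> p (m - u))"
    using c by (intro finsum_cong') (auto simp: m_comm subset_mset.diff_diff_right)
  finally show "(p \<otimes>\<^bsub>power_series_ring R I\<^esub> q) m = (q \<otimes>\<^bsub>power_series_ring R I\<^esub> p) m"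
    unfolding ps_mult .
qed

lemma ps_mult_assoc:
  assumes p: "p \<in> carrier (power_series_ring R I)" and q: "q \<in> carrier (power_series_ring R I)"
    and s: "s \<in> carrier (power_series_ring R I)"
  shows "(p \<otimes>\<^bsub>power_series_ring R I\<^esub> q) \<otimes>\<^bsub>power_series_ring R I\<^esub> s =
    p \<otimes>\<^bsub>power_series_ring R I\<^esub> (q \<otimes>\<^bsub>power_series_ring R I\<^esub> s)"
proof
  fix m
  note c [simp] = ps_closed[OF p] ps_closed[OF q] ps_closed[OF s]
  have "((p \<otimes>\<^bsub>power_series_ring R I\<^esub> q) \<otimes>\<^bsub>power_series_ring R I\<^esub> s) m =
      (\<Oplus>u\<in>{u. u \<subseteq># m}. \<Oplus>v\<in>{v. v \<subseteq># u}. p v \<otimes> q (u - v) \<otimes> s (m - (v + (u - v))))"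
    unfolding ps_mult
  proof (rule finsum_cong')
    fix u assume "u \<in> {u. u \<subseteq># m}"
    have "(\<Oplus>v\<in>{v. v \<subseteq># u}. p v \<otimes> q (u - v)) \<otimes> s (m - u) =
        (\<Oplus>v\<in>{v. v \<subseteq># u}. p v \<otimes> q (u - v) \<otimes> s (m - u))"
      by (rule finsum_ldistr) (auto simp: finite_submultisets)
    also have "\<dots> = (\<Oplus>v\<in>{v. v \<subseteq># u}. p v \<otimes> q (u - v) \<otimes> s (m - (v + (u - v))))"
      by (intro finsum_cong') (auto simp: subset_mset.add_diff_inverse)
    finally show "(\<Oplus>v\<in>{v. v \<subseteq># u}. p v \<otimes> q (u - v)) \<otimes> s (m - u) = \<dots>" .
  qed (auto intro!: finsum_closed)
  also have "\<dots> = (\<Oplus>v\<in>{v. v \<subseteq># m}. \<Oplus>w\<in>{w. w \<subseteq># m - v}. p v \<otimes> q w \<otimes> s (m - (v + w)))"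
    by (rule finsum_submultisets_assoc) simp
  also have "\<dots> = (p \<otimes>\<^bsub>power_series_ring R I\<^esub> (q \<otimes>\<^bsub>power_series_ring R I\<^esub> s)) m"
    unfolding ps_mult
  proof (rule finsum_cong')
    fix v assume "v \<in> {v. v \<subseteq># m}"
    have "p v \<otimes> (\<Oplus>w\<in>{w. w \<subseteq># m - v}. q w \<otimes> s (m - v - w)) =
        (\<Oplus>w\<in>{w. w \<subseteq># m - v}. p v \<otimes> (q w \<otimes> s (m - v - w)))"
      by (rule finsum_rdistr) (auto simp: finite_submultisets)
    also have "\<dots> = (\<Oplus>w\<in>{w. w \<subseteq># m - v}. p v \<otimes> q w \<otimes> s (m - (v + w)))"
      by (intro finsum_cong') (auto simp: m_assoc)
    finally show "(\<Oplus>w\<in>{w. w \<subseteq># m - v}. p v \<otimes> q w \<otimes> s (m - (v + w))) =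
        p v \<otimes> (\<Oplus>w\<in>{w. w \<subseteq># m - v}. q w \<otimes> s (m - v - w))" by simp
  qed (auto intro!: finsum_closed)
  finally show "((p \<otimes>\<^bsub>power_series_ring R I\<^esub> q) \<otimes>\<^bsub>power_series_ring R I\<^esub> s) m = \<dots>" .
qed

lemma cring_power_series: "cring (power_series_ring R I)"
proof (rule cringI)
  let ?P = "power_series_ring R I"
  show "abelian_group ?P"
  proof (rule abelian_groupI)
    fix p assume "p \<in> carrier ?P"
    then show "\<exists>q\<in>carrier ?P. q \<oplus>\<^bsub>?P\<^esub> p = \<zero>\<^bsub>?P\<^esub>"
      by (intro bexI[of _ "\<lambda>m. \<ominus> p m"]) (auto simp: ps_carrier ps_add ps_zero l_neg intro!: ext)
  qed (auto simp: ps_carrier ps_add ps_zero a_ac intro!: ext)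
  have one: "\<one>\<^bsub>?P\<^esub> \<in> carrier ?P" by (auto simp: ps_carrier ps_one)
  have l_one: "\<one>\<^bsub>?P\<^esub> \<otimes>\<^bsub>?P\<^esub> p = p" if p: "p \<in> carrier ?P" for p
  proof
    fix m
    have "(\<Oplus>u\<in>{u. u \<subseteq># m}. \<one>\<^bsub>?P\<^esub> u \<otimes> p (m - u)) = \<one>\<^bsub>?P\<^esub> {#} \<otimes> p (m - {#})"
      using ps_closed[OF p] by (intro finsum_submultisets_single) (auto simp: ps_one)
    then show "(\<one>\<^bsub>?P\<^esub> \<otimes>\<^bsub>?P\<^esub> p) m = p m"
      using ps_closed[OF p] by (simp add: ps_mult ps_one)
  qed
  show "comm_monoid ?P"
    by (rule comm_monoidI) (rule ps_mult_closed one ps_mult_assoc l_one ps_mult_comm; assumption)+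
  fix p q s assume pqs: "p \<in> carrier ?P" "q \<in> carrier ?P" "s \<in> carrier ?P"
  show "(p \<oplus>\<^bsub>?P\<^esub> q) \<otimes>\<^bsub>?P\<^esub> s = p \<otimes>\<^bsub>?P\<^esub> s \<oplus>\<^bsub>?P\<^esub> q \<otimes>\<^bsub>?P\<^esub> s"
  proof
    fix m
    note [simp] = pqs[THEN ps_closed]
    have "((p \<oplus>\<^bsub>?P\<^esub> q) \<otimes>\<^bsub>?P\<^esub> s) m = (\<Oplus>u\<in>{u. u \<subseteq># m}. p u \<otimes> s (m - u) \<oplus> q u \<otimes> s (m - u))"
      unfolding ps_mult ps_add by (intro finsum_cong') (auto simp: l_distr)
    also have "\<dots> = (p \<otimes>\<^bsub>?P\<^esub> s \<oplus>\<^bsub>?P\<^esub> q \<otimes>\<^bsub>?P\<^esub> s) m"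
      unfolding ps_mult ps_add by (intro finsum_addf) auto
    finally show "((p \<oplus>\<^bsub>?P\<^esub> q) \<otimes>\<^bsub>?P\<^esub> s) m = (p \<otimes>\<^bsub>?P\<^esub> s \<oplus>\<^bsub>?P\<^esub> q \<otimes>\<^bsub>?P\<^esub> s) m" .
  qed
qed

section \<open>Variables, constants, and completeness with respect to one variable\<close>

lemma indexed_var_apply: "indexed_var i m = (if m = {#i#} then \<one> else \<zero>)"
  by (auto simp: indexed_var_def indexed_pmult_def indexed_const_def)
    (metis insert_DiffM)

lemma indexed_var_closed: "i \<in> I \<Longrightarrow> indexed_var i \<in> carrier (power_series_ring R I)"
  by (auto simp: ps_carrier indexed_var_apply)

lemma indexed_const_closed: "a \<in> carrier R \<Longrightarrow> indexed_const a \<in> carrier (power_series_ring R I)"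
  by (auto simp: ps_carrier indexed_const_def)

lemma indexed_var_mult:
  assumes p: "p \<in> carrier (power_series_ring R I)"
  shows "(indexed_var i \<otimes>\<^bsub>power_series_ring R I\<^esub> p) m = (if i \<in># m then p (m - {#i#}) else \<zero>)"
proof (cases "i \<in># m")
  case True
  have "(\<Oplus>u\<in>{u. u \<subseteq># m}. indexed_var i u \<otimes> p (m - u)) = indexed_var i {#i#} \<otimes> p (m - {#i#})"
    using ps_closed[OF p] True
    by (intro finsum_submultisets_single) (auto simp: indexed_var_apply)
  then show ?thesis using True ps_closed[OF p] by (simp add: ps_mult indexed_var_apply)
next
  case False
  have "(\<Oplus>u\<in>{u. u \<subseteq># m}. indexed_var i u \<otimes> p (m - u)) = \<zero>"
    using ps_closed[OF p] False
    by (intro finsum_submultisets_zero) (auto simp: indexed_var_apply)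
  then show ?thesis using False by (simp add: ps_mult)
qed

lemma indexed_const_ring_hom:
  fixes I :: "'i set"
  shows "indexed_const \<in> ring_hom R (power_series_ring R I)"
proof (rule ring_hom_memI)
  fix a b assume ab: "a \<in> carrier R" "b \<in> carrier R"
  show "indexed_const (a \<otimes> b) = indexed_const a \<otimes>\<^bsub>power_series_ring R I\<^esub> indexed_const b"
  proof
    fix m :: "'i multiset"
    have "(\<Oplus>u\<in>{u. u \<subseteq># m}. indexed_const a u \<otimes> indexed_const b (m - u)) =
        indexed_const a ({#} :: 'i multiset) \<otimes> indexed_const b (m - {#})"
      using ab by (intro finsum_submultisets_single) (auto simp: indexed_const_def)
    then show "indexed_const (a \<otimes> b) m = (indexed_const a \<otimes>\<^bsub>power_series_ring R I\<^esub> indexed_const b) m"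
      using ab by (simp add: ps_mult indexed_const_def)
  qed
  show "indexed_const (a \<oplus> b) = indexed_const a \<oplus>\<^bsub>power_series_ring R I\<^esub> indexed_const b"
    using ab by (auto simp: ps_add indexed_const_def intro!: ext)
qed (simp_all add: indexed_const_closed, simp add: power_series_ring_def)

definition kill_var :: "'i \<Rightarrow> ('i multiset \<Rightarrow> 'a) \<Rightarrow> 'i multiset \<Rightarrow> 'a" where
  "kill_var i p = (\<lambda>m. if i \<in># m then \<zero> else p m)"

lemma kill_var_ring_hom:
  "kill_var i \<in> ring_hom (power_series_ring R (insert i I)) (power_series_ring R I)"
proof (rule ring_hom_memI)
  let ?P = "power_series_ring R (insert i I)" and ?Q = "power_series_ring R I"
  fix p q assume p: "p \<in> carrier ?P"
  show "kill_var i p \<in> carrier ?Q"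
    using p unfolding ps_carrier kill_var_def by auto
  assume q: "q \<in> carrier ?P"
  show "kill_var i (p \<oplus>\<^bsub>?P\<^esub> q) = kill_var i p \<oplus>\<^bsub>?Q\<^esub> kill_var i q"
    by (auto simp: kill_var_def ps_add intro!: ext)
  show "kill_var i (p \<otimes>\<^bsub>?P\<^esub> q) = kill_var i p \<otimes>\<^bsub>?Q\<^esub> kill_var i q"
  proof
    fix m
    show "kill_var i (p \<otimes>\<^bsub>?P\<^esub> q) m = (kill_var i p \<otimes>\<^bsub>?Q\<^esub> kill_var i q) m"
    proof (cases "i \<in># m")
      case True
      have "(\<Oplus>u\<in>{u. u \<subseteq># m}. kill_var i p u \<otimes> kill_var i q (m - u)) = \<zero>"
      proof (rule finsum_submultisets_zero)
        fix u assume "u \<subseteq># m"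
        then have "i \<in># u \<or> i \<in># m - u"
          using True by (metis subset_mset.add_diff_inverse union_iff)
        then show "kill_var i p u \<otimes> kill_var i q (m - u) = \<zero>"
          using ps_closed[OF p] ps_closed[OF q] by (auto simp: kill_var_def)
      qed
      then show ?thesis using True by (simp add: ps_mult kill_var_def)
    next
      case False
      have "i \<notin># u \<and> i \<notin># m - u" if "u \<subseteq># m" for u
        using False that by (meson in_diffD mset_subset_eqD)
      then have "(\<Oplus>u\<in>{u. u \<subseteq># m}. kill_var i p u \<otimes> kill_var i q (m - u)) =
          (\<Oplus>u\<in>{u. u \<subseteq># m}. p u \<otimes> q (m - u))"
        using ps_closed[OF p] ps_closed[OF q] by (intro finsum_cong') (auto simp: kill_var_def)
      then show ?thesis using False by (simp add: ps_mult kill_var_def)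
    qed
  qed
qed (auto simp: kill_var_def ps_one intro!: ext)

text \<open>Series in \<open>I\<close> and in \<open>insert i I\<close> share one type, so adjoining
  a variable needs no nested power series; setting variable \<open>i\<close> to zero takes the role
  of the constant coefficient.\<close>

lemma adic_quotient_power_series:
  assumes i: "i \<notin> I"
  shows "adic_quotient (power_series_ring R (insert i I)) (power_series_ring R I) (kill_var i) (indexed_var i)"
proof -
  let ?P = "power_series_ring R (insert i I)" and ?Q = "power_series_ring R I"
  let ?X = "indexed_var i"
  interpret P: cring ?P by (rule cring_power_series)
  interpret Q: cring ?Q by (rule cring_power_series)
  have X: "?X \<in> carrier ?P" by (rule indexed_var_closed) simp
  note mult = indexed_var_mult[where I = "insert i I" and i = i]
  have shift: "(\<lambda>m. p (add_mset i m)) \<in> carrier ?P" if "p \<in> carrier ?P" for p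
    using that unfolding ps_carrier by auto
  show ?thesis
  proof (unfold_locales, goal_cases)
    case 1
    show ?case by (rule kill_var_ring_hom)
  next
    case 2
    show ?case
    proof
      show "kill_var i ` carrier ?P \<subseteq> carrier ?Q"
        by (rule image_subsetI) (rule ring_hom_closed[OF kill_var_ring_hom])
      show "carrier ?Q \<subseteq> kill_var i ` carrier ?P"
      proof
        fix p assume p: "p \<in> carrier ?Q"
        then have "p \<in> carrier ?P" unfolding ps_carrier by auto
        moreover have "kill_var i p = p"
        proof
          fix m
          show "kill_var i p m = p m"
            using p i unfolding ps_carrier kill_var_def by auto
        qed
        ultimately show "p \<in> kill_var i ` carrier ?P" by (metis imageI)
      qed
    qed
  next
    case 3
    show ?case by (rule X)
  next
    case (4 p)
    show ?case
    proof (rule bexI[OF _ shift[OF 4(1)]])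
      show "p = ?X \<otimes>\<^bsub>?P\<^esub> (\<lambda>m. p (add_mset i m))"
      proof
        fix m
        show "p m = (?X \<otimes>\<^bsub>?P\<^esub> (\<lambda>m. p (add_mset i m))) m"
          using fun_cong[OF 4(2), of m] unfolding mult[OF shift[OF 4(1)]]
          by (simp add: kill_var_def ps_zero split: if_splits)
      qed
    qed
  next
    case 5
    show ?case by (auto simp: kill_var_def indexed_var_apply ps_zero intro!: ext)
  next
    case (6 p)
    show ?case
    proof
      fix m
      show "p m = \<zero>\<^bsub>?P\<^esub> m"
        using fun_cong[OF 6(2), of "add_mset i m"] unfolding mult[OF 6(1)] by (simp add: ps_zero)
    qed
  next
    case (7 a)
    \<comment> \<open>The coefficient of \<open>a k\<close> at \<open>m\<close> is zero or the
      coefficient of \<open>a (k + 1)\<close> at a smaller monomial; hence induction on the degree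
      of \<open>m\<close>, for all \<open>k\<close> at once.\<close>
    have "a k m = \<zero>" for k m
    proof (induction m arbitrary: k rule: measure_induct_rule[of size])
      case (less m)
      have "a k m = (if i \<in># m then a (Suc k) (m - {#i#}) else \<zero>)"
        using fun_cong[OF 7(2)[of k], of m] unfolding mult[OF 7(1)] .
      then show ?case using less[of "m - {#i#}" "Suc k"] by (simp add: size_Diff1_less)
    qed
    then show ?case by (auto simp: ps_zero intro!: ext)
  next
    case (8 c)
    \<comment> \<open>\<open>F k\<close> has to be the sum of the \<open>x^j c (k + j)\<close>. At
      \<open>m\<close> only the terms with \<open>j\<close> at most the exponent of \<open>i\<close>
      contribute, and \<open>H j\<close> unrolls the recursion for \<open>j\<close> steps.\<close>
    define H where "H = rec_nat (\<lambda>k m. c k m) (\<lambda>_ G k m. c k m \<oplus> G (Suc k) (m - {#i#}))"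
    have H0: "H 0 k m = c k m" and HS: "H (Suc j) k m = c k m \<oplus> H j (Suc k) (m - {#i#})" for j k m
      by (simp_all add: H_def)
    define F where "F k m = H (count m i) k m" for k m
    have cc: "c k m \<in> carrier R" for k m using ps_closed[OF 8] .
    have Hc: "H j k m \<in> carrier R" for j k m
      by (induction j arbitrary: k m) (simp_all add: H0 HS cc)
    have Fr: "F k m = c k m \<oplus> (if i \<in># m then F (Suc k) (m - {#i#}) else \<zero>)" for k m
    proof (cases "i \<in># m")
      case True
      then obtain m' where "m = add_mset i m'" by (metis insert_DiffM)
      then show ?thesis by (simp add: F_def HS)
    next
      case False
      then have "count m i = 0" by (simp add: not_in_iff)
      then show ?thesis using False by (simp add: F_def H0 cc)
    qed
    have Fz: "F k m = \<zero>" if "\<not> set_mset m \<subseteq> insert i I" for k m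
      using that
    proof (induction m arbitrary: k rule: measure_induct_rule[of size])
      case (less m)
      have cz: "c k m = \<zero>" using 8[of k] less.prems unfolding ps_carrier by blast
      show ?case
      proof (cases "i \<in># m")
        case True
        have "set_mset m \<subseteq> insert i (set_mset (m - {#i#}))" using True by (metis insert_DiffM set_mset_add_mset_insert order_refl)
        then have "\<not> set_mset (m - {#i#}) \<subseteq> insert i I" using less.prems by blast
        then have "F (Suc k) (m - {#i#}) = \<zero>"
          using less.IH[of "m - {#i#}"] True by (simp add: size_Diff1_less)
        then show ?thesis using Fr[of k m] True cz by simp
      qed (use Fr[of k m] cz in simp)
    qed
    have Fc: "F k \<in> carrier ?P" for k
      unfolding ps_carrier using Hc Fz by (simp add: F_def)
    show ?case
    proof (intro exI[of _ F] conjI allI Fc)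
      fix k show "F k = c k \<oplus>\<^bsub>?P\<^esub> ?X \<otimes>\<^bsub>?P\<^esub> F (Suc k)"
      proof
        fix m show "F k m = (c k \<oplus>\<^bsub>?P\<^esub> ?X \<otimes>\<^bsub>?P\<^esub> F (Suc k)) m"
          unfolding ps_add mult[OF Fc] by (rule Fr)
      qed
    qed
  qed
qed

lemma const_coeff_ring_hom: "(\<lambda>p. p {#}) \<in> ring_hom (power_series_ring R I) R"
proof (rule ring_hom_memI)
  fix p q assume p: "p \<in> carrier (power_series_ring R I)"
  show "p {#} \<in> carrier R" using ps_closed[OF p] .
  assume q: "q \<in> carrier (power_series_ring R I)"
  have "{u. u \<subseteq># {#}} = {{#}}" by auto
  then show "(p \<otimes>\<^bsub>power_series_ring R I\<^esub> q) {#} = p {#} \<otimes> q {#}"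
    using ps_closed[OF p] ps_closed[OF q] by (simp add: ps_mult)
qed (simp_all add: ps_add ps_one)

text \<open>The case of no remaining variables, with the series in \<open>{}\<close> replaced by the
  ring \<open>R\<close> itself, whose type is different.\<close>

lemma adic_quotient_const_coeff:
  "adic_quotient (power_series_ring R {i}) R (\<lambda>p. p {#}) (indexed_var i)"
proof -
  let ?P = "power_series_ring R {i}"
  interpret K: adic_quotient ?P "power_series_ring R {}" "kill_var i" "indexed_var i"
    by (rule adic_quotient_power_series) simp
  have "kill_var i p = \<zero>\<^bsub>power_series_ring R {}\<^esub>" if p: "p \<in> carrier ?P" and "p {#} = \<zero>" for p
  proof
    fix m show "kill_var i p m = \<zero>\<^bsub>power_series_ring R {}\<^esub> m"
      using p that(2) unfolding ps_carrier kill_var_def ps_zero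
      by (cases "m = {#}") (auto simp: subset_singleton_iff)
  qed
  then have ker: "\<exists>b\<in>carrier ?P. p = indexed_var i \<otimes>\<^bsub>?P\<^esub> b" if "p \<in> carrier ?P" "p {#} = \<zero>" for p
    using K.x_kernel that by blast
  show ?thesis
  proof (unfold_locales, goal_cases)
    case 1
    show ?case by (rule const_coeff_ring_hom)
  next
    case 2
    have "a \<in> (\<lambda>p. p {#}) ` carrier ?P" if "a \<in> carrier R" for a
      using indexed_const_closed[OF that] by (intro image_eqI[of _ _ "indexed_const a"])
        (simp_all add: indexed_const_def)
    then show ?case using ps_closed by blast
  next
    case 4
    then show ?case by (rule ker)
  next
    case 5
    show ?case by (simp add: indexed_var_apply)
  next
    case 3
    show ?case by (rule K.x_closed)
  next
    case 6
    then show ?case by (rule K.x_nzd)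
  next
    case (7 a)
    then show ?case by (rule K.separated)
  next
    case (8 c)
    then show ?case by (rule K.complete)
  qed
qed

section \<open>Formal partial derivatives\<close>

definition ps_derivative :: "'i \<Rightarrow> ('i multiset \<Rightarrow> 'a) \<Rightarrow> 'i multiset \<Rightarrow> 'a" where
  "ps_derivative i p = (\<lambda>m. add_pow R (Suc (count m i)) (p (add_mset i m)))"

lemma ps_derivative_closed:
  "p \<in> carrier (power_series_ring R I) \<Longrightarrow> ps_derivative i p \<in> carrier (power_series_ring R I)"
  unfolding ps_carrier ps_derivative_def by (auto simp: add.nat_pow_closed)

lemma ps_derivative_add:
  "p \<in> carrier (power_series_ring R I) \<Longrightarrow> q \<in> carrier (power_series_ring R I) \<Longrightarrow>
    ps_derivative i (p \<oplus>\<^bsub>power_series_ring R I\<^esub> q) =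
    ps_derivative i p \<oplus>\<^bsub>power_series_ring R I\<^esub> ps_derivative i q"
  by (rule ext) (simp only: ps_derivative_def ps_add add.nat_pow_distrib ps_closed)

text \<open>One half of the product rule. Terms without \<open>i\<close> in \<open>u\<close> have
  weight zero; in the others one \<open>i\<close> is taken out of \<open>u\<close>, which turns the
  weighted factor \<open>p u\<close> into a coefficient of the derivative.\<close>

lemma ps_derivative_mult_aux:
  assumes p: "p \<in> carrier (power_series_ring R I)" and q: "q \<in> carrier (power_series_ring R I)"
  shows "(\<Oplus>u\<in>{u. u \<subseteq># add_mset i m}. add_pow R (count u i) (p u \<otimes> q (add_mset i m - u))) =
    (ps_derivative i p \<otimes>\<^bsub>power_series_ring R I\<^esub> q) m"
proof -
  note [simp] = ps_closed[OF p] ps_closed[OF q]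
  let ?g = "\<lambda>u. add_pow R (count u i) (p u \<otimes> q (add_mset i m - u))"
  have "(\<Oplus>u\<in>{u. u \<subseteq># add_mset i m}. ?g u) = (\<Oplus>u\<in>add_mset i ` {u. u \<subseteq># m}. ?g u)"
  proof (rule add.finprod_mono_neutral_cong_right)
    fix u assume u: "u \<in> {u. u \<subseteq># add_mset i m} - add_mset i ` {u. u \<subseteq># m}"
    have "i \<notin># u"
    proof
      assume "i \<in># u"
      then obtain v where "u = add_mset i v" by (metis insert_DiffM)
      then show False using u by auto
    qed
    then show "?g u = \<zero>" by (simp add: not_in_iff)
  qed (auto simp: finite_submultisets intro!: add.nat_pow_closed)
  also have "\<dots> = (\<Oplus>u\<in>{u. u \<subseteq># m}. ?g (add_mset i u))"
    by (rule finsum_reindex) (auto intro!: add.nat_pow_closed simp: inj_on_def)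
  also have "\<dots> = (ps_derivative i p \<otimes>\<^bsub>power_series_ring R I\<^esub> q) m"
    unfolding ps_mult ps_derivative_def
    by (rule finsum_cong') (auto simp del: add.nat_pow_Suc simp: add_pow_ldistr)
  finally show ?thesis .
qed

text \<open>In the coefficient at \<open>add_mset i m\<close> the exponent of \<open>i\<close> is
  the sum of its exponents in \<open>u\<close> and in the complement of \<open>u\<close>; the two
  resulting sums are the two products, the second after exchanging \<open>u\<close> with its
  complement.\<close>

lemma ps_derivative_mult:
  assumes p: "p \<in> carrier (power_series_ring R I)" and q: "q \<in> carrier (power_series_ring R I)"
  shows "ps_derivative i (p \<otimes>\<^bsub>power_series_ring R I\<^esub> q) =
    ps_derivative i p \<otimes>\<^bsub>power_series_ring R I\<^esub> q \<oplus>\<^bsub>power_series_ring R I\<^esub>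
    p \<otimes>\<^bsub>power_series_ring R I\<^esub> ps_derivative i q"
proof
  fix m
  note [simp] = ps_closed[OF p] ps_closed[OF q]
  let ?M = "add_mset i m"
  let ?g = "\<lambda>u. p u \<otimes> q (?M - u)"
  have "ps_derivative i (p \<otimes>\<^bsub>power_series_ring R I\<^esub> q) m = add_pow R (count ?M i) (\<Oplus>u\<in>{u. u \<subseteq># ?M}. ?g u)"
    by (simp add: ps_derivative_def ps_mult del: add.nat_pow_Suc)
  also have "\<dots> = (\<Oplus>u\<in>{u. u \<subseteq># ?M}. add_pow R (count ?M i) (?g u))"
    by (rule nat_mult_finsum[OF finite_submultisets]) simp
  also have "\<dots> = (\<Oplus>u\<in>{u. u \<subseteq># ?M}. add_pow R (count u i) (?g u) \<oplus> add_pow R (count (?M - u) i) (?g u))"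
  proof (rule finsum_cong')
    fix u assume "u \<in> {u. u \<subseteq># ?M}"
    then have "count ?M i = count u i + count (?M - u) i"
      by (metis count_union mem_Collect_eq subset_mset.add_diff_inverse)
    then show "add_pow R (count ?M i) (?g u) = add_pow R (count u i) (?g u) \<oplus> add_pow R (count (?M - u) i) (?g u)"
      by (simp only: add.nat_pow_mult m_closed ps_closed[OF p] ps_closed[OF q])
  qed (auto intro!: add.nat_pow_closed)
  also have "\<dots> = (\<Oplus>u\<in>{u. u \<subseteq># ?M}. add_pow R (count u i) (?g u)) \<oplus>
      (\<Oplus>u\<in>{u. u \<subseteq># ?M}. add_pow R (count (?M - u) i) (?g u))"
    by (rule finsum_addf) (auto intro!: add.nat_pow_closed)
  also have "(\<Oplus>u\<in>{u. u \<subseteq># ?M}. add_pow R (count (?M - u) i) (?g u)) =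
      (\<Oplus>u\<in>{u. u \<subseteq># ?M}. add_pow R (count (?M - (?M - u)) i) (?g (?M - u)))"
    by (rule finsum_submultisets_swap[symmetric]) (auto intro!: add.nat_pow_closed)
  also have "\<dots> = (\<Oplus>u\<in>{u. u \<subseteq># ?M}. add_pow R (count u i) (q u \<otimes> p (?M - u)))"
    by (rule finsum_cong') (auto intro!: add.nat_pow_closed simp: subset_mset.diff_diff_right m_comm)
  also have "\<dots> = (ps_derivative i q \<otimes>\<^bsub>power_series_ring R I\<^esub> p) m"
    by (rule ps_derivative_mult_aux[OF q p])
  also have "\<dots> = (p \<otimes>\<^bsub>power_series_ring R I\<^esub> ps_derivative i q) m"
    using ps_mult_comm[OF ps_derivative_closed[OF q] p] by simp
  finally show "ps_derivative i (p \<otimes>\<^bsub>power_series_ring R I\<^esub> q) m =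
    (ps_derivative i p \<otimes>\<^bsub>power_series_ring R I\<^esub> q \<oplus>\<^bsub>power_series_ring R I\<^esub>
    p \<otimes>\<^bsub>power_series_ring R I\<^esub> ps_derivative i q) m"
    unfolding ps_derivative_mult_aux[OF p q] ps_add .
qed

lemma ps_derivative_const: "a \<in> carrier R \<Longrightarrow> ps_derivative i (indexed_const a) = \<zero>\<^bsub>power_series_ring R I\<^esub>"
  by (rule ext) (simp add: ps_derivative_def indexed_const_def ps_zero del: add.nat_pow_Suc)

lemma ps_derivative_var: "ps_derivative i (indexed_var i) = \<one>\<^bsub>power_series_ring R I\<^esub>"
  by (rule ext) (auto simp: ps_derivative_def indexed_var_apply ps_one)

end

text \<open>\<open>{..n}\<close> has \<open>n + 1\<close> variables, so the base case is one
  variable over \<open>k\<close>, reached through the constant coefficient. Each variable raises the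
  degree \<open>l\<close> by one.\<close>

lemma power_series_regular:
  assumes "field k"
  shows "domain (power_series_ring k {..n::nat}) \<and> fg_submodules (power_series_ring k {..n}) \<and>
    (\<exists>l. \<one>\<^bsub>power_series_ring k {..n}\<^esub> \<in> syzygy_ann (power_series_ring k {..n}) l)"
proof -
  interpret k: field k by fact
  interpret k: free_modules k ..
  show ?thesis
  proof (induction n)
    case 0
    interpret adic_quotient "power_series_ring k {0::nat}" k "\<lambda>p. p {#}" "k.indexed_var 0"
      by (rule k.adic_quotient_const_coeff)
    have "{..0::nat} = {0}" by auto
    then show ?case
      using domain_lift[OF k.domain_axioms] fg_submodules_lift[OF k.field_fg_submodules[OF assms]]
        one_in_syzygy_ann[OF k.field_one_in_syzygy_ann[OF assms]]
      by auto
  next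
    case (Suc n)
    interpret adic_quotient "power_series_ring k {..Suc n}" "power_series_ring k {..n}"
      "k.kill_var (Suc n)" "k.indexed_var (Suc n)"
      unfolding atMost_Suc by (rule k.adic_quotient_power_series) simp
    show ?case
      using Suc domain_lift fg_submodules_lift one_in_syzygy_ann by blast
  qed
qed

section \<open>Factor rings by principal ideals\<close>

context cring
begin

lemma surjective_ring_change_principal:
  assumes "g \<in> carrier R"
  shows "surjective_ring_change R (R Quot (PIdl g)) (\<lambda>a. PIdl g +> a)"
proof -
  interpret ideal "PIdl g" R by (rule cgenideal_ideal[OF assms])
  interpret Q: cring "R Quot (PIdl g)" by (rule quotient_is_cring[OF cring_axioms])
  show ?thesis
  proof
    show "(\<lambda>a. PIdl g +> a) \<in> ring_hom R (R Quot (PIdl g))" by (rule rcos_ring_hom)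
    show "(\<lambda>a. PIdl g +> a) ` carrier R = carrier (R Quot (PIdl g))"
      by (auto simp: FactRing_def A_RCOSETS_def')
  qed
qed

lemma principal_coset_eq_iff:
  assumes "g \<in> carrier R" "a \<in> carrier R" "b \<in> carrier R"
  shows "PIdl g +> a = PIdl g +> b \<longleftrightarrow> (\<exists>c\<in>carrier R. a \<ominus> b = c \<otimes> g)"
  using quotient_eq_iff_same_a_r_cos[OF cgenideal_ideal[OF assms(1)] assms(2,3)]
  by (auto simp: cgenideal_def)

lemma principal_coset_zero_iff:
  assumes "g \<in> carrier R" "a \<in> carrier R"
  shows "PIdl g +> a = \<zero>\<^bsub>R Quot (PIdl g)\<^esub> \<longleftrightarrow> (\<exists>c\<in>carrier R. a = c \<otimes> g)"
proof -
  interpret C: surjective_ring_change R "R Quot (PIdl g)" "\<lambda>a. PIdl g +> a"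
    by (rule surjective_ring_change_principal[OF assms(1)])
  have "PIdl g +> \<zero> = \<zero>\<^bsub>R Quot (PIdl g)\<^esub>" by (rule C.hom_simps)
  moreover have "a \<ominus> \<zero> = a" using assms(2) by algebra
  ultimately show ?thesis using principal_coset_eq_iff[OF assms(1,2) zero_closed] by simp
qed

lemma nzd_quotient_principal:
  assumes g: "g \<in> carrier R" and nzd: "\<And>a. a \<in> carrier R \<Longrightarrow> g \<otimes> a = \<zero> \<Longrightarrow> a = \<zero>"
  shows "nzd_quotient R (R Quot (PIdl g)) (\<lambda>a. PIdl g +> a) g"
proof -
  interpret C: surjective_ring_change R "R Quot (PIdl g)" "\<lambda>a. PIdl g +> a"
    by (rule surjective_ring_change_principal[OF g])
  show ?thesis
  proof (unfold_locales, goal_cases)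
    case 1
    show ?case by (rule g)
  next
    case (2 a)
    then show ?case using principal_coset_zero_iff[OF g] m_comm[OF g] by metis
  next
    case 3
    show ?case using principal_coset_zero_iff[OF g g] g by (metis one_closed l_one)
  next
    case (4 a)
    then show ?case by (rule nzd)
  qed
qed

end

section \<open>The branched cover and its projection\<close>

locale branched_cover_data = cring S for S (structure) +
  fixes f and m :: nat
  assumes f_closed [simp]: "f \<in> carrier S" and m: "m \<ge> 2"
begin

text \<open>Against the notation of the statement: \<open>T\<close> is \<open>S^sharp\<close>,
  \<open>P\<close> is \<open>R^sharp\<close>, \<open>Q\<close> is \<open>R\<close>, and
  \<open>\<rho>\<close> is \<pi>.\<close>

abbreviation "T \<equiv> power_series_ring S {()}"
abbreviation "g \<equiv> branched_cover_equation S f m"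
abbreviation "P \<equiv> branched_cover S f m"
abbreviation "Q \<equiv> hypersurface_ring S f"
abbreviation "y \<equiv> indexed_var ()"
abbreviation "to_P \<equiv> (\<lambda>F. (PIdl\<^bsub>T\<^esub> g) +>\<^bsub>T\<^esub> F)"
abbreviation "to_Q \<equiv> (\<lambda>a. (PIdl f) +> a)"
abbreviation "\<rho> \<equiv> branched_cover_proj S f"

sublocale A: adic_quotient T S "\<lambda>F. F {#}" y
  by (rule adic_quotient_const_coeff)

lemma P_def': "P = T Quot (PIdl\<^bsub>T\<^esub> g)" and Q_def': "Q = S Quot (PIdl f)"
  by (simp_all add: branched_cover_def hypersurface_ring_def Let_def)

lemma g_def': "g = indexed_const f \<oplus>\<^bsub>T\<^esub> y [^]\<^bsub>T\<^esub> m"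
  by (simp add: branched_cover_equation_def Let_def)

lemma const_closed [simp]: "a \<in> carrier S \<Longrightarrow> indexed_const a \<in> carrier T"
  by (rule indexed_const_closed)

lemma g_closed [simp]: "g \<in> carrier T"
  unfolding g_def' by simp

text \<open>Here \<open>m \<ge> 2\<close> enters: with two factors \<open>y\<close> split off,
  \<open>f\<close> becomes a multiple of \<open>y^2\<close> in \<open>P\<close>.\<close>

lemma y_pow: "y [^]\<^bsub>T\<^esub> m = y \<otimes>\<^bsub>T\<^esub> (y \<otimes>\<^bsub>T\<^esub> y [^]\<^bsub>T\<^esub> (m - 2))"
proof -
  have "m = Suc (Suc (m - 2))" using m by simp
  then have "y [^]\<^bsub>T\<^esub> m = y [^]\<^bsub>T\<^esub> Suc (Suc (m - 2))" by simp
  then show ?thesis by (simp add: A.S.m_ac)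
qed

lemma g_const_coeff: "g {#} = f"
proof -
  have "(y \<otimes>\<^bsub>T\<^esub> (y \<otimes>\<^bsub>T\<^esub> y [^]\<^bsub>T\<^esub> (m - 2))) {#} = \<zero>"
    using A.hom_simps(3)[of y "y \<otimes>\<^bsub>T\<^esub> y [^]\<^bsub>T\<^esub> (m - 2)"] A.hom_simps(1) A.x_zero by simp
  then show ?thesis
    unfolding g_def' y_pow by (simp add: ps_add indexed_const_def)
qed

sublocale P: surjective_ring_change T P to_P
  unfolding P_def' by (rule A.S.surjective_ring_change_principal) simp

sublocale Q: surjective_ring_change S Q to_Q
  unfolding Q_def' by (rule surjective_ring_change_principal) simp

text \<open>\<open>the_elem\<close> is meaningful because members of a coset differ by multiples of
  \<open>g\<close>, whose constant coefficient is \<open>f\<close>.\<close>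

lemma proj_coset:
  assumes F: "F \<in> carrier T"
  shows "\<rho> (to_P F) = to_Q (F {#})"
proof -
  have "to_Q (F' {#}) = to_Q (F {#})" if F': "F' \<in> to_P F" for F'
  proof -
    obtain h where h: "h \<in> carrier T" "F' = h \<otimes>\<^bsub>T\<^esub> g \<oplus>\<^bsub>T\<^esub> F"
      using F' by (auto simp: a_r_coset_def' cgenideal_def)
    have c: "h {#} \<in> carrier S" "F {#} \<in> carrier S" using A.hom_simps(1) h(1) F by blast+
    have "F' {#} = h {#} \<otimes> f \<oplus> F {#}"
      using h F A.hom_simps(3)[OF h(1) g_closed] by (simp add: ps_add g_const_coeff)
    then have "F' {#} \<ominus> F {#} = h {#} \<otimes> f" using c f_closed by algebra
    then show ?thesis
      using principal_coset_eq_iff[OF f_closed, of "F' {#}" "F {#}"] c \<open>F' {#} = _\<close> by auto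
  qed
  moreover have "F \<in> to_P F"
  proof -
    interpret I: ideal "PIdl\<^bsub>T\<^esub> g" T by (rule A.S.cgenideal_ideal[OF g_closed])
    show ?thesis by (rule I.a_rcos_self[OF F])
  qed
  ultimately have "(\<lambda>F. to_Q (F {#})) ` to_P F = {to_Q (F {#})}" by blast
  then show ?thesis by (simp add: branched_cover_proj_def)
qed

lemma P_cases:
  assumes "c \<in> carrier P"
  obtains F where "F \<in> carrier T" "c = to_P F"
  using assms P.surj by blast

sublocale R: surjective_ring_change P Q \<rho>
proof
  show "\<rho> \<in> ring_hom P Q"
  proof (rule ring_hom_memI)
    fix a assume "a \<in> carrier P"
    then obtain F where F: "F \<in> carrier T" "a = to_P F" by (rule P_cases)
    have F0: "F {#} \<in> carrier S" using A.hom_simps(1)[OF F(1)] .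
    show "\<rho> a \<in> carrier Q" unfolding F(2) proj_coset[OF F(1)] by (rule Q.hom_simps(1)[OF F0])
    fix b assume "b \<in> carrier P"
    then obtain G where G: "G \<in> carrier T" "b = to_P G" by (rule P_cases)
    have G0: "G {#} \<in> carrier S" using A.hom_simps(1)[OF G(1)] .
    show "\<rho> (a \<otimes>\<^bsub>P\<^esub> b) = \<rho> a \<otimes>\<^bsub>Q\<^esub> \<rho> b"
      unfolding F(2) G(2) P.hom_simps(3)[OF F(1) G(1), symmetric] proj_coset[OF F(1)] proj_coset[OF G(1)]
        proj_coset[OF A.S.m_closed[OF F(1) G(1)]] A.hom_simps(3)[OF F(1) G(1)]
      by (rule Q.hom_simps(3)[OF F0 G0])
    show "\<rho> (a \<oplus>\<^bsub>P\<^esub> b) = \<rho> a \<oplus>\<^bsub>Q\<^esub> \<rho> b"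
      unfolding F(2) G(2) P.hom_simps(2)[OF F(1) G(1), symmetric] proj_coset[OF F(1)] proj_coset[OF G(1)]
        proj_coset[OF A.S.a_closed[OF F(1) G(1)]] A.hom_simps(2)[OF F(1) G(1)]
      by (rule Q.hom_simps(2)[OF F0 G0])
  next
    show "\<rho> \<one>\<^bsub>P\<^esub> = \<one>\<^bsub>Q\<^esub>"
      unfolding P.hom_simps(4)[symmetric] proj_coset[OF A.S.one_closed] A.hom_simps(4)
      by (rule Q.hom_simps(4))
  qed
  then have closed: "\<rho> c \<in> carrier Q" if "c \<in> carrier P" for c
    using that by (rule ring_hom_closed)
  show "\<rho> ` carrier P = carrier Q"
  proof (intro equalityI subsetI)
    fix c assume "c \<in> \<rho> ` carrier P"
    then show "c \<in> carrier Q" using closed by (elim imageE) simp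
  next
    fix c assume "c \<in> carrier Q"
    then have "c \<in> to_Q ` carrier S" unfolding Q.surj .
    then obtain a where a: "a \<in> carrier S" "c = to_Q a" by blast
    have "\<rho> (to_P (indexed_const a)) = to_Q a"
      unfolding proj_coset[OF const_closed[OF a(1)]] by (simp add: indexed_const_def)
    then show "c \<in> \<rho> ` carrier P"
      using a P.hom_simps(1)[OF const_closed[OF a(1)]] by (metis imageI)
  qed
qed

context
  assumes dom: "domain S" and f0: "f \<noteq> \<zero>"
begin

interpretation D: domain S by (rule dom)

text \<open>If \<open>y F = h g\<close>, constant coefficients give \<open>h(0) f = 0\<close>. Since
  \<open>f\<close> is nonzero in a domain, \<open>h(0) = 0\<close>, so \<open>y\<close> divides
  \<open>h\<close> and can be cancelled: \<open>F\<close> is a multiple of \<open>g\<close>.\<close>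

lemma nzd_y: "nzd_quotient P Q \<rho> (to_P y)"
proof (unfold_locales, goal_cases)
  case 1
  show ?case by (rule P.hom_simps(1)[OF A.x_closed])
next
  case (2 c)
  obtain F where F: "F \<in> carrier T" "c = to_P F" using 2(1) by (rule P_cases)
  have F0: "F {#} \<in> carrier S" using A.hom_simps(1)[OF F(1)] .
  have "to_Q (F {#}) = \<zero>\<^bsub>Q\<^esub>" using 2(2) unfolding F(2) proj_coset[OF F(1)] .
  then obtain h where h: "h \<in> carrier S" "F {#} = h \<otimes> f"
    using principal_coset_zero_iff[OF f_closed F0] unfolding Q_def' by blast
  \<comment> \<open>Subtracting \<open>h g\<close> keeps the class in \<open>P\<close> and makes the
    constant coefficient zero, so that what is left is divisible by \<open>y\<close>.\<close>
  define G where "G = F \<ominus>\<^bsub>T\<^esub> indexed_const h \<otimes>\<^bsub>T\<^esub> g"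
  have hg: "indexed_const h \<otimes>\<^bsub>T\<^esub> g \<in> carrier T" using h(1) by simp
  have G: "G \<in> carrier T" unfolding G_def using F(1) hg by simp
  have FG: "F = G \<oplus>\<^bsub>T\<^esub> indexed_const h \<otimes>\<^bsub>T\<^esub> g"
    unfolding G_def using F(1) hg by algebra
  have hg0: "(indexed_const h \<otimes>\<^bsub>T\<^esub> g) {#} = h \<otimes> f"
    using A.hom_simps(3)[OF const_closed[OF h(1)] g_closed] by (simp add: g_const_coeff indexed_const_def)
  have "G {#} \<oplus> h \<otimes> f = h \<otimes> f"
    using fun_cong[OF FG, of "{#}"] by (simp only: ps_add hg0 h(2))
  then have "G {#} = \<zero>"
    using A.hom_simps(1)[OF G] h(1) by simp
  then obtain b where b: "b \<in> carrier T" "G = y \<otimes>\<^bsub>T\<^esub> b" using A.x_kernel[OF G] by blast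
  have "to_P F = to_P G"
  proof (subst A.S.principal_coset_eq_iff[OF g_closed F(1) G], rule bexI)
    show "F \<ominus>\<^bsub>T\<^esub> G = indexed_const h \<otimes>\<^bsub>T\<^esub> g" unfolding G_def using F(1) hg by algebra
  qed (simp add: h(1))
  then have "c = to_P y \<otimes>\<^bsub>P\<^esub> to_P b"
    unfolding F(2) b(2) using P.hom_simps(3)[OF A.x_closed b(1)] by simp
  then show ?case using P.hom_simps(1)[OF b(1)] by blast
next
  case 3
  show ?case unfolding proj_coset[OF A.x_closed] A.x_zero by (rule Q.hom_simps(5))
next
  case (4 c)
  obtain F where F: "F \<in> carrier T" "c = to_P F" using 4(1) by (rule P_cases)
  have "to_P (y \<otimes>\<^bsub>T\<^esub> F) = \<zero>\<^bsub>P\<^esub>"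
    using 4(2) unfolding F(2) P.hom_simps(3)[OF A.x_closed F(1)] .
  then obtain h where h: "h \<in> carrier T" "y \<otimes>\<^bsub>T\<^esub> F = h \<otimes>\<^bsub>T\<^esub> g"
    using A.S.principal_coset_zero_iff[OF g_closed A.S.m_closed[OF A.x_closed F(1)]]
    unfolding P_def' by blast
  have h0c: "h {#} \<in> carrier S" using A.hom_simps(1)[OF h(1)] .
  have "h {#} \<otimes> f = \<zero>"
    using arg_cong[OF h(2), of "\<lambda>F. F {#}"] A.hom_simps(3)[OF h(1) g_closed]
      A.hom_simps(3)[OF A.x_closed F(1)] A.hom_simps(1)[OF F(1)] A.x_zero
    by (simp add: g_const_coeff)
  then have "h {#} = \<zero>" using D.integral[OF _ h0c f_closed] f0 by blast
  then obtain b where b: "b \<in> carrier T" "h = y \<otimes>\<^bsub>T\<^esub> b" using A.x_kernel[OF h(1)] by blast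
  have "y \<otimes>\<^bsub>T\<^esub> (F \<ominus>\<^bsub>T\<^esub> b \<otimes>\<^bsub>T\<^esub> g) = y \<otimes>\<^bsub>T\<^esub> F \<ominus>\<^bsub>T\<^esub> (y \<otimes>\<^bsub>T\<^esub> b) \<otimes>\<^bsub>T\<^esub> g"
    using F(1) b(1) A.x_closed g_closed by algebra
  also have "\<dots> = \<zero>\<^bsub>T\<^esub>"
    unfolding h(2) b(2)[symmetric] using h(1) g_closed by algebra
  finally have "F \<ominus>\<^bsub>T\<^esub> b \<otimes>\<^bsub>T\<^esub> g = \<zero>\<^bsub>T\<^esub>"
    using A.x_nzd F(1) b(1) by simp
  then have "F = b \<otimes>\<^bsub>T\<^esub> g" using F(1) b(1) by simp
  then show ?case
    unfolding F(2) P_def' using A.S.principal_coset_zero_iff[OF g_closed F(1)] b(1) by blast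
qed

interpretation N: nzd_quotient P Q \<rho> "to_P y" by (rule nzd_y)

text \<open>The descent runs through \<open>S\<close>, embedded as constants. A lift chosen over
  \<open>P\<close> itself would in general make \<open>D D\<close> divisible by \<open>y\<close>
  only, not by \<open>y^2\<close>.\<close>

lemma proj_syzygy_ann:
  assumes "b \<in> syzygy_ann P l"
  shows "\<rho> b \<in> syzygy_ann Q l"
proof (rule N.descend_syzygy_ann[where T = S and \<iota> = "\<lambda>a. to_P (indexed_const a)", OF _ _ _ assms])
  have const: "indexed_const \<in> ring_hom S T" by (rule indexed_const_ring_hom)
  show "ring_change S P (\<lambda>a. to_P (indexed_const a))"
    by unfold_locales
      (use ring_hom_trans[OF const P.hom] in \<open>simp add: comp_def\<close>)
  have proj: "\<rho> (to_P (indexed_const a)) = to_Q a" if "a \<in> carrier S" for a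
    unfolding proj_coset[OF const_closed[OF that]] by (simp add: indexed_const_def)
  show "(\<lambda>a. \<rho> (to_P (indexed_const a))) ` carrier S = carrier Q"
    unfolding Q.surj[symmetric] using proj by (rule image_cong[OF refl])
  fix a assume a: "a \<in> carrier S" "\<rho> (to_P (indexed_const a)) = \<zero>\<^bsub>Q\<^esub>"
  obtain h where h: "h \<in> carrier S" "a = h \<otimes> f"
    using a(2) principal_coset_zero_iff[OF f_closed a(1)] unfolding proj[OF a(1)] Q_def' by blast
  define z where "z = y [^]\<^bsub>T\<^esub> (m - 2)"
  have z: "z \<in> carrier T" unfolding z_def by simp
  \<comment> \<open>In \<open>P\<close> the element \<open>a = h f\<close> equals
    \<open>-h y^m\<close>, that is \<open>y^2 c\<close>.\<close>
  define c where "c = \<ominus>\<^bsub>T\<^esub> (indexed_const h \<otimes>\<^bsub>T\<^esub> z)"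
  have c: "c \<in> carrier T" unfolding c_def using z h(1) by simp
  have yyc: "y \<otimes>\<^bsub>T\<^esub> (y \<otimes>\<^bsub>T\<^esub> c) \<in> carrier T" using c by simp
  have ca: "indexed_const a = indexed_const h \<otimes>\<^bsub>T\<^esub> indexed_const f"
    unfolding h(2) using ring_hom_mult[OF const h(1) f_closed] .
  have "indexed_const a \<ominus>\<^bsub>T\<^esub> y \<otimes>\<^bsub>T\<^esub> (y \<otimes>\<^bsub>T\<^esub> c) = indexed_const h \<otimes>\<^bsub>T\<^esub> g"
    unfolding ca c_def g_def' y_pow z_def[symmetric]
    using z const_closed[OF h(1)] const_closed[OF f_closed] A.x_closed by algebra
  then have "to_P (indexed_const a) = to_P (y \<otimes>\<^bsub>T\<^esub> (y \<otimes>\<^bsub>T\<^esub> c))"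
    using A.S.principal_coset_eq_iff[OF g_closed const_closed[OF a(1)] yyc] h(1) const_closed by blast
  also have "\<dots> = to_P y \<otimes>\<^bsub>P\<^esub> (to_P y \<otimes>\<^bsub>P\<^esub> to_P c)"
    using P.hom_simps(3)[OF A.x_closed c] P.hom_simps(3)[OF A.x_closed A.S.m_closed[OF A.x_closed c]]
    by simp
  finally show "\<exists>c\<in>carrier P. to_P (indexed_const a) = to_P y \<otimes>\<^bsub>P\<^esub> (to_P y \<otimes>\<^bsub>P\<^esub> c)"
    using P.hom_simps(1)[OF c] by blast
qed

text \<open>\<open>T\<close> is regular and \<open>P = T/(g)\<close>, so the derivative of
  \<open>g\<close> has a homotopy over \<open>P\<close>. The extra degree is spent on passing from
  \<open>S\<close> to \<open>T\<close>.\<close>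

lemma y_in_syzygy_ann:
  assumes one: "\<one> \<in> syzygy_ann S l" and m2: "m = 2"
    and two: "c \<in> carrier S" "c \<otimes> (\<one> \<oplus> \<one>) = \<one>"
  shows "to_P y \<in> syzygy_ann P (Suc l)"
proof -
  interpret T: domain T by (rule A.domain_lift[OF dom])
  have "g \<noteq> \<zero>\<^bsub>T\<^esub>"
    using g_const_coeff f0 A.hom_simps(5) by metis
  then interpret G: nzd_quotient T P to_P g
    unfolding P_def' by (intro A.S.nzd_quotient_principal) (auto simp: T.integral_iff)
  have dg: "ps_derivative () g = y \<oplus>\<^bsub>T\<^esub> y"
  proof -
    have "ps_derivative () (y [^]\<^bsub>T\<^esub> m) = ps_derivative () (y \<otimes>\<^bsub>T\<^esub> y)"
      by (simp add: m2 numeral_2_eq_2)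
    also have "\<dots> = y \<oplus>\<^bsub>T\<^esub> y"
      by (simp add: ps_derivative_mult[OF A.x_closed A.x_closed] ps_derivative_var[where I = "{()}"])
    finally show ?thesis
      unfolding g_def'
      by (simp add: ps_derivative_add[where I = "{()}"] ps_derivative_const[where I = "{()}"])
  qed
  have "to_P (ps_derivative () g) \<in> syzygy_ann P (Suc l)"
    by (rule G.derivative_syzygy_ann[OF A.one_in_syzygy_ann[OF one]])
      (auto intro: ps_derivative_closed ps_derivative_add ps_derivative_mult)
  then have yy: "to_P (y \<oplus>\<^bsub>T\<^esub> y) \<in> syzygy_ann P (Suc l)" unfolding dg .
  have const: "indexed_const \<in> ring_hom S T" by (rule indexed_const_ring_hom)
  \<comment> \<open>\<open>c\<close> is one half; as a constant series it removes the factor 2 from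
    the derivative \<open>y + y\<close>.\<close>
  have "indexed_const c \<otimes>\<^bsub>T\<^esub> (\<one>\<^bsub>T\<^esub> \<oplus>\<^bsub>T\<^esub> \<one>\<^bsub>T\<^esub>) = \<one>\<^bsub>T\<^esub>"
    using arg_cong[OF two(2), of "indexed_const :: _ \<Rightarrow> unit multiset \<Rightarrow> _"] two(1)
    by (simp add: ring_hom_mult[OF const] ring_hom_add[OF const] ring_hom_one[OF const])
  moreover have "indexed_const c \<otimes>\<^bsub>T\<^esub> (y \<oplus>\<^bsub>T\<^esub> y) =
      (indexed_const c \<otimes>\<^bsub>T\<^esub> (\<one>\<^bsub>T\<^esub> \<oplus>\<^bsub>T\<^esub> \<one>\<^bsub>T\<^esub>)) \<otimes>\<^bsub>T\<^esub> y"
    using const_closed[OF two(1)] A.x_closed by algebra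
  ultimately have cy: "indexed_const c \<otimes>\<^bsub>T\<^esub> (y \<oplus>\<^bsub>T\<^esub> y) = y" by simp
  have "to_P (indexed_const c) \<otimes>\<^bsub>P\<^esub> to_P (y \<oplus>\<^bsub>T\<^esub> y) \<in> syzygy_ann P (Suc l)"
    by (rule P.R.syzygy_ann_mult[OF yy P.hom_simps(1)[OF const_closed[OF two(1)]]])
  then show ?thesis
    using P.hom_simps(3)[OF const_closed[OF two(1)] A.S.a_closed[OF A.x_closed A.x_closed]] cy by simp
qed

lemma syzygy_ann_lifts:
  assumes y: "to_P y \<in> syzygy_ann P (Suc l)" and a: "a \<in> syzygy_ann Q l'"
  shows "\<exists>b l. b \<in> syzygy_ann P l \<and> \<rho> b = a"
proof -
  have "a \<in> \<rho> ` carrier P" unfolding R.surj using syzygy_ann_closed[OF a] .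
  then obtain b where b: "b \<in> carrier P" "\<rho> b = a" by blast
  \<comment> \<open>Lifting asks for \<open>\<rho> b\<close> in some degree and for \<open>y\<close>
    in the next one; passing to the maximum aligns the two.\<close>
  have "\<rho> b \<in> syzygy_ann Q (max l l')" using a b(2) syzygy_ann_mono[of l' "max l l'" Q] by auto
  moreover have "to_P y \<in> syzygy_ann P (Suc (max l l'))"
    using y syzygy_ann_mono[of "Suc l" "Suc (max l l')" P] by auto
  ultimately have "b \<in> syzygy_ann P (Suc (max l l'))" by (rule N.lift_syzygy_ann[OF b(1)])
  then show ?thesis using b(2) by blast
qed

end

text \<open>The equality excludes \<open>f = 0\<close>: for \<open>m = 2\<close> one then has
  \<open>y^2 = 0\<close> in \<open>P\<close>, so \<open>y\<close> is a zero divisor and the lifting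
  of homotopies from \<open>Q\<close> to \<open>P\<close> breaks down.\<close>

lemma coh_ann_branched:
  assumes "domain S" and fg: "fg_submodules S" and one: "\<one> \<in> syzygy_ann S l"
  shows "\<rho> ` coh_ann P \<subseteq> coh_ann Q"
    and "\<lbrakk>m = 2; f \<noteq> \<zero>; c \<in> carrier S; c \<otimes> (\<one> \<oplus> \<one>) = \<one>\<rbrakk> \<Longrightarrow> \<rho> ` coh_ann P = coh_ann Q"
proof -
  have P: "coh_ann P = (\<Union>l. syzygy_ann P l)"
    by (rule P.R.coh_ann_eq[OF P.fg_submodules_quotient[OF A.fg_submodules_lift[OF fg]]])
  have Q: "coh_ann Q = (\<Union>l. syzygy_ann Q l)"
    by (rule Q.R.coh_ann_eq[OF Q.fg_submodules_quotient[OF fg]])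
  show sub: "\<rho> ` coh_ann P \<subseteq> coh_ann Q"
  proof (cases "f = \<zero>")
    case False
    then show ?thesis
      unfolding P Q using proj_syzygy_ann[OF assms(1)] by blast
  next
    case True
    have "inj_on to_Q (carrier S)"
    proof (rule inj_onI)
      fix a b assume ab: "a \<in> carrier S" "b \<in> carrier S" "to_Q a = to_Q b"
      then obtain h where "h \<in> carrier S" "a \<ominus> b = h \<otimes> f"
        using principal_coset_eq_iff[OF f_closed ab(1,2)] by blast
      then have "a \<ominus> b = \<zero>" using True by simp
      then show "a = b" using ab(1,2) by simp
    qed
    then have "to_Q \<one> \<in> syzygy_ann Q l" by (rule Q.syzygy_ann_iso[OF _ one])
    then have one': "\<one>\<^bsub>Q\<^esub> \<in> syzygy_ann Q l" unfolding Q.hom_simps(4) .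
    have "a \<in> coh_ann Q" if a: "a \<in> carrier Q" for a
      using Q.R.syzygy_ann_mult[OF one' a] a unfolding Q by auto
    moreover have "\<rho> b \<in> carrier Q" if b: "b \<in> coh_ann P" for b
    proof -
      obtain l' where "b \<in> syzygy_ann P l'" using b unfolding P by blast
      then show ?thesis by (rule R.hom_simps(1)[OF syzygy_ann_closed])
    qed
    ultimately show ?thesis by blast
  qed
  assume "m = 2" "f \<noteq> \<zero>" "c \<in> carrier S" "c \<otimes> (\<one> \<oplus> \<one>) = \<one>"
  then have "to_P y \<in> syzygy_ann P (Suc l)" using y_in_syzygy_ann[OF assms(1) _ one] by blast
  then have "coh_ann Q \<subseteq> \<rho> ` coh_ann P"
    unfolding P Q using syzygy_ann_lifts[OF assms(1) \<open>f \<noteq> \<zero>\<close>] by blast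
  then show "\<rho> ` coh_ann P = coh_ann Q" using sub by blast
qed

end

theorem theorem5p4:
  fixes k :: "('k, 'e) ring_scheme" and n m :: nat and f :: "nat multiset \<Rightarrow> 'k"
    and S :: "(nat multiset \<Rightarrow> 'k) ring"
  assumes "field k"
    and "S = power_series_ring k {..n}"
    and "f \<in> Idl\<^bsub>S\<^esub> (ring.indexed_var k ` {..n})"
    and "m \<ge> 2"
  shows "branched_cover_proj S f ` coh_ann (branched_cover S f m) \<subseteq> coh_ann (hypersurface_ring S f)
    \<and> (m = 2 \<and> f \<noteq> \<zero>\<^bsub>S\<^esub> \<and> \<one>\<^bsub>k\<^esub> \<oplus>\<^bsub>k\<^esub> \<one>\<^bsub>k\<^esub> \<noteq> \<zero>\<^bsub>k\<^esub> \<longrightarrow>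
        branched_cover_proj S f ` coh_ann (branched_cover S f m) = coh_ann (hypersurface_ring S f))"
proof -
  interpret k: field k by fact
  obtain l where dom: "domain S" and fg: "fg_submodules S" and one: "\<one>\<^bsub>S\<^esub> \<in> syzygy_ann S l"
    using power_series_regular[OF assms(1), of n] assms(2) by blast
  interpret S: domain S by (rule dom)
  have vars: "ring.indexed_var k ` {..n} \<subseteq> carrier S"
    using k.indexed_var_closed[of _ "{..n}"] assms(2) by blast
  have f: "f \<in> carrier S"
    by (rule ideal.Icarr[OF S.genideal_ideal[OF vars] assms(3)])
  interpret branched_cover_data S f m by unfold_locales (rule f assms(4))+
  have "branched_cover_proj S f ` coh_ann (branched_cover S f m) = coh_ann (hypersurface_ring S f)"
    if h: "m = 2" "f \<noteq> \<zero>\<^bsub>S\<^esub>" "\<one>\<^bsub>k\<^esub> \<oplus>\<^bsub>k\<^esub> \<one>\<^bsub>k\<^esub> \<noteq> \<zero>\<^bsub>k\<^esub>"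
  proof -
    \<comment> \<open>The inverse of 2 in \<open>k\<close>, which as a constant series is one half
      in \<open>S\<close>.\<close>
    let ?c = "inv\<^bsub>k\<^esub> (\<one>\<^bsub>k\<^esub> \<oplus>\<^bsub>k\<^esub> \<one>\<^bsub>k\<^esub>)"
    have u: "\<one>\<^bsub>k\<^esub> \<oplus>\<^bsub>k\<^esub> \<one>\<^bsub>k\<^esub> \<in> Units k" using h(3) by (simp add: k.field_Units)
    have const: "k.indexed_const \<in> ring_hom k S"
      unfolding assms(2) by (rule k.indexed_const_ring_hom)
    have "k.indexed_const ?c \<otimes>\<^bsub>S\<^esub> (\<one>\<^bsub>S\<^esub> \<oplus>\<^bsub>S\<^esub> \<one>\<^bsub>S\<^esub>) = k.indexed_const (?c \<otimes>\<^bsub>k\<^esub> (\<one>\<^bsub>k\<^esub> \<oplus>\<^bsub>k\<^esub> \<one>\<^bsub>k\<^esub>))"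
      by (simp only: ring_hom_mult[OF const] ring_hom_add[OF const] ring_hom_one[OF const]
          k.Units_inv_closed[OF u] k.Units_closed[OF u] k.one_closed)
    also have "\<dots> = \<one>\<^bsub>S\<^esub>" using u by (simp add: ring_hom_one[OF const])
    finally show ?thesis
      using coh_ann_branched(2)[OF dom fg one h(1,2)] ring_hom_closed[OF const k.Units_inv_closed[OF u]]
      by blast
  qed
  then show ?thesis using coh_ann_branched(1)[OF dom fg one] by blast
qed

end
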